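(* Let $R$ be a unital commutative ring and let $C$ and $C'$ be octonion algebras over $R$ with norms $q_C$ and $q_{C'}$. The following statements are equivalent. (1) The quadratic forms $q_C$ and $q_{C'}$ are isometric. (2) The quadratic forms $q_C$ and $q_{C'}$ are similar. (3) There exist $a,b\in\mathbf{S}_C(R)$ such that $C'$ is isomorphic to $C^{a,b}$. (4) There exists $a\in\mathbf{S}_C(R)$ such that $C'$ is isomorphic to $C^{a,a^{-1}}=C^{a,\overline{a}}$.
   Context: An octonion algebra over $R$ is a unital (not necessarily associative) $R$-algebra $C$ whose underlying module is projective of constant rank 8, endowed with a regular multiplicative quadratic form $q=q_C$, called its norm (regular: the polar form $b_q(x,y)=q(x+y)-q(x)-q(y)$ induces an isomorphism $C\to\mathrm{Hom}_R(C,R)$). Its natural involution is $\overline{x}=b_q(x,1)1-x$. Set $\mathbf{S}_C(R)=\{c\in C\mid q_C(c)=1\}$. For $a,b\in\mathbf{S}_C(R)$ (more generally, $a,b$ invertible in $C$), $C^{a,b}$ is the $R$-module $C$ with multiplication $x*y=(xa)(by)$, where the product on the right is that of $C$; it is again an octonion algebra. "Isomorphic" means isomorphic as $R$-algebras. Two quadratic forms $q,q'$ over $R$ are similar if $q'$ is isometric to $\lambda q$ for some $\lambda\in R^*$. *)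

theory Defs
  imports "HOL-Algebra.Module" "HOL-Algebra.Ideal"
begin

text \<open>
  Modules over a commutative ring are those of \<^theory>\<open>HOL-Algebra.Module\<close>. The record type
  \<^typ>\<open>('r, 'm) module\<close> also has the fields \<^const>\<open>mult\<close> and \<^const>\<open>one\<close>, on which the locale
  \<^locale>\<open>module\<close> puts no condition: they carry the product and the unit of nonassociative
  algebras, and are left unspecified for plain modules.
\<close>

definition linear_maps ::
    "('r, 'x) ring_scheme \<Rightarrow> ('r, 'm, 'y) module_scheme \<Rightarrow> ('r, 'n, 'z) module_scheme \<Rightarrow> ('m \<Rightarrow> 'n) set"
  where "linear_maps R M N = {f \<in> carrier M \<rightarrow> carrier N.
    (\<forall>x\<in>carrier M. \<forall>y\<in>carrier M. f (x \<oplus>\<^bsub>M\<^esub> y) = f x \<oplus>\<^bsub>N\<^esub> f y) \<and>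
    (\<forall>r\<in>carrier R. \<forall>x\<in>carrier M. f (r \<odot>\<^bsub>M\<^esub> x) = r \<odot>\<^bsub>N\<^esub> f x)}"

definition module_isomorphic ::
    "('r, 'x) ring_scheme \<Rightarrow> ('r, 'm, 'y) module_scheme \<Rightarrow> ('r, 'n, 'z) module_scheme \<Rightarrow> bool"
  where "module_isomorphic R M N \<longleftrightarrow>
    (\<exists>f\<in>linear_maps R M N. bij_betw f (carrier M) (carrier N))"

definition self_module :: "('r, 'x) ring_scheme \<Rightarrow> ('r, 'r) module"
  where "self_module R =
    \<lparr>carrier = carrier R, mult = mult R, one = \<one>\<^bsub>R\<^esub>, zero = \<zero>\<^bsub>R\<^esub>,
     add = add R, smult = mult R\<rparr>"

definition free_module :: "('r, 'x) ring_scheme \<Rightarrow> nat \<Rightarrow> ('r, nat \<Rightarrow> 'r) module"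
  where "free_module R n =
    \<lparr>carrier = {..<n} \<rightarrow>\<^sub>E carrier R,
     mult = undefined, one = undefined,
     zero = (\<lambda>i\<in>{..<n}. \<zero>\<^bsub>R\<^esub>),
     add = (\<lambda>v w. \<lambda>i\<in>{..<n}. v i \<oplus>\<^bsub>R\<^esub> w i),
     smult = (\<lambda>r v. \<lambda>i\<in>{..<n}. r \<otimes>\<^bsub>R\<^esub> v i)\<rparr>"

text \<open>
  The rank is taken for finitely generated projective modules, i.e. direct summands of some
  \<open>R\<^sup>n\<close>; a projective module of constant finite rank is always finitely generated.
\<close>

definition fg_projective :: "('r, 'x) ring_scheme \<Rightarrow> ('r, 'm, 'y) module_scheme \<Rightarrow> bool"
  where "fg_projective R M \<longleftrightarrow>
    (\<exists>n. \<exists>i\<in>linear_maps R M (free_module R n). \<exists>p\<in>linear_maps R (free_module R n) M.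
      \<forall>x\<in>carrier M. p (i x) = x)"


subsection \<open>Localization and rank\<close>

text \<open>
  The fraction \<open>m / s\<close> is the class of \<open>(m, s)\<close> in \<open>M \<times> S\<close>. Operations on fractions are
  defined through representatives; for a multiplicative set \<open>S\<close> all members of the indexed
  unions below coincide.
\<close>

definition fraction ::
    "('r, 'm, 'y) module_scheme \<Rightarrow> 'r set \<Rightarrow> 'm \<Rightarrow> 'r \<Rightarrow> ('m \<times> 'r) set"
  where "fraction M S m s = {(m', s'). m' \<in> carrier M \<and> s' \<in> S \<and>
    (\<exists>u\<in>S. u \<odot>\<^bsub>M\<^esub> (s' \<odot>\<^bsub>M\<^esub> m) = u \<odot>\<^bsub>M\<^esub> (s \<odot>\<^bsub>M\<^esub> m'))}"

definition localized_ring :: "('r, 'x) ring_scheme \<Rightarrow> 'r set \<Rightarrow> ('r \<times> 'r) set ring"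
  where "localized_ring R S =
    (let frac = fraction (self_module R) S in
    \<lparr>carrier = {frac a s |a s. a \<in> carrier R \<and> s \<in> S},
     mult = (\<lambda>X Y. \<Union>(a, s)\<in>X. \<Union>(b, t)\<in>Y. frac (a \<otimes>\<^bsub>R\<^esub> b) (s \<otimes>\<^bsub>R\<^esub> t)),
     one = frac \<one>\<^bsub>R\<^esub> \<one>\<^bsub>R\<^esub>,
     zero = frac \<zero>\<^bsub>R\<^esub> \<one>\<^bsub>R\<^esub>,
     add = (\<lambda>X Y. \<Union>(a, s)\<in>X. \<Union>(b, t)\<in>Y.
       frac (t \<otimes>\<^bsub>R\<^esub> a \<oplus>\<^bsub>R\<^esub> s \<otimes>\<^bsub>R\<^esub> b) (s \<otimes>\<^bsub>R\<^esub> t))\<rparr>)"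

definition localized_module ::
    "('r, 'x) ring_scheme \<Rightarrow> 'r set \<Rightarrow> ('r, 'm, 'y) module_scheme \<Rightarrow>
      (('r \<times> 'r) set, ('m \<times> 'r) set) module"
  where "localized_module R S M =
    \<lparr>carrier = {fraction M S m s |m s. m \<in> carrier M \<and> s \<in> S},
     mult = undefined, one = undefined,
     zero = fraction M S \<zero>\<^bsub>M\<^esub> \<one>\<^bsub>R\<^esub>,
     add = (\<lambda>X Y. \<Union>(m, s)\<in>X. \<Union>(n, t)\<in>Y.
       fraction M S (t \<odot>\<^bsub>M\<^esub> m \<oplus>\<^bsub>M\<^esub> s \<odot>\<^bsub>M\<^esub> n) (s \<otimes>\<^bsub>R\<^esub> t)),
     smult = (\<lambda>A X. \<Union>(a, s)\<in>A. \<Union>(m, t)\<in>X. fraction M S (a \<odot>\<^bsub>M\<^esub> m) (s \<otimes>\<^bsub>R\<^esub> t))\<rparr>"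

definition has_constant_rank ::
    "('r, 'x) ring_scheme \<Rightarrow> ('r, 'm, 'y) module_scheme \<Rightarrow> nat \<Rightarrow> bool"
  where "has_constant_rank R M n \<longleftrightarrow>
    (\<forall>P. primeideal P R \<longrightarrow>
      (let S = carrier R - P in
       module_isomorphic (localized_ring R S) (localized_module R S M)
         (free_module (localized_ring R S) n)))"


subsection \<open>Quadratic forms\<close>

definition polar ::
    "('r, 'x) ring_scheme \<Rightarrow> ('r, 'm, 'y) module_scheme \<Rightarrow> ('m \<Rightarrow> 'r) \<Rightarrow> 'm \<Rightarrow> 'm \<Rightarrow> 'r"
  where "polar R M q x y = q (x \<oplus>\<^bsub>M\<^esub> y) \<ominus>\<^bsub>R\<^esub> q x \<ominus>\<^bsub>R\<^esub> q y"

locale quadratic_form = module R M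
  for R :: "('r, 'x) ring_scheme" (structure) and M :: "('r, 'm, 'y) module_scheme" (structure) +
  fixes q :: "'m \<Rightarrow> 'r"
  assumes q_closed: "x \<in> carrier M \<Longrightarrow> q x \<in> carrier R"
    and q_smult: "\<lbrakk>r \<in> carrier R; x \<in> carrier M\<rbrakk> \<Longrightarrow>
      q (r \<odot>\<^bsub>M\<^esub> x) = (r \<otimes>\<^bsub>R\<^esub> r) \<otimes>\<^bsub>R\<^esub> q x"
    and polar_linear_left: "y \<in> carrier M \<Longrightarrow>
      (\<lambda>x. polar R M q x y) \<in> linear_maps R M (self_module R)"
    and polar_linear_right: "x \<in> carrier M \<Longrightarrow>
      (\<lambda>y. polar R M q x y) \<in> linear_maps R M (self_module R)"

text \<open>
  The dual module consists of the linear forms on \<open>M\<close>, taken extensional so that two forms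
  which agree on the carrier are equal.
\<close>

locale regular_quadratic_form = quadratic_form +
  assumes polar_bij: "bij_betw (\<lambda>x. \<lambda>y\<in>carrier M. polar R M q x y) (carrier M)
    (linear_maps R M (self_module R) \<inter> extensional (carrier M))"

definition isometric ::
    "('r, 'x) ring_scheme \<Rightarrow> ('r, 'm, 'y) module_scheme \<Rightarrow> ('m \<Rightarrow> 'r) \<Rightarrow>
      ('r, 'n, 'z) module_scheme \<Rightarrow> ('n \<Rightarrow> 'r) \<Rightarrow> bool"
  where "isometric R M q N q' \<longleftrightarrow>
    (\<exists>f\<in>linear_maps R M N. bij_betw f (carrier M) (carrier N) \<and>
      (\<forall>x\<in>carrier M. q' (f x) = q x))"

definition similar ::
    "('r, 'x) ring_scheme \<Rightarrow> ('r, 'm, 'y) module_scheme \<Rightarrow> ('m \<Rightarrow> 'r) \<Rightarrow>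
      ('r, 'n, 'z) module_scheme \<Rightarrow> ('n \<Rightarrow> 'r) \<Rightarrow> bool"
  where "similar R M q N q' \<longleftrightarrow>
    (\<exists>l\<in>Units R. isometric R N q' M (\<lambda>x. l \<otimes>\<^bsub>R\<^esub> q x))"


subsection \<open>Octonion algebras\<close>

locale nonassoc_algebra = module R C
  for R :: "('r, 'x) ring_scheme" (structure) and C :: "('r, 'c, 'y) module_scheme" (structure) +
  assumes mult_closed: "\<lbrakk>x \<in> carrier C; y \<in> carrier C\<rbrakk> \<Longrightarrow> x \<otimes>\<^bsub>C\<^esub> y \<in> carrier C"
    and unit_closed: "\<one>\<^bsub>C\<^esub> \<in> carrier C"
    and mult_unit_left: "x \<in> carrier C \<Longrightarrow> \<one>\<^bsub>C\<^esub> \<otimes>\<^bsub>C\<^esub> x = x"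
    and mult_unit_right: "x \<in> carrier C \<Longrightarrow> x \<otimes>\<^bsub>C\<^esub> \<one>\<^bsub>C\<^esub> = x"
    and mult_linear_left: "y \<in> carrier C \<Longrightarrow> (\<lambda>x. x \<otimes>\<^bsub>C\<^esub> y) \<in> linear_maps R C C"
    and mult_linear_right: "x \<in> carrier C \<Longrightarrow> (\<lambda>y. x \<otimes>\<^bsub>C\<^esub> y) \<in> linear_maps R C C"

locale octonion_algebra = nonassoc_algebra R C + regular_quadratic_form R C q
  for R :: "('r, 'x) ring_scheme" (structure) and C :: "('r, 'c, 'y) module_scheme" (structure)
    and q :: "'c \<Rightarrow> 'r" +
  assumes projective: "fg_projective R C"
    and rank_8: "has_constant_rank R C 8"
    and q_mult: "\<lbrakk>x \<in> carrier C; y \<in> carrier C\<rbrakk> \<Longrightarrow> q (x \<otimes>\<^bsub>C\<^esub> y) = q x \<otimes>\<^bsub>R\<^esub> q y"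

definition conjugate ::
    "('r, 'x) ring_scheme \<Rightarrow> ('r, 'c, 'y) module_scheme \<Rightarrow> ('c \<Rightarrow> 'r) \<Rightarrow> 'c \<Rightarrow> 'c"
  where "conjugate R C q x = polar R C q x \<one>\<^bsub>C\<^esub> \<odot>\<^bsub>C\<^esub> \<one>\<^bsub>C\<^esub> \<ominus>\<^bsub>C\<^esub> x"

definition norm_one ::
    "('r, 'x) ring_scheme \<Rightarrow> ('r, 'c, 'y) module_scheme \<Rightarrow> ('c \<Rightarrow> 'r) \<Rightarrow> 'c set"
  where "norm_one R C q = {c \<in> carrier C. q c = \<one>\<^bsub>R\<^esub>}"

text \<open>
  Inverses in \<open>C\<close> are written with \<^const>\<open>m_inv\<close>, which only asks for a two-sided inverse and
  is meaningful without associativity since such inverses are unique in an octonion algebra.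
  The unit of the isotope \<open>C\<^sup>a\<^sup>,\<^sup>b\<close> is \<open>(a b)\<^sup>-\<^sup>1 = b\<^sup>-\<^sup>1 a\<^sup>-\<^sup>1\<close>.
\<close>

definition isotope ::
    "('r, 'c, 'y) module_scheme \<Rightarrow> 'c \<Rightarrow> 'c \<Rightarrow> ('r, 'c, 'y) module_scheme"
  where "isotope C a b =
    C\<lparr>mult := (\<lambda>x y. (x \<otimes>\<^bsub>C\<^esub> a) \<otimes>\<^bsub>C\<^esub> (b \<otimes>\<^bsub>C\<^esub> y)), one := inv\<^bsub>C\<^esub> (a \<otimes>\<^bsub>C\<^esub> b)\<rparr>"

definition algebra_isomorphic ::
    "('r, 'x) ring_scheme \<Rightarrow> ('r, 'c, 'y) module_scheme \<Rightarrow> ('r, 'd, 'z) module_scheme \<Rightarrow> bool"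
  where "algebra_isomorphic R C D \<longleftrightarrow>
    (\<exists>f\<in>linear_maps R C D. bij_betw f (carrier C) (carrier D) \<and> f \<one>\<^bsub>C\<^esub> = \<one>\<^bsub>D\<^esub> \<and>
      (\<forall>x\<in>carrier C. \<forall>y\<in>carrier C. f (x \<otimes>\<^bsub>C\<^esub> y) = f x \<otimes>\<^bsub>D\<^esub> f y))"

end

theory Submission
  imports "HOL-Algebra.Ring_Divisibility" Defs
begin

text \<open>
  An isomorphism from \<open>C'\<close> to an isotope of \<open>C\<close> is an isometry since a composition algebra of rank
  8 determines its norm. Conversely, a similitude between the norms can be corrected to an isometry
  that maps unit to unit, and then there are two composition products \<open>x y\<close> and \<open>x \<circ> y\<close> with the
  same norm and unit on the same module. Locally one finds \<open>u\<close> with \<open>q u\<close> invertible and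
  \<open>(x \<circ> y) u = x (y u)\<close>, or the same for the opposite of \<open>\<circ>\<close>: the relations
  \<open>x (\<^bold>y w) + y (\<^bold>x w) = b(x, y) w\<close>, with bold letters for conjugates, let the same
  Clifford algebra act through both products, and its two half-spin representations account for
  the two cases. Such a \<open>u\<close> is
  unique up to scalars, because the nucleus of an octonion algebra consists of scalars. By the
  left Moufang identity, \<open>x \<mapsto> u\<^sup>-\<^sup>1 x u\<close>, preceded by conjugation in the opposite case, carries \<open>\<circ>\<close> to the
  product of the isotope at \<open>a = \<^bold>u\<^sup>2 / q u\<close> and \<open>a\<^sup>-\<^sup>1\<close>. The map and \<open>a\<close> are unchanged when \<open>u\<close> is
  scaled, so the local solutions glue.
\<close>

section \<open>Composition algebras\<close>

text \<open>Apart from reading off the rank, nothing is localized or divided. A local inverse is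
  replaced by an explicit multiplier such as \<open>disc x\<close>, \<open>hgt x y z\<close> or
  \<open>q u\<close> that stays in the conclusion, and one principle removes the multipliers: an
  ideal contained in no prime avoiding the idempotent \<open>e\<close> contains \<open>e\<close>.
  Since 2 may lie in some primes and not in others, a basis of eight is not built from three
  imaginary elements. It starts from an \<open>x\<close> with \<open>disc x\<close> outside the
  prime, which generates a separable quadratic algebra in every characteristic, and doubles twice.
  Which half-spin alternative occurs can change from prime to prime. It appears as the root of a
  quadratic equation, \<open>c * (c + h * q v) = 0\<close> up to a power of \<open>h\<close>, whose
  two roots are distinct where \<open>h\<close> and \<open>q v\<close> are invertible. A type cannot
  depend on a ring given by its carrier. The computations therefore live in a product of rings, and
  \<open>e\<close> picks out the factor that belongs to the given algebra; this is why
  \<open>e\<close> stands in the conclusions where 1 is expected.\<close>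

locale composition_algebra =
  fixes sc :: "'r::comm_ring_1 \<Rightarrow> 'm::ab_group_add \<Rightarrow> 'm" (infixr "\<cdot>" 75)
    and mu :: "'m \<Rightarrow> 'm \<Rightarrow> 'm" (infixl "\<bullet>" 70)
    and un :: 'm
    and q :: "'m \<Rightarrow> 'r"
  assumes sc_add: "r \<cdot> (x + y) = r \<cdot> x + r \<cdot> y"
    and add_sc: "(r + s) \<cdot> x = r \<cdot> x + s \<cdot> x"
    and sc_sc: "r \<cdot> s \<cdot> x = (r * s) \<cdot> x"
    and one_sc: "1 \<cdot> x = x"
    and add_mu: "(x + y) \<bullet> z = x \<bullet> z + y \<bullet> z"
    and mu_add: "x \<bullet> (y + z) = x \<bullet> y + x \<bullet> z"
    and sc_mu: "(r \<cdot> x) \<bullet> y = r \<cdot> (x \<bullet> y)"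
    and mu_sc: "x \<bullet> (r \<cdot> y) = r \<cdot> (x \<bullet> y)"
    and un_mu: "un \<bullet> x = x"
    and mu_un: "x \<bullet> un = x"
    and q_sc: "q (r \<cdot> x) = r * r * q x"
    and polar_add: "q (x + y + z) - q (x + y) - q z = (q (x + z) - q x - q z) + (q (y + z) - q y - q z)"
    and polar_sc: "q (r \<cdot> x + y) - q (r \<cdot> x) - q y = r * (q (x + y) - q x - q y)"
    and q_mu: "q (x \<bullet> y) = q x * q y"
    and q_un: "q un = 1"
    and nondegenerate: "(\<And>y. q (x + y) - q x - q y = 0) \<Longrightarrow> x = 0"
begin

section \<open>Polar form, conjugation and the identities of a composition algebra\<close>

definition b :: "'m \<Rightarrow> 'm \<Rightarrow> 'r" where "b x y = q (x + y) - q x - q y"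

definition cj :: "'m \<Rightarrow> 'm" where "cj x = b x un \<cdot> un - x"

lemma sc_zero [simp]: "r \<cdot> 0 = 0"
  using sc_add[of r 0 0] by simp

lemma zero_sc [simp]: "0 \<cdot> x = 0"
  using add_sc[of 0 0 x] by simp

lemma sc_minus: "r \<cdot> (- x) = - (r \<cdot> x)"
  using sc_add[of r x "- x"] by (simp add: eq_neg_iff_add_eq_0 add.commute)

lemma minus_sc: "(- r) \<cdot> x = - (r \<cdot> x)"
  using add_sc[of r "- r" x] by (simp add: eq_neg_iff_add_eq_0 add.commute)

lemma sc_diff: "r \<cdot> (x - y) = r \<cdot> x - r \<cdot> y"
  using sc_add[of r x "- y"] by (simp add: sc_minus)

lemma diff_sc: "(r - s) \<cdot> x = r \<cdot> x - s \<cdot> x"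
  using add_sc[of r "- s" x] by (simp add: minus_sc)

lemma two_sc: "2 \<cdot> x = x + x"
  using add_sc[of 1 1 x] by (simp add: one_sc)

lemma mu_zero [simp]: "x \<bullet> 0 = 0"
  using mu_add[of x 0 0] by simp

lemma zero_mu [simp]: "0 \<bullet> x = 0"
  using add_mu[of 0 0 x] by simp

lemma mu_minus: "x \<bullet> (- y) = - (x \<bullet> y)"
  using mu_add[of x y "- y"] by (simp add: eq_neg_iff_add_eq_0 add.commute)

lemma minus_mu: "(- x) \<bullet> y = - (x \<bullet> y)"
  using add_mu[of x "- x" y] by (simp add: eq_neg_iff_add_eq_0 add.commute)

lemma mu_diff: "x \<bullet> (y - z) = x \<bullet> y - x \<bullet> z"
  using mu_add[of x y "- z"] by (simp add: mu_minus)

lemma diff_mu: "(x - y) \<bullet> z = x \<bullet> z - y \<bullet> z"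
  using add_mu[of x "- y" z] by (simp add: minus_mu)

lemmas sc_simps = sc_add add_sc sc_minus minus_sc sc_diff diff_sc sc_sc one_sc
lemmas mu_simps = add_mu mu_add sc_mu mu_sc mu_minus minus_mu mu_diff diff_mu un_mu mu_un
lemmas lin = sc_simps mu_simps

lemma b_commute: "b x y = b y x"
  by (simp add: b_def add.commute)

lemma b_add: "b (x + y) z = b x z + b y z"
  unfolding b_def using polar_add[of x y z] .

lemma b_sc: "b (r \<cdot> x) y = r * b x y"
  unfolding b_def by (rule polar_sc)

lemma add_b: "b z (x + y) = b z x + b z y"
  using b_add[of x y z] by (simp add: b_commute)

lemma sc_b: "b y (r \<cdot> x) = r * b y x"
  using b_sc[of r x y] by (simp add: b_commute)

lemma b_zero [simp]: "b 0 y = 0" "b y 0 = 0"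
  using b_sc[of 0 0 y] sc_b[of y 0 0] by auto

lemma b_minus: "b (- x) y = - b x y" "b y (- x) = - b y x"
  using b_add[of x "- x" y] add_b[of y x "- x"] by (simp_all add: eq_neg_iff_add_eq_0 add.commute)

lemma b_diff: "b (x - y) z = b x z - b y z" "b z (x - y) = b z x - b z y"
  using b_add[of x "- y" z] add_b[of z x "- y"] by (simp_all add: b_minus)

lemmas b_lin = b_add add_b b_sc sc_b b_minus b_diff

lemma b_ext: "(\<And>z. b x z = b y z) \<Longrightarrow> x = y"
  using nondegenerate[of "x - y"] by (simp add: b_diff flip: b_def)

lemma q_add: "q (x + y) = q x + q y + b x y"
  by (simp add: b_def)

lemma q_zero [simp]: "q 0 = 0"
  using q_sc[of 0 0] by simp

lemma q_minus: "q (- x) = q x"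
proof -
  have "(- 1) \<cdot> x = - x" by (simp add: minus_sc one_sc)
  then show ?thesis using q_sc[of "- 1" x] by simp
qed

lemma q_diff: "q (x - y) = q x + q y - b x y"
  using q_add[of x "- y"] by (simp add: q_minus b_minus)

lemma b_self: "b x x = 2 * q x"
proof -
  have "q (x + x) = 4 * q x" using q_sc[of 2 x] by (simp add: two_sc)
  then show ?thesis by (simp add: b_def)
qed

lemma b_mu_left: "b (x \<bullet> y) (x \<bullet> z) = q x * b y z"
  by (simp add: b_def q_mu algebra_simps flip: mu_add)

lemma b_mu_right: "b (x \<bullet> z) (y \<bullet> z) = b x y * q z"
  by (simp add: b_def q_mu algebra_simps flip: add_mu)

text \<open>Polarize \<open>b_mu_left\<close> in its left factor. With one argument equal to the
  unit, this says that multiplication by \<open>cj x\<close> is adjoint to multiplication by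
  \<open>x\<close>, and nondegeneracy turns such adjunctions into the identities below.\<close>

lemma b_exchange: "b (x \<bullet> y) (z \<bullet> w) + b (x \<bullet> w) (z \<bullet> y) = b x z * b y w"
  using b_mu_left[of "x + z" y w] b_mu_left[of x y w] b_mu_left[of z y w]
  by (simp add: add_mu b_lin q_add b_commute algebra_simps)

lemma b_cj: "b (cj x) y = b x un * b un y - b x y" "b y (cj x) = b x un * b y un - b y x"
  by (simp_all add: cj_def b_lin)

lemma cj_cj [simp]: "cj (cj x) = x"
  by (simp add: cj_def b_lin b_self q_un lin algebra_simps)

lemma cj_add: "cj (x + y) = cj x + cj y"
  and cj_sc: "cj (r \<cdot> x) = r \<cdot> cj x"
  and cj_un [simp]: "cj un = un"
  by (simp_all add: cj_def b_lin lin algebra_simps b_self q_un two_sc)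

lemma b_un_cj [simp]: "b (cj x) un = b x un"
  by (simp add: b_cj b_self q_un)

lemma b_cj_cj: "b (cj x) (cj y) = b x y"
  by (simp add: b_cj b_self q_un b_commute)

lemma q_cj: "q (cj x) = q x"
  by (simp add: cj_def q_diff q_sc q_un b_lin b_commute)

lemma adj_left: "b (x \<bullet> y) z = b y (cj x \<bullet> z)"
  using b_exchange[of x y un z] by (simp add: un_mu cj_def lin b_lin b_commute algebra_simps)

lemma adj_right: "b (y \<bullet> x) z = b y (z \<bullet> cj x)"
  using b_exchange[of y x z un] by (simp add: mu_un cj_def lin b_lin b_commute algebra_simps)

lemma cj_mu_mu: "cj x \<bullet> (x \<bullet> y) = q x \<cdot> y"
  by (rule b_ext) (simp add: adj_left[of "cj x"] b_mu_left b_lin)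

lemma mu_cj_mu: "x \<bullet> (cj x \<bullet> y) = q x \<cdot> y"
  using cj_mu_mu[of "cj x" y] by (simp add: q_cj)

lemma mu_mu_cj: "(y \<bullet> x) \<bullet> cj x = q x \<cdot> y"
  by (rule b_ext) (simp add: adj_right[of _ "cj x"] b_mu_right b_lin mult.commute)

lemma mu_cj_mu_right: "(y \<bullet> cj x) \<bullet> x = q x \<cdot> y"
  using mu_mu_cj[of y "cj x"] by (simp add: q_cj)

lemma mu_cj: "x \<bullet> cj x = q x \<cdot> un" and cj_mu: "cj x \<bullet> x = q x \<cdot> un"
  using mu_mu_cj[of un x] cj_mu_mu[of x un] by (simp_all add: lin)

lemma clifford: "x \<bullet> (cj y \<bullet> w) + y \<bullet> (cj x \<bullet> w) = b x y \<cdot> w"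
  using mu_cj_mu[of "x + y" w] mu_cj_mu[of x w] mu_cj_mu[of y w]
  by (simp add: cj_add q_add lin algebra_simps)

lemma clifford_right: "(w \<bullet> cj y) \<bullet> x + (w \<bullet> cj x) \<bullet> y = b x y \<cdot> w"
  using mu_cj_mu_right[of w "x + y"] mu_cj_mu_right[of w x] mu_cj_mu_right[of w y]
  by (simp add: cj_add q_add lin algebra_simps)

lemma cj_mult: "cj (x \<bullet> y) = cj y \<bullet> cj x"
proof (rule b_ext)
  fix z
  have "b (cj (x \<bullet> y)) z = b (x \<bullet> y) (cj z)"
    using b_cj_cj[of "x \<bullet> y" "cj z"] by simp
  also have "\<dots> = b y (cj x \<bullet> cj z)" by (rule adj_left)
  also have "\<dots> = b (y \<bullet> z) (cj x)" by (simp add: adj_right)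
  also have "\<dots> = b (cj y \<bullet> cj x) z" by (simp add: adj_left b_commute)
  finally show "b (cj (x \<bullet> y)) z = b (cj y \<bullet> cj x) z" .
qed

lemma square: "x \<bullet> (x \<bullet> w) = b x un \<cdot> (x \<bullet> w) - q x \<cdot> w"
  using cj_mu_mu[of x w] by (simp add: cj_def lin algebra_simps)

lemma square_right: "(w \<bullet> x) \<bullet> x = b x un \<cdot> (w \<bullet> x) - q x \<cdot> w"
  using mu_mu_cj[of w x] by (simp add: cj_def lin algebra_simps)

lemma mu_self: "x \<bullet> x = b x un \<cdot> x - q x \<cdot> un"
  using square[of x un] by (simp add: lin)

lemma left_alternative: "(x \<bullet> x) \<bullet> w = x \<bullet> (x \<bullet> w)"
  by (simp add: square mu_self lin)

lemma right_alternative: "w \<bullet> (x \<bullet> x) = (w \<bullet> x) \<bullet> x"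
  by (simp add: square_right mu_self lin)

lemma flexible: "(x \<bullet> y) \<bullet> x = x \<bullet> (y \<bullet> x)"
proof -
  have "(x \<bullet> y) \<bullet> x = b x (cj y) \<cdot> x - q x \<cdot> cj y"
    using clifford_right[of x "cj y" x] by (simp add: mu_cj mu_sc sc_mu un_mu algebra_simps mu_un)
  moreover have "x \<bullet> (y \<bullet> x) = b x (cj y) \<cdot> x - q x \<cdot> cj y"
    using clifford[of x "cj y" x] by (simp add: cj_mu lin algebra_simps)
  ultimately show ?thesis by simp
qed

lemma flexible_cj: "(cj x \<bullet> y) \<bullet> x = cj x \<bullet> (y \<bullet> x)"
  by (simp add: cj_def lin flexible)

lemma sandwich: "(x \<bullet> y) \<bullet> x = b x (cj y) \<cdot> x - q x \<cdot> cj y"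
  using clifford_right[of x "cj y" x] by (simp add: mu_cj lin algebra_simps b_commute)

text \<open>By \<open>clifford\<close>, \<open>x \<bullet> (a \<bullet> w)\<close> is a multiple of
  \<open>w\<close> minus \<open>cj a \<bullet> (cj x \<bullet> w)\<close>. A further factor
  \<open>a\<close> on the left cancels \<open>cj a\<close> up to \<open>q a\<close>, and
  \<open>sandwich\<close> recognizes what remains.\<close>

lemma left_moufang: "((a \<bullet> x) \<bullet> a) \<bullet> w = a \<bullet> (x \<bullet> (a \<bullet> w))"
proof -
  have "x \<bullet> (a \<bullet> w) = b x (cj a) \<cdot> w - cj a \<bullet> (cj x \<bullet> w)"
    using clifford[of x "cj a" w] by (simp add: algebra_simps)
  then show ?thesis by (simp add: sandwich lin mu_cj_mu b_cj b_commute mult.commute)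
qed

section \<open>Imaginary elements and Cayley-Dickson doubling\<close>

definition imag :: "'m \<Rightarrow> bool" where "imag f \<longleftrightarrow> b f un = 0"

lemma imag_cj: "imag f \<Longrightarrow> cj f = - f"
  by (simp add: imag_def cj_def)

lemma imag_imag: "imag f \<Longrightarrow> imag g \<Longrightarrow> f \<bullet> (g \<bullet> w) = - (b f g \<cdot> w) - g \<bullet> (f \<bullet> w)"
proof -
  assume "imag f" "imag g"
  then have *: "b f g \<cdot> w = - (f \<bullet> (g \<bullet> w)) - g \<bullet> (f \<bullet> w)"
    using clifford[of f g w] by (simp add: imag_cj mu_minus minus_mu)
  show ?thesis unfolding * by simp
qed

lemma imag_swap: "imag f \<Longrightarrow> imag g \<Longrightarrow> b f g = 0 \<Longrightarrow> f \<bullet> (g \<bullet> w) = - (g \<bullet> (f \<bullet> w))"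
  using imag_imag[of f g w] by simp

lemma imag_square: "imag f \<Longrightarrow> f \<bullet> (f \<bullet> w) = - (q f \<cdot> w)"
  by (simp add: square imag_def)

lemma imag_any: "imag f \<Longrightarrow> b x f = 0 \<Longrightarrow> f \<bullet> (x \<bullet> w) = b x un \<cdot> (f \<bullet> w) - x \<bullet> (f \<bullet> w)"
  using clifford[of x f w] by (simp add: imag_def cj_def lin algebra_simps)

lemma imag_any_cj: "imag f \<Longrightarrow> b x f = 0 \<Longrightarrow> f \<bullet> (x \<bullet> w) = cj x \<bullet> (f \<bullet> w)"
  by (simp add: imag_any cj_def lin)

lemma imag_any_right: "imag f \<Longrightarrow> b x f = 0 \<Longrightarrow> f \<bullet> x = b x un \<cdot> f - x \<bullet> f"
  using imag_any[of f x un] by (simp add: mu_un)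

lemma imag_mu: "imag f \<Longrightarrow> b x f = 0 \<Longrightarrow> imag (x \<bullet> f)"
  using adj_left[of x f un] by (simp add: imag_def b_lin mu_un b_cj b_commute)

text \<open>By \<open>imag_any_cj\<close>, \<open>e\<close> moves past a factor orthogonal to it by
  conjugating that factor, and conjugation reverses products. This is the product rule of the
  Cayley-Dickson process.\<close>

lemma doubling:
  assumes "imag e" "b e a = 0" "b e c = 0" "b e (c \<bullet> a) = 0"
  shows "a \<bullet> (c \<bullet> e) = (c \<bullet> a) \<bullet> e"
proof -
  have ce: "c \<bullet> e = e \<bullet> cj c"
    using imag_any_cj[of e c un] assms by (simp add: cj_def lin b_commute imag_any algebra_simps)
  have "a \<bullet> (c \<bullet> e) = e \<bullet> (cj a \<bullet> cj c)"
    using imag_any_cj[of e "cj a" "cj c"] assms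
    by (simp add: ce b_cj imag_def b_commute)
  also have "\<dots> = e \<bullet> cj (c \<bullet> a)" by (simp add: cj_mult)
  also have "\<dots> = (c \<bullet> a) \<bullet> e"
    using imag_any_cj[of e "cj (c \<bullet> a)" un] assms by (simp add: b_cj imag_def b_commute mu_un)
  finally show ?thesis .
qed

section \<open>Bases of eight elements and expansion in them\<close>

definition disc :: "'m \<Rightarrow> 'r" where "disc x = 4 * q x - b x un * b x un"

text \<open>A Cayley triple in which only \<open>y\<close> and \<open>z\<close> have to be
  imaginary. In characteristic 2 an imaginary \<open>x\<close> would have discriminant zero, so the
  trace of \<open>x\<close> is left free.\<close>

definition basic :: "'m \<Rightarrow> 'm \<Rightarrow> 'm \<Rightarrow> bool"
  where "basic x y z \<longleftrightarrow> imag y \<and> b x y = 0 \<and> imag z \<and> b x z = 0 \<and> b y z = 0 \<and> b (x \<bullet> y) z = 0"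

definition orth8 :: "'m \<Rightarrow> 'm \<Rightarrow> 'm \<Rightarrow> 'm \<Rightarrow> bool"
  where "orth8 x y z v \<longleftrightarrow> b v un = 0 \<and> b v x = 0 \<and> b v y = 0 \<and> b v (x \<bullet> y) = 0
    \<and> b v z = 0 \<and> b v (x \<bullet> z) = 0 \<and> b v (y \<bullet> z) = 0 \<and> b v (x \<bullet> (y \<bullet> z)) = 0"

text \<open>The Gram determinant of \<open>f\<close> and \<open>x \<bullet> f\<close> is
  \<open>disc x * q f * q f\<close>. For a basic triple the planes obtained from \<open>un\<close>,
  \<open>y\<close>, \<open>z\<close> and \<open>y \<bullet> z\<close> are mutually orthogonal, so
  the Gram determinant of the eight elements is the fourth power of
  \<open>hgt x y z\<close>.\<close>

definition hgt :: "'m \<Rightarrow> 'm \<Rightarrow> 'm \<Rightarrow> 'r" where "hgt x y z = disc x * q y * q z"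

lemma q_disc: "q (2 \<cdot> x - b x un \<cdot> un) = disc x"
  by (simp add: disc_def q_diff q_sc b_lin q_un algebra_simps)

lemma b_mu_cross: "imag f \<Longrightarrow> b x f = 0 \<Longrightarrow> b (x \<bullet> f) g = b x un * b f g - b f (x \<bullet> g)"
  by (simp add: adj_left cj_def lin b_lin)

lemma basic_yz:
  assumes "basic x y z"
  shows "imag (y \<bullet> z)" "b x (y \<bullet> z) = 0" "b y (y \<bullet> z) = 0" "b (x \<bullet> y) (y \<bullet> z) = 0"
    "b z (y \<bullet> z) = 0" "b (x \<bullet> z) (y \<bullet> z) = 0" "b (x \<bullet> z) y = 0" "b (x \<bullet> y) z = 0"
    "b (x \<bullet> (y \<bullet> z)) y = 0" "b (x \<bullet> (y \<bullet> z)) z = 0"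
proof -
  have i: "imag y" "imag z" and o: "b x y = 0" "b x z = 0" "b y z = 0" "b (x \<bullet> y) z = 0"
    using assms by (auto simp: basic_def)
  show "imag (y \<bullet> z)" using i o by (intro imag_mu) auto
  have yx: "y \<bullet> x = b x un \<cdot> y - x \<bullet> y" using imag_any_right i o by blast
  show xyz: "b x (y \<bullet> z) = 0"
    using adj_left[of y z x] i o by (simp add: imag_cj lin b_lin yx b_commute)
  show "b y (y \<bullet> z) = 0"
    using b_mu_left[of y un z] i by (simp add: mu_un imag_def b_commute)
  show "b z (y \<bullet> z) = 0"
    using b_mu_right[of un z y] i by (simp add: un_mu imag_def b_commute)
  show xzy: "b (x \<bullet> z) y = 0"
    using b_mu_cross[OF i(2) o(2), of y] o(3,4) by (simp add: b_commute[of z])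
  show "b (x \<bullet> y) z = 0" by (fact o)
  have zy: "y \<bullet> z = - (z \<bullet> y)" using imag_swap[of y z un] i o by (simp add: mu_un)
  show "b (x \<bullet> z) (y \<bullet> z) = 0"
    using b_mu_right[of x z y] o by simp
  have "b (x \<bullet> y) (z \<bullet> y) = b x z * q y" by (rule b_mu_right)
  then show xyyz: "b (x \<bullet> y) (y \<bullet> z) = 0" using o by (simp add: zy b_lin)
  show "b (x \<bullet> (y \<bullet> z)) y = 0"
    using b_mu_cross[OF \<open>imag (y \<bullet> z)\<close> xyz, of y] \<open>b y (y \<bullet> z) = 0\<close> xyyz
    by (simp add: b_commute[of "y \<bullet> z"])
  show "b (x \<bullet> (y \<bullet> z)) z = 0"
    using b_mu_cross[OF \<open>imag (y \<bullet> z)\<close> xyz, of z] \<open>b z (y \<bullet> z) = 0\<close>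
      \<open>b (x \<bullet> z) (y \<bullet> z) = 0\<close>
    by (simp add: b_commute[of "y \<bullet> z"])
qed

lemma b_plane: "b f (x \<bullet> f) = b x un * q f" "b (x \<bullet> f) f = b x un * q f"
  using b_mu_right[of un f x] by (simp_all add: un_mu b_commute)

text \<open>A vector orthogonal to all eight would allow a third doubling, which must fail.
  Collecting the factors of \<open>z \<bullet> (y \<bullet> (x \<bullet> v))\<close> in two ways
  gives \<open>((x \<bullet> y) \<bullet> z) \<bullet> v\<close> and
  \<open>(x \<bullet> (y \<bullet> z)) \<bullet> v\<close>, and the associator of \<open>x\<close>,
  \<open>y\<close>, \<open>z\<close> has norm \<open>hgt x y z\<close>.\<close>

lemma span:
  assumes bas: "basic x y z" and o: "orth8 x y z v"
  shows "hgt x y z \<cdot> v = 0"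
proof -
  have i: "imag y" "imag z" "b x y = 0" "b x z = 0" "b y z = 0" "b (x \<bullet> y) z = 0"
    using bas by (auto simp: basic_def)
  note yz = basic_yz[OF bas]
  have iv: "imag v" using o by (simp add: orth8_def imag_def)
  have yx: "y \<bullet> x = b x un \<cdot> y - x \<bullet> y" using imag_any_right i by blast
  have zy: "z \<bullet> y = - (y \<bullet> z)" using imag_swap[of z y un] i by (simp add: mu_un b_commute)
  have xy_z: "(x \<bullet> y) \<bullet> z = b x un \<cdot> (y \<bullet> z) - x \<bullet> (y \<bullet> z)"
    using doubling[of z x y] i by (simp add: yx lin b_lin b_commute)
  have l: "z \<bullet> (y \<bullet> (x \<bullet> v)) = ((x \<bullet> y) \<bullet> z) \<bullet> v"
    using doubling[of v y x] doubling[of v z "x \<bullet> y"] iv o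
    by (simp add: orth8_def xy_z b_lin)
  have cross: "b (x \<bullet> v) g = b x un * b v g - b v (x \<bullet> g)" for g
    using o iv by (intro b_mu_cross) (auto simp: orth8_def b_commute)
  have ixv: "imag (x \<bullet> v)"
    using o iv by (intro imag_mu) (auto simp: orth8_def b_commute)
  have r: "z \<bullet> (y \<bullet> (x \<bullet> v)) = (x \<bullet> (y \<bullet> z)) \<bullet> v"
    using doubling[of "x \<bullet> v" z y] doubling[of v "y \<bullet> z" x] ixv iv o
    by (simp add: orth8_def cross)
  have "((2 \<cdot> x - b x un \<cdot> un) \<bullet> (y \<bullet> z)) \<bullet> v = 0"
    using l unfolding r by (simp add: xy_z lin two_sc algebra_simps)
  then have "cj ((2 \<cdot> x - b x un \<cdot> un) \<bullet> (y \<bullet> z)) \<bullet> (((2 \<cdot> x - b x un \<cdot> un) \<bullet> (y \<bullet> z)) \<bullet> v) = 0"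
    by simp
  then show ?thesis
    unfolding cj_mu_mu by (simp add: q_mu q_disc hgt_def mult.assoc)
qed

text \<open>Cramer's rule for the Gram matrix of \<open>f\<close> and \<open>x \<bullet> f\<close>:
  where \<open>disc x * q f\<close> is invertible, this is that scalar times the orthogonal
  projection of \<open>v\<close> onto the plane they span.\<close>

definition plane :: "'m \<Rightarrow> 'm \<Rightarrow> 'm \<Rightarrow> 'm"
  where "plane x f v = (2 * q x * b v f - b x un * b v (x \<bullet> f)) \<cdot> f
    + (2 * b v (x \<bullet> f) - b x un * b v f) \<cdot> (x \<bullet> f)"

lemma plane_b:
  "b (plane x f v) f = disc x * q f * b v f"
  "b (plane x f v) (x \<bullet> f) = disc x * q f * b v (x \<bullet> f)"
  by (simp_all add: plane_def b_lin b_plane b_self q_mu disc_def algebra_simps)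

lemma plane_orth:
  assumes "b f g = 0" "b (x \<bullet> f) g = 0"
  shows "b (plane x f v) g = 0" "b (plane x f v) (x \<bullet> g) = 0"
proof -
  have "b f (x \<bullet> g) = b (cj x \<bullet> f) g" by (simp add: adj_left)
  then have 1: "b f (x \<bullet> g) = 0" using assms by (simp add: cj_def b_lin lin)
  show "b (plane x f v) g = 0" "b (plane x f v) (x \<bullet> g) = 0"
    using assms 1 by (simp_all add: plane_def b_lin b_mu_left)
qed

text \<open>The four projections carry the factors \<open>disc x\<close>,
  \<open>disc x * q y\<close>, \<open>disc x * q z\<close> and \<open>disc x * q y * q z\<close>;
  the weights raise each of them to \<open>hgt x y z\<close>.\<close>

lemma expand_diff:
  assumes bas: "basic x y z"
  defines "K \<equiv> q y * q z"
  shows "orth8 x y z (hgt x y z \<cdot> v - K \<cdot> plane x un v - q z \<cdot> plane x y v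
    - q y \<cdot> plane x z v - plane x (y \<bullet> z) v)"
proof -
  have i: "imag y" "imag z" "b x y = 0" "b x z = 0" "b y z = 0" "b (x \<bullet> y) z = 0"
    using bas by (auto simp: basic_def)
  note yz = basic_yz[OF bas]
  have u: "b un y = 0" "b un z = 0" "b un (y \<bullet> z) = 0"
    using i yz by (simp_all add: imag_def b_commute)
  have u': "b y un = 0" "b z un = 0" "b (y \<bullet> z) un = 0" "b (x \<bullet> y) un = 0" "b (x \<bullet> z) un = 0"
     "b (x \<bullet> (y \<bullet> z)) un = 0"
    using i yz imag_mu[of y x] imag_mu[of z x] imag_mu[of "y \<bullet> z" x]
    by (simp_all add: imag_def b_commute)
  have c: "b z y = 0" "b (y \<bullet> z) y = 0" "b (y \<bullet> z) z = 0"
    using i yz by (simp_all add: b_commute)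
  have px: "b (plane x un v) x = disc x * b v x"
    using plane_b(2)[of x un v] by (simp add: mu_un q_un)
  have px0: "b (plane x y v) x = 0" "b (plane x z v) x = 0" "b (plane x (y \<bullet> z) v) x = 0"
    using plane_orth(2)[of _ un x v] u' i yz by (simp_all add: mu_un)
  have xun: "b (x \<bullet> un) g = b x g" for g by (simp add: mu_un)
  have v: "b (x \<bullet> un) y = 0" "b (x \<bullet> un) z = 0" "b (x \<bullet> un) (y \<bullet> z) = 0"
    using i yz by (simp_all only: xun)
  note z0 = px0
      plane_orth(1)[of un y x v, OF u(1) v(1)]
      plane_orth(2)[of un y x v, OF u(1) v(1)]
      plane_orth(1)[of un z x v, OF u(2) v(2)]
      plane_orth(2)[of un z x v, OF u(2) v(2)]
      plane_orth(1)[of un "y \<bullet> z" x v, OF u(3) v(3)]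
      plane_orth(2)[of un "y \<bullet> z" x v, OF u(3) v(3)]
      plane_orth(1)[of y un x v, OF u'(1) u'(4)]
      plane_orth(1)[of y z x v, OF i(5) i(6)]
      plane_orth(2)[of y z x v, OF i(5) i(6)]
      plane_orth(1)[of y "y \<bullet> z" x v, OF yz(3) yz(4)]
      plane_orth(2)[of y "y \<bullet> z" x v, OF yz(3) yz(4)]
      plane_orth(1)[of z un x v, OF u'(2) u'(5)]
      plane_orth(1)[of z y x v, OF c(1) yz(7)]
      plane_orth(2)[of z y x v, OF c(1) yz(7)]
      plane_orth(1)[of z "y \<bullet> z" x v, OF yz(5) yz(6)]
      plane_orth(2)[of z "y \<bullet> z" x v, OF yz(5) yz(6)]
      plane_orth(1)[of "y \<bullet> z" un x v, OF u'(3) u'(6)]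
      plane_orth(1)[of "y \<bullet> z" y x v, OF c(2) yz(9)]
      plane_orth(2)[of "y \<bullet> z" y x v, OF c(2) yz(9)]
      plane_orth(1)[of "y \<bullet> z" z x v, OF c(3) yz(10)]
      plane_orth(2)[of "y \<bullet> z" z x v, OF c(3) yz(10)]
  have pu: "b (plane x un v) un = disc x * b v un" using plane_b(1)[of x un v] by (simp add: q_un)
  show ?thesis
    unfolding orth8_def b_lin z0 px pu plane_b K_def hgt_def q_mu
    by (simp add: ac_simps q_un)
qed

text \<open>One factor \<open>hgt x y z\<close> comes from Cramer's rule, the other is the
  multiplier with which \<open>span\<close> kills the remainder.\<close>

lemma expand:
  assumes "basic x y z"
  shows "(hgt x y z * hgt x y z) \<cdot> v = hgt x y z \<cdot> ((q y * q z) \<cdot> plane x un v + q z \<cdot> plane x y v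
    + q y \<cdot> plane x z v + plane x (y \<bullet> z) v)"
  using span[OF assms expand_diff[OF assms, of v]] unfolding diff_diff_eq sc_diff
  by (simp add: sc_sc)

lemma expand_ex:
  assumes "basic x y z"
  shows "\<exists>c1 c2 c3 c4 c5 c6 c7 c8. (hgt x y z * hgt x y z) \<cdot> v =
    c1 \<cdot> un + c2 \<cdot> x + c3 \<cdot> y + c4 \<cdot> (x \<bullet> y) + c5 \<cdot> z + c6 \<cdot> (x \<bullet> z)
    + c7 \<cdot> (y \<bullet> z) + c8 \<cdot> (x \<bullet> (y \<bullet> z))"
  unfolding expand[OF assms] plane_def sc_add sc_sc add.assoc mu_un by blast

section \<open>Operators that compare two products with the same norm\<close>

definition pair :: "'m \<Rightarrow> 'm \<Rightarrow> 'm \<Rightarrow> bool"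
  where "pair x f p \<longleftrightarrow> imag f \<and> b x f = 0 \<and> imag p \<and> b x p = 0
    \<and> q p = q x * q f \<and> b f p = b x un * q f"

text \<open>\<open>p\<close> stands for the product of \<open>x\<close> and \<open>f\<close> in a
  second composition product with the same norm and unit, and \<open>pair\<close> records the inner
  products which this forces. The kernel of \<open>E\<close> consists of the \<open>w\<close> on
  which \<open>p\<close> acts as \<open>f\<close> followed by \<open>x\<close>.\<close>

definition E :: "'m \<Rightarrow> 'm \<Rightarrow> 'm \<Rightarrow> 'm \<Rightarrow> 'm"
  where "E x f p w = x \<bullet> (f \<bullet> w) - p \<bullet> w"

text \<open>The second product of \<open>f\<close> and \<open>x\<close> is
  \<open>b x un \<cdot> f - p\<close>, so this is \<open>E\<close> for the opposite of the second
  product.\<close>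

definition G :: "'m \<Rightarrow> 'm \<Rightarrow> 'm \<Rightarrow> 'm \<Rightarrow> 'm"
  where "G x f p w = p \<bullet> w - b x un \<cdot> (f \<bullet> w) + x \<bullet> (f \<bullet> w)"

lemma E_lin: "E x f p (v + w) = E x f p v + E x f p w" "E x f p (r \<cdot> w) = r \<cdot> E x f p w"
  "E x f p (- w) = - E x f p w" "E x f p (v - w) = E x f p v - E x f p w" "E x f p 0 = 0"
  by (simp_all add: E_def lin)

lemma G_lin: "G x f p (v + w) = G x f p v + G x f p w" "G x f p (r \<cdot> w) = r \<cdot> G x f p w"
  "G x f p (- w) = - G x f p w" "G x f p (v - w) = G x f p v - G x f p w" "G x f p 0 = 0"
  by (simp_all add: G_def lin mult.commute)

lemma pair_rules:
  assumes "pair x f p"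
  shows "f \<bullet> (x \<bullet> w) = b x un \<cdot> (f \<bullet> w) - x \<bullet> (f \<bullet> w)"
    "p \<bullet> (x \<bullet> w) = b x un \<cdot> (p \<bullet> w) - x \<bullet> (p \<bullet> w)"
    "f \<bullet> (f \<bullet> w) = - (q f \<cdot> w)" "p \<bullet> (p \<bullet> w) = - ((q x * q f) \<cdot> w)"
    "f \<bullet> (p \<bullet> w) = - ((b x un * q f) \<cdot> w) - p \<bullet> (f \<bullet> w)"
    "x \<bullet> (x \<bullet> w) = b x un \<cdot> (x \<bullet> w) - q x \<cdot> w"
  using assms imag_any[of f x w] imag_any[of p x w] imag_square[of f w] imag_square[of p w]
    imag_imag[of f p w] square[of x w]
  by (simp_all add: pair_def)

text \<open>Where \<open>disc x * q f\<close> is invertible, these relations make the kernel of each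
  operator the image of the other and split the module into the two kernels.\<close>

lemma E_G: "pair x f p \<Longrightarrow> E x f p (G x f p w) = 0"
  and G_E: "pair x f p \<Longrightarrow> G x f p (E x f p w) = 0"
  and E_E_G_G: "pair x f p \<Longrightarrow> E x f p (E x f p w) + G x f p (G x f p w) = - ((disc x * q f) \<cdot> w)"
proof -
  \<comment> \<open>The 4 in \<open>disc\<close> becomes a repeated sum, so that linear terms can
    cancel.\<close>
  have d: "(r * (s * 4)) \<cdot> w = (r * s) \<cdot> w + ((r * s) \<cdot> w + ((r * s) \<cdot> w + (r * s) \<cdot> w))" for r s
    by (simp flip: add_sc) (simp add: algebra_simps)
  show "pair x f p \<Longrightarrow> E x f p (G x f p w) = 0"
    "pair x f p \<Longrightarrow> G x f p (E x f p w) = 0"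
    "pair x f p \<Longrightarrow> E x f p (E x f p w) + G x f p (G x f p w) = - ((disc x * q f) \<cdot> w)"
    by (simp_all add: E_def G_def pair_rules lin disc_def d algebra_simps)
qed

lemma pair_x: "pair x f p \<Longrightarrow> E x f p (x \<bullet> w) = b x un \<cdot> E x f p w - x \<bullet> E x f p w"
  by (simp add: E_def pair_rules lin algebra_simps)

lemma E_self: "pair x f p \<Longrightarrow> E x f p (f \<bullet> w) = - (f \<bullet> E x f p w)"
  and G_self: "pair x f p \<Longrightarrow> G x f p (f \<bullet> w) = - (f \<bullet> G x f p w)"
  by (simp_all add: E_def G_def pair_rules lin algebra_simps)

definition apart :: "'m \<Rightarrow> 'm \<Rightarrow> 'm \<Rightarrow> 'm \<Rightarrow> bool"
  where "apart x f p g \<longleftrightarrow> imag g \<and> b x g = 0 \<and> b f g = 0 \<and> b p g = 0"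

lemma apart_rules:
  assumes "pair x f p" "apart x f p g"
  shows "g \<bullet> (x \<bullet> w) = b x un \<cdot> (g \<bullet> w) - x \<bullet> (g \<bullet> w)"
    "g \<bullet> (f \<bullet> w) = - (f \<bullet> (g \<bullet> w))" "g \<bullet> (p \<bullet> w) = - (p \<bullet> (g \<bullet> w))"
  using assms imag_any[of g x w] imag_swap[of g f w] imag_swap[of g p w]
  by (simp_all add: pair_def apart_def b_commute)

text \<open>\<open>g\<close> passes \<open>f\<close> and \<open>p\<close> with a sign but
  \<open>x\<close> with a conjugation, and this exchanges the equation for the second product with
  the one for its opposite.\<close>

lemma E_swap: "pair x f p \<Longrightarrow> apart x f p g \<Longrightarrow> E x f p (g \<bullet> w) = g \<bullet> G x f p w"
  and G_swap: "pair x f p \<Longrightarrow> apart x f p g \<Longrightarrow> G x f p (g \<bullet> w) = g \<bullet> E x f p w"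
  by (simp_all add: E_def G_def apart_rules lin algebra_simps)

lemma E_G_cross:
  assumes p: "pair x f p" "pair x g r" and a: "apart x f p g" "apart x f p r"
  shows "E x g r (G x f p w) = - E x f p (G x g r w)"
    "G x g r (G x f p w) = - E x f p (E x g r w)"
    "G x f p (E x g r w) = - G x g r (E x f p w)"
  using p by (simp_all add: E_def G_def pair_rules[OF p(1)] pair_rules(1,2,6)[OF p(2)]
      apart_rules(2,3)[OF p(1) a(1)] apart_rules(2,3)[OF p(1) a(2)] lin algebra_simps)

text \<open>The first equation, together with \<open>E_G\<close>, puts the vectors
  \<open>G x f p (E x g r w)\<close> into both kernels of \<open>E\<close>; the second one is what
  makes their norms computable.\<close>

lemma E_G_E:
  assumes p: "pair x f p" "pair x g r" and a: "apart x f p g" "apart x f p r"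
  shows "E x g r (G x f p (E x g r w)) = 0"
    "E x g r (G x f p (G x f p w)) = E x f p (E x f p (E x g r w))"
  by (simp_all add: E_G_cross[OF assms] G_E[OF p(2)] E_G[OF p(2)] E_lin)

lemma E_adjoint: "pair x f p \<Longrightarrow> b (E x f p v) w = - b v (E x f p w)"
  and G_adjoint: "pair x f p \<Longrightarrow> b (G x f p v) w = - b v (G x f p w)"
proof -
  assume p: "pair x f p"
  then have c: "cj f = - f" "cj p = - p" by (auto simp: pair_def imag_cj)
  have cx: "cj x = b x un \<cdot> un - x" by (simp add: cj_def)
  show "b (E x f p v) w = - b v (E x f p w)" "b (G x f p v) w = - b v (G x f p w)"
    by (simp_all add: E_def G_def b_lin adj_left[of x] adj_left[of f] adj_left[of p] c lin cx
        pair_rules[OF p] algebra_simps)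
qed

end

section \<open>Prime ideals and rank\<close>

definition idl :: "'r::comm_ring_1 set \<Rightarrow> bool"
  where "idl I \<longleftrightarrow> 0 \<in> I \<and> (\<forall>a\<in>I. \<forall>c\<in>I. a + c \<in> I) \<and> (\<forall>r. \<forall>a\<in>I. r * a \<in> I)"

text \<open>In a product of rings with \<open>e\<close> the idempotent of one factor, the ideals \<open>m\<close> with \<open>prm e m\<close>
  are the prime ideals of that factor.\<close>

definition prm :: "'r::comm_ring_1 \<Rightarrow> 'r set \<Rightarrow> bool"
  where "prm e m \<longleftrightarrow> idl m \<and> e \<notin> m \<and> (\<forall>a c. a * c \<in> m \<longrightarrow> a \<in> m \<or> c \<in> m)"

lemma idl_zero: "idl I \<Longrightarrow> 0 \<in> I"
  and idl_add: "idl I \<Longrightarrow> a \<in> I \<Longrightarrow> c \<in> I \<Longrightarrow> a + c \<in> I"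
  and idl_mult: "idl I \<Longrightarrow> a \<in> I \<Longrightarrow> r * a \<in> I"
  and idl_mult_right: "idl I \<Longrightarrow> a \<in> I \<Longrightarrow> a * r \<in> I"
  unfolding idl_def by (metis mult.commute)+

lemma idl_minus: "idl I \<Longrightarrow> a \<in> I \<Longrightarrow> - a \<in> I"
  using idl_mult[of I a "- 1"] by simp

lemma idl_diff: "idl I \<Longrightarrow> a \<in> I \<Longrightarrow> c \<in> I \<Longrightarrow> a - c \<in> I"
  using idl_add[of I a "- c"] idl_minus[of I c] by simp

lemma idl_sum: "idl I \<Longrightarrow> (\<And>k. k \<in> A \<Longrightarrow> f k \<in> I) \<Longrightarrow> sum f A \<in> I"
  by (induction A rule: infinite_finite_induct) (auto simp: idl_zero idl_add)

lemma prm_idl: "prm e m \<Longrightarrow> idl m"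
  by (simp add: prm_def)

lemma prm_mult: "prm e m \<Longrightarrow> a * c \<in> m \<longleftrightarrow> a \<in> m \<or> c \<in> m"
  unfolding prm_def using idl_mult idl_mult_right by blast

lemma prm_one: "prm e m \<Longrightarrow> 1 \<notin> m"
  unfolding prm_def using idl_mult[of m 1 e] by auto

lemma prm_power: "prm e m \<Longrightarrow> a ^ k \<in> m \<Longrightarrow> a \<in> m"
  by (induction k) (auto simp: prm_one prm_mult)

text \<open>The passage from primes to global statements. An ideal maximal among those that contain
  \<open>I\<close> but not \<open>e\<close> is prime: if it misses \<open>a\<close> and
  \<open>c\<close>, then \<open>e\<close> is a member plus a multiple of \<open>a\<close>, and also
  a member plus a multiple of \<open>c\<close>, so \<open>a * c\<close> in the ideal would put
  \<open>e * e = e\<close> there.\<close>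

lemma idempotent_in_idl:
  assumes e: "e * e = e" and I: "idl I" and no: "\<And>m. prm e m \<Longrightarrow> \<exists>r\<in>I. r \<notin> m"
  shows "e \<in> I"
proof (rule ccontr)
  assume "e \<notin> I"
  define A where "A = {J. idl J \<and> I \<subseteq> J \<and> e \<notin> J}"
  have "I \<in> A" using I \<open>e \<notin> I\<close> by (simp add: A_def)
  have "\<exists>M\<in>A. \<forall>X\<in>A. M \<subseteq> X \<longrightarrow> X = M"
  proof (rule subset_Zorn_nonempty)
    show "A \<noteq> {}" using \<open>I \<in> A\<close> by blast
  next
    fix K assume ne: "K \<noteq> {}" and ch: "subset.chain A K"
    have sub: "K \<subseteq> A" using ch by (auto simp: subset.chain_def)
    have "idl (\<Union>K)"
      unfolding idl_def
    proof (intro conjI ballI allI)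
      show "0 \<in> \<Union>K" using ne sub idl_zero unfolding A_def by blast
    next
      fix a c assume "a \<in> \<Union>K" "c \<in> \<Union>K"
      then obtain J L where "J \<in> K" "L \<in> K" "a \<in> J" "c \<in> L" by blast
      moreover have "J \<subseteq> L \<or> L \<subseteq> J" using ch calculation by (auto simp: subset_chain_def)
      ultimately show "a + c \<in> \<Union>K" using sub unfolding A_def by (blast intro: idl_add)
    next
      fix r a assume "a \<in> \<Union>K"
      then show "r * a \<in> \<Union>K" using sub unfolding A_def by (blast intro: idl_mult)
    qed
    then show "\<Union>K \<in> A" using ne sub unfolding A_def by blast
  qed
  then obtain M where M: "M \<in> A" and max: "\<And>X. X \<in> A \<Longrightarrow> M \<subseteq> X \<Longrightarrow> X = M" by blast
  have iM: "idl M" "I \<subseteq> M" "e \<notin> M" using M by (auto simp: A_def)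
  have ext: "\<exists>r. \<exists>c\<in>M. e = c + r * a" if "a \<notin> M" for a
  proof (rule ccontr)
    assume no_e: "\<not> ?thesis"
    define X where "X = {c + r * a |c r. c \<in> M}"
    have "idl X"
      unfolding idl_def
    proof (intro conjI ballI allI)
      show "0 \<in> X" unfolding X_def using idl_zero[OF iM(1)]
        by (intro CollectI exI[of _ 0] exI[of _ 0]) simp
    next
      fix u v assume "u \<in> X" "v \<in> X"
      then obtain c r c' r' where "u = c + r * a" "v = c' + r' * a" "c \<in> M" "c' \<in> M"
        unfolding X_def by blast
      then have "u + v = (c + c') + (r + r') * a" "c + c' \<in> M"
        using idl_add[OF iM(1)] by (auto simp: algebra_simps)
      then show "u + v \<in> X" unfolding X_def by blast
    next
      fix s u assume "u \<in> X"
      then obtain c r where "u = c + r * a" "c \<in> M" unfolding X_def by blast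
      then have "s * u = s * c + (s * r) * a" "s * c \<in> M"
        using idl_mult[OF iM(1)] by (auto simp: algebra_simps)
      then show "s * u \<in> X" unfolding X_def by blast
    qed
    moreover have MX: "M \<subseteq> X"
    proof
      fix c assume "c \<in> M"
      then show "c \<in> X" unfolding X_def by (intro CollectI exI[of _ c] exI[of _ 0]) simp
    qed
    moreover have "e \<notin> X" using no_e by (auto simp: X_def)
    ultimately have "X \<in> A" using iM(2) by (auto simp: A_def)
    then have "X = M" using max MX by blast
    moreover have "a \<in> X" unfolding X_def using idl_zero[OF iM(1)]
      by (intro CollectI exI[of _ 0] exI[of _ 1]) simp
    ultimately show False using that by blast
  qed
  have "prm e M"
    unfolding prm_def
  proof (intro conjI allI impI)
    fix a c assume ac: "a * c \<in> M"
    show "a \<in> M \<or> c \<in> M"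
    proof (rule ccontr)
      assume "\<not> ?thesis"
      then obtain r s u v where "u \<in> M" "v \<in> M" and eq: "e = u + r * a" "e = v + s * c"
        using ext[of a] ext[of c] by blast
      have "e * e = (u + r * a) * (v + s * c)" by (simp flip: eq)
      also have "\<dots> = u * (v + s * c) + (r * a) * v + (r * s) * (a * c)"
        by (simp add: algebra_simps)
      also have "\<dots> \<in> M"
        using \<open>u \<in> M\<close> \<open>v \<in> M\<close> ac
        by (intro idl_add[OF iM(1)]) (simp_all add: idl_mult[OF iM(1)] idl_mult_right[OF iM(1)])
      finally show False using e iM(3) by simp
    qed
  qed (use iM in auto)
  then show False using no iM(2) by blast
qed

text \<open>Gaussian elimination without division. \<open>B\<close> is the matrix after clearing
  column \<open>p\<close> by the pivot \<open>A i0 p\<close>; a solution for \<open>B\<close> is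
  scaled by the pivot, which is outside the prime and so keeps some coordinate outside, and
  coordinate \<open>p\<close> then solves row \<open>i0\<close> exactly.\<close>

lemma underdetermined:
  assumes prm: "prm e m" and fin: "finite I"
  shows "finite J \<Longrightarrow> card I < card J \<Longrightarrow>
    \<exists>c. (\<forall>i\<in>I. (\<Sum>j\<in>J. A i j * c j) \<in> m) \<and> (\<exists>j\<in>J. c j \<notin> m)"
  using fin
proof (induction I arbitrary: A J rule: finite_induct)
  case empty
  then show ?case using prm_one[OF prm] by (intro exI[of _ "\<lambda>_. 1"]) (auto simp: card_gt_0_iff)
next
  case (insert i0 I)
  note im = prm_idl[OF prm]
  show ?case
  proof (cases "\<forall>j\<in>J. A i0 j \<in> m")
    case True
    obtain c where "\<forall>i\<in>I. (\<Sum>j\<in>J. A i j * c j) \<in> m" "\<exists>j\<in>J. c j \<notin> m"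
      using insert.IH[of J A] insert.prems insert.hyps by auto
    moreover have "(\<Sum>j\<in>J. A i0 j * c j) \<in> m"
      using True by (intro idl_sum[OF im] idl_mult_right[OF im]) auto
    ultimately show ?thesis by auto
  next
    case False
    then obtain p where p: "p \<in> J" "A i0 p \<notin> m" by blast
    define B where "B i j = A i0 p * A i j - A i0 j * A i p" for i j
    have "card I < card (J - {p})" using insert p by simp
    then obtain c' where c': "\<forall>i\<in>I. (\<Sum>j\<in>J - {p}. B i j * c' j) \<in> m"
      and nz: "\<exists>j\<in>J - {p}. c' j \<notin> m"
      using insert.IH[of "J - {p}" B] insert.prems by auto
    define c where "c j = (if j = p then - (\<Sum>j\<in>J - {p}. A i0 j * c' j) else A i0 p * c' j)" for j
    have s: "(\<Sum>j\<in>J. A i j * c j) = (\<Sum>j\<in>J - {p}. B i j * c' j)" for i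
    proof -
      have "(\<Sum>j\<in>J. A i j * c j) = A i p * c p + (\<Sum>j\<in>J - {p}. A i j * c j)"
        using insert.prems p by (simp add: sum.remove)
      also have "(\<Sum>j\<in>J - {p}. A i j * c j) = (\<Sum>j\<in>J - {p}. A i j * (A i0 p * c' j))"
        by (rule sum.cong) (auto simp: c_def)
      finally show ?thesis
        by (simp add: c_def B_def sum_distrib_left left_diff_distrib sum_subtractf algebra_simps)
    qed
    have "(\<Sum>j\<in>J - {p}. B i0 j * c' j) = 0" by (simp add: B_def algebra_simps)
    then have "\<forall>i\<in>insert i0 I. (\<Sum>j\<in>J. A i j * c j) \<in> m"
      using c' idl_zero[OF im] by (auto simp: s)
    moreover have "\<exists>j\<in>J. c j \<notin> m"
      using nz p prm_mult[OF prm] by (auto simp: c_def)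
    ultimately show ?thesis by blast
  qed
qed

section \<open>The radical of the norm at a prime, and existence of basic triples\<close>

context composition_algebra
begin

definition rad :: "'r set \<Rightarrow> 'm \<Rightarrow> bool" where "rad m x \<longleftrightarrow> (\<forall>y. b x y \<in> m)"

lemma rad_add: "idl m \<Longrightarrow> rad m x \<Longrightarrow> rad m y \<Longrightarrow> rad m (x + y)"
  and rad_sc: "idl m \<Longrightarrow> rad m x \<Longrightarrow> rad m (r \<cdot> x)"
  and rad_sc_mem: "idl m \<Longrightarrow> r \<in> m \<Longrightarrow> rad m (r \<cdot> x)"
  and rad_mu: "rad m x \<Longrightarrow> rad m (a \<bullet> x)"
  and rad_minus: "idl m \<Longrightarrow> rad m x \<Longrightarrow> rad m (- x)"
  and rad_zero: "idl m \<Longrightarrow> rad m 0"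
  by (auto simp: rad_def b_lin adj_left intro: idl_add idl_diff idl_mult idl_mult_right idl_minus idl_zero)

lemma rad_sum: "idl m \<Longrightarrow> (\<And>k. k \<in> A \<Longrightarrow> rad m (f k)) \<Longrightarrow> rad m (sum f A)"
  by (induction A rule: infinite_finite_induct) (auto simp: rad_zero rad_add)

lemma rad_cancel: "prm e m \<Longrightarrow> r \<notin> m \<Longrightarrow> rad m (r \<cdot> x) \<Longrightarrow> rad m x"
  by (auto simp: rad_def b_lin prm_mult)

lemma sc_sum: "r \<cdot> sum f A = (\<Sum>k\<in>A. r \<cdot> f k)"
  by (induction A rule: infinite_finite_induct) (auto simp: sc_add)

lemma sum_sc: "sum f A \<cdot> x = (\<Sum>k\<in>A. f k \<cdot> x)"
  by (induction A rule: infinite_finite_induct) (auto simp: add_sc)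

end

text \<open>The condition \<open>rank\<close> says that five vectors are independent modulo the radical of the norm at
  every prime; among the ranks 1, 2, 4, 8 of composition algebras it leaves only 8.\<close>

locale ranked_composition_algebra = composition_algebra sc mu un q
  for sc :: "'r::comm_ring_1 \<Rightarrow> 'm::ab_group_add \<Rightarrow> 'm" (infixr "\<cdot>" 75)
    and mu :: "'m \<Rightarrow> 'm \<Rightarrow> 'm" (infixl "\<bullet>" 70)
    and un :: 'm
    and q :: "'m \<Rightarrow> 'r" +
  fixes e :: 'r
  assumes idem: "e * e = e"
    and rank: "prm e m \<Longrightarrow> \<exists>X. \<forall>c. (\<forall>y. q ((\<Sum>j<5::nat. c j \<cdot> X j) + y)
      - q (\<Sum>j<5. c j \<cdot> X j) - q y \<in> m) \<longrightarrow> (\<forall>j<5. c j \<in> m)"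
begin

lemma rank_rad: "prm e m \<Longrightarrow> \<exists>X. \<forall>c. rad m (\<Sum>j<5::nat. c j \<cdot> X j) \<longrightarrow> (\<forall>j<5. c j \<in> m)"
  using rank unfolding rad_def b_def .

text \<open>Five coordinate vectors of length four satisfy a relation by
  \<open>underdetermined\<close>. Scaled by the denominators \<open>s (X j)\<close>, it becomes a
  relation between the five vectors \<open>X j\<close> that are independent modulo the
  radical.\<close>

lemma not_spanned:
  assumes prm: "prm e m"
    and span: "\<And>x. \<exists>s r. s \<notin> m \<and> rad m (s \<cdot> x - (\<Sum>k<4::nat. r k \<cdot> es k))"
  shows False
proof -
  note im = prm_idl[OF prm]
  obtain X where X: "\<And>c. rad m (\<Sum>j<5::nat. c j \<cdot> X j) \<Longrightarrow> \<forall>j<5. c j \<in> m"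
    using rank_rad[OF prm] by blast
  obtain s r where s: "\<And>x. s x \<notin> m"
    and sr: "\<And>x. rad m (s x \<cdot> x - (\<Sum>k<4::nat. r x k \<cdot> es k))"
    using span by metis
  obtain c where c: "\<And>k. k < 4 \<Longrightarrow> (\<Sum>j<5::nat. r (X j) k * c j) \<in> m" and nz: "\<exists>j<5. c j \<notin> m"
    using underdetermined[OF prm, of "{..<4::nat}" "{..<5::nat}" "\<lambda>k j. r (X j) k"] by auto
  have "(\<Sum>j<5. (c j * s (X j)) \<cdot> X j)
      = (\<Sum>j<5. c j \<cdot> (s (X j) \<cdot> X j - (\<Sum>k<4. r (X j) k \<cdot> es k)))
        + (\<Sum>j<5. \<Sum>k<4. (r (X j) k * c j) \<cdot> es k)"
    by (simp add: sc_diff sc_sc sc_sum sum_subtractf mult.commute)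
  also have "(\<Sum>j<5. \<Sum>k<4. (r (X j) k * c j) \<cdot> es k) = (\<Sum>k<4. (\<Sum>j<5. r (X j) k * c j) \<cdot> es k)"
    by (subst sum.swap) (simp add: sum_sc)
  finally have eq: "(\<Sum>j<5. (c j * s (X j)) \<cdot> X j)
      = (\<Sum>j<5. c j \<cdot> (s (X j) \<cdot> X j - (\<Sum>k<4. r (X j) k \<cdot> es k)))
        + (\<Sum>k<4. (\<Sum>j<5. r (X j) k * c j) \<cdot> es k)" .
  have "rad m (\<Sum>j<5. (c j * s (X j)) \<cdot> X j)"
    unfolding eq using sr c
    by (intro rad_add[OF im] rad_sum[OF im]) (auto intro: rad_sc[OF im] rad_sc_mem[OF im])
  then show False using X[of "\<lambda>j. c j * s (X j)"] nz s by (auto simp: prm_mult[OF prm])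
qed

lemma not_spanned4:
  assumes prm: "prm e m"
    and span: "\<And>x. \<exists>s r0 r1 r2 r3. s \<notin> m \<and> rad m (s \<cdot> x - (r0 \<cdot> e0 + r1 \<cdot> e1 + r2 \<cdot> e2 + r3 \<cdot> e3))"
  shows False
proof (rule not_spanned[OF prm])
  fix x
  obtain s r0 r1 r2 r3 where *: "s \<notin> m" "rad m (s \<cdot> x - (r0 \<cdot> e0 + r1 \<cdot> e1 + r2 \<cdot> e2 + r3 \<cdot> e3))"
    using span by blast
  show "\<exists>s r. s \<notin> m \<and> rad m (s \<cdot> x - (\<Sum>k<4::nat. r k \<cdot> ((!) [e0, e1, e2, e3]) k))"
    using * by (intro exI[of _ s] exI[of _ "(!) [r0, r1, r2, r3]"]) (simp add: eval_nat_numeral)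
qed

text \<open>Since \<open>b x y = b un (cj x \<bullet> y)\<close>, the form takes only traces as
  values. If all of them were in \<open>m\<close>, the radical would be everything.\<close>

lemma ex_trace:
  assumes prm: "prm e m"
  shows "\<exists>c. b c un \<notin> m"
proof (rule ccontr)
  assume no: "\<not> ?thesis"
  have "rad m x" for x
    unfolding rad_def
  proof
    fix y
    show "b x y \<in> m" using no adj_left[of x un y] by (metis mu_un b_commute)
  qed
  then show False using not_spanned4[OF prm] prm_one[OF prm] by blast
qed

text \<open>Suppose every discriminant is in \<open>m\<close>. Then 2 is not, because some trace is
  not, and polarizing \<open>disc\<close> puts \<open>2 \<cdot> x - b x un \<cdot> un\<close> into
  the radical, so that the unit alone would span.\<close>

lemma ex_disc:
  assumes prm: "prm e m"
  shows "\<exists>x. disc x \<notin> m"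
proof (rule ccontr)
  assume no: "\<not> ?thesis"
  note im = prm_idl[OF prm]
  obtain c where c: "b c un \<notin> m" using ex_trace[OF prm] by blast
  have two: "2 \<notin> m"
  proof
    assume "2 \<in> m"
    have "4 * q c \<in> m" using idl_mult_right[OF im \<open>2 \<in> m\<close>, of "2 * q c"] by simp
    then have "4 * q c - disc c \<in> m" using no by (intro idl_diff[OF im]) auto
    then show False using c by (simp add: disc_def prm_mult[OF prm])
  qed
  \<comment> \<open>Zero vectors fill the list up to the four that \<open>not_spanned4\<close>
    expects.\<close>
  have "rad m (2 \<cdot> x - (b x un \<cdot> un + 0 \<cdot> 0 + 0 \<cdot> 0 + 0 \<cdot> 0))" for x
    unfolding rad_def
  proof
    fix y
    have "disc (x + y) - disc x - disc y \<in> m" using no by (intro idl_diff[OF im]) auto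
    also have "disc (x + y) - disc x - disc y = 2 * (2 * b x y - b x un * b un y)"
      by (simp add: disc_def q_add b_lin b_commute algebra_simps)
    finally have "2 * b x y - b x un * b un y \<in> m"
      unfolding prm_mult[OF prm] using two by blast
    then show "b (2 \<cdot> x - (b x un \<cdot> un + 0 \<cdot> 0 + 0 \<cdot> 0 + 0 \<cdot> 0)) y \<in> m"
      by (simp add: b_lin)
  qed
  then show False using not_spanned4[OF prm, of un 0 0 0] two by blast
qed

text \<open>After \<open>x\<close>, two rounds of one argument: project onto the orthogonal
  complement of what has been built. If all norms there were in \<open>m\<close>, polarization would
  put the complement into the radical, and at most four vectors would span.\<close>

lemma ex_basic:
  assumes prm: "prm e m"
  shows "\<exists>x y z. basic x y z \<and> hgt x y z \<notin> m"
proof -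
  note im = prm_idl[OF prm]
  obtain x where x: "disc x \<notin> m" using ex_disc[OF prm] by blast
  have rad_if: "rad m w" if "\<And>w'. q (w + w') \<in> m" "\<And>w'. q w' \<in> m" for w
    using that by (auto simp: rad_def b_def intro!: idl_diff im)
  define P where "P v = disc x \<cdot> v - plane x un v" for v
  have Pun: "b (P v) un = 0" for v
    using plane_b(1)[of x un v] by (simp add: P_def b_lin q_un)
  have Px: "b (P v) x = 0" for v
    using plane_b(2)[of x un v] by (simp add: P_def b_lin q_un mu_un)
  \<comment> \<open>A projection is self-adjoint, here up to the scale \<open>disc x\<close>, so the
    form on the image of \<open>P\<close> controls the pairing of that image with every
    vector.\<close>
  have PP: "b (P v) (P w) = disc x * b (P v) w" for v w
    unfolding P_def[of w] plane_def by (simp add: b_lin Pun Px mu_un)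
  have "\<exists>v. q (P v) \<notin> m"
  proof (rule ccontr)
    assume no: "\<not> ?thesis"
    have "rad m (P v)" for v
      unfolding rad_def
    proof
      fix w
      have "P (v + w) = P v + P w" by (simp add: P_def plane_def b_lin lin algebra_simps)
      then have "b (P v) (P w) \<in> m" using no by (auto simp: b_def simp flip: \<open>P (v + w) = P v + P w\<close> intro!: idl_diff im)
      then show "b (P v) w \<in> m" using x by (simp add: PP prm_mult[OF prm])
    qed
    then have "rad m (disc x \<cdot> v - ((2 * q x * b v un - b x un * b v (x \<bullet> un)) \<cdot> un
        + (2 * b v (x \<bullet> un) - b x un * b v un) \<cdot> x + 0 \<cdot> 0 + 0 \<cdot> 0))" for v
      by (simp add: P_def plane_def mu_un)
    then show False using not_spanned4[OF prm, of un x 0 0] x by blast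
  qed
  then obtain y where y: "q y \<notin> m" "b y un = 0" "b y x = 0" using Pun Px by blast
  have iy: "imag y" "b x y = 0" "b un y = 0" using y by (auto simp: imag_def b_commute)
  have xy0: "b (x \<bullet> y) un = 0"
    using imag_mu[OF iy(1,2)] by (simp add: imag_def)
  have xyx: "b (x \<bullet> y) x = 0"
    using b_mu_left[of x y un] y by (simp add: mu_un)
  define Q where "Q v = (disc x * q y) \<cdot> v - q y \<cdot> plane x un v - plane x y v" for v
  have pxun: "b (plane x un v) un = disc x * b v un" "b (plane x un v) x = disc x * b v x" for v
    using plane_b[of x un v] by (simp_all add: q_un mu_un)
  have pun: "b (plane x un v) y = 0" "b (plane x un v) (x \<bullet> y) = 0"
    "b (plane x y v) un = 0" "b (plane x y v) x = 0" for v
    using plane_orth[of un y x v] plane_orth[of y un x v] iy xy0 y by (simp_all add: mu_un)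
  have Q: "b (Q v) un = 0" "b (Q v) x = 0" "b (Q v) y = 0" "b (Q v) (x \<bullet> y) = 0" for v
    by (simp_all add: Q_def b_lin pxun pun plane_b q_un ac_simps)
  have QQ: "b (Q v) (Q w) = disc x * q y * b (Q v) w" for v w
    unfolding Q_def[of w] plane_def by (simp add: b_lin Q mu_un)
  have "\<exists>v. q (Q v) \<notin> m"
  proof (rule ccontr)
    assume no: "\<not> ?thesis"
    have "rad m (Q v)" for v
      unfolding rad_def
    proof
      fix w
      have *: "Q (v + w) = Q v + Q w" by (simp add: Q_def plane_def b_lin lin algebra_simps)
      then have "b (Q v) (Q w) \<in> m" using no by (auto simp: b_def simp flip: * intro!: idl_diff im)
      then show "b (Q v) w \<in> m" using x y by (simp add: QQ prm_mult[OF prm])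
    qed
    then have "rad m ((disc x * q y) \<cdot> v - ((q y * (2 * q x * b v un - b x un * b v (x \<bullet> un))) \<cdot> un
        + (q y * (2 * b v (x \<bullet> un) - b x un * b v un)) \<cdot> x
        + (2 * q x * b v y - b x un * b v (x \<bullet> y)) \<cdot> y
        + (2 * b v (x \<bullet> y) - b x un * b v y) \<cdot> (x \<bullet> y)))" for v
      by (simp add: Q_def plane_def mu_un sc_add sc_sc diff_diff_eq add.assoc)
    moreover have "disc x * q y \<notin> m" using x y by (simp add: prm_mult[OF prm])
    ultimately show False using not_spanned4[OF prm, of un x y "x \<bullet> y"] by blast
  qed
  then obtain z where z: "q z \<notin> m" "b z un = 0" "b z x = 0" "b z y = 0" "b z (x \<bullet> y) = 0"
    using Q by blast
  have "basic x y z"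
    using iy z by (simp add: basic_def imag_def b_commute)
  moreover have "hgt x y z \<notin> m"
    using x y z by (simp add: hgt_def prm_mult[OF prm])
  ultimately show ?thesis by blast
qed

end

section \<open>Two products with the same norm\<close>

text \<open>\<open>b\<close>, \<open>cj\<close>, \<open>imag\<close> and \<open>disc\<close> involve
  only scalars, unit and norm and mean the same for both products. \<open>E\<close> and
  \<open>G\<close> act through \<open>\<bullet>\<close>, while basic triples and their products are
  formed with \<open>\<diamondop>\<close>.\<close>

locale two_products = composition_algebra sc mu un q + v: ranked_composition_algebra sc mv un q e
  for sc :: "'r::comm_ring_1 \<Rightarrow> 'm::ab_group_add \<Rightarrow> 'm" (infixr "\<cdot>" 75)
    and mu :: "'m \<Rightarrow> 'm \<Rightarrow> 'm" (infixl "\<bullet>" 70)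
    and mv :: "'m \<Rightarrow> 'm \<Rightarrow> 'm" (infixl "\<diamondop>" 70)
    and un :: 'm
    and q :: "'m \<Rightarrow> 'r"
    and e :: 'r
begin

lemma basic_pairs:
  assumes "v.basic x y z"
  shows "pair x y (x \<diamondop> y)" "pair x z (x \<diamondop> z)" "pair x (y \<diamondop> z) (x \<diamondop> (y \<diamondop> z))"
    "apart x y (x \<diamondop> y) z" "apart x y (x \<diamondop> y) (y \<diamondop> z)" "apart x y (x \<diamondop> y) (x \<diamondop> z)"
    "apart x z (x \<diamondop> z) y" "apart x z (x \<diamondop> z) (y \<diamondop> z)"
    "apart x (y \<diamondop> z) (x \<diamondop> (y \<diamondop> z)) y" "apart x (y \<diamondop> z) (x \<diamondop> (y \<diamondop> z)) z"
proof -
  have i: "imag y" "imag z" "b x y = 0" "b x z = 0" "b y z = 0" "b (x \<diamondop> y) z = 0"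
    using assms by (auto simp: v.basic_def)
  note yz = v.basic_yz[OF assms]
  have pr: "pair x f (x \<diamondop> f)" if "imag f" "b x f = 0" for f
    using that v.imag_mu[OF that] v.b_mu_left[of x un f] v.b_plane(1)[of f x]
    by (simp add: pair_def v.q_mu v.mu_un imag_def b_commute[of un f])
  show "pair x y (x \<diamondop> y)" "pair x z (x \<diamondop> z)" "pair x (y \<diamondop> z) (x \<diamondop> (y \<diamondop> z))"
    using pr i yz by auto
  have "b (x \<diamondop> y) (x \<diamondop> z) = 0" using v.b_mu_left[of x y z] i by simp
  moreover have "imag (x \<diamondop> z)" using v.imag_mu i by blast
  moreover have "b x (x \<diamondop> z) = 0" using v.b_mu_left[of x un z] i(2) by (simp add: v.mu_un imag_def b_commute[of un z])
  ultimately show "apart x y (x \<diamondop> y) z" "apart x y (x \<diamondop> y) (y \<diamondop> z)" "apart x y (x \<diamondop> y) (x \<diamondop> z)"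
    "apart x z (x \<diamondop> z) y" "apart x z (x \<diamondop> z) (y \<diamondop> z)"
    "apart x (y \<diamondop> z) (x \<diamondop> (y \<diamondop> z)) y" "apart x (y \<diamondop> z) (x \<diamondop> (y \<diamondop> z)) z"
    using i yz by (simp_all add: apart_def b_commute[of z y] b_commute[of y "x \<diamondop> z"] b_commute[of "y \<diamondop> z" y]
        b_commute[of "y \<diamondop> z" z])
qed

text \<open>\<open>K2\<close>, \<open>same\<close> and \<open>oppo\<close> are the parts of the equation \<open>(a \<diamondop> c) \<bullet> v = a \<bullet> (c \<bullet> v)\<close> needed for a
  Cayley triple \<open>x, y, z\<close>; the third generator \<open>y \<diamondop> z\<close> decides between \<open>\<diamondop>\<close> and its opposite.\<close>

definition K2 :: "'m \<Rightarrow> 'm \<Rightarrow> 'm \<Rightarrow> 'm \<Rightarrow> bool"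
  where "K2 x y z v \<longleftrightarrow> E x y (x \<diamondop> y) v = 0 \<and> E x z (x \<diamondop> z) v = 0"

text \<open>All vectors \<open>?Gy (?Ez w)\<close> satisfy \<open>K2\<close>. If their norms were
  all in \<open>m\<close>, skew-adjointness would put \<open>?Ey (?Ey (?Ez (?Ez w)))\<close> into
  the radical for every \<open>w\<close>. Replacing \<open>w\<close> by a multiple with
  \<open>z\<close> or \<open>y\<close> changes the operators of the other element from
  \<open>E\<close> to \<open>G\<close>, and \<open>E_E_G_G\<close> strips them off until every
  vector is in the radical.\<close>

lemma ex_K2:
  assumes prm: "prm e m" and bas: "v.basic x y z" and h: "v.hgt x y z \<notin> m"
  shows "\<exists>w. K2 x y z w \<and> q w \<notin> m"
proof (rule ccontr)
  assume no: "\<not> ?thesis"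
  note im = prm_idl[OF prm]
  note pr = basic_pairs[OF bas]
  have h: "disc x \<notin> m" "q y \<notin> m" "q z \<notin> m"
    using h by (auto simp: v.hgt_def prm_mult[OF prm])
  let ?Ey = "E x y (x \<diamondop> y)" and ?Ez = "E x z (x \<diamondop> z)"
  let ?Gy = "G x y (x \<diamondop> y)" and ?Gz = "G x z (x \<diamondop> z)"
  have "K2 x y z (?Gy (?Ez w))" for w
    unfolding K2_def using E_G[OF pr(1)] E_G_E(1)[OF pr(1,2,4,6)] by simp
  then have qm: "q (?Gy (?Ez w)) \<in> m" for w using no by blast
  have R: "rad m (?Ey (?Ey (?Ez (?Ez w))))" for w
    unfolding rad_def
  proof
    fix w'
    have "b (?Ey (?Ey (?Ez (?Ez w)))) w' = b (?Ez (?Gy (?Gy (?Ez w)))) w'"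
      by (simp add: E_G_E(2)[OF pr(1,2,4,6)])
    also have "\<dots> = b (?Gy (?Ez w)) (?Gy (?Ez w'))"
      by (simp add: E_adjoint[OF pr(2)] G_adjoint[OF pr(1)])
    also have "\<dots> = q (?Gy (?Ez (w + w'))) - q (?Gy (?Ez w)) - q (?Gy (?Ez w'))"
      by (simp add: b_def E_lin G_lin)
    finally show "b (?Ey (?Ey (?Ez (?Ez w)))) w' \<in> m" using qm by (simp add: idl_diff im)
  qed
  have can: "rad m w" if "rad m (f \<bullet> w)" "imag f" "q f \<notin> m" for f w
    using rad_mu[OF that(1), of f] that rad_cancel[OF prm, of "- q f" w] idl_minus[OF im, of "- q f"]
    by (auto simp: imag_square minus_sc)
  have i: "imag y" "imag z" using bas by (auto simp: v.basic_def)
  have "rad m (?Gy (?Gy (?Ez (?Ez w))))" for w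
    using R[of "z \<bullet> w"] can[OF _ i(2) h(3)]
    by (simp add: E_self[OF pr(2)] E_lin E_swap[OF pr(1,4)])
  then have "rad m (- ((disc x * q y) \<cdot> ?Ez (?Ez w)))" for w
    using rad_add[OF im R] by (simp flip: E_E_G_G[OF pr(1)])
  then have S: "rad m (?Ez (?Ez w))" for w
    using rad_minus[OF im] rad_cancel[OF prm, of "disc x * q y"] h prm_mult[OF prm] by force
  have "rad m (?Gz (?Gz w))" for w
    using S[of "y \<bullet> w"] can[OF _ i(1) h(2)] by (simp add: E_swap[OF pr(2,7)])
  then have "rad m (- ((disc x * q z) \<cdot> w))" for w
    using rad_add[OF im S] by (simp flip: E_E_G_G[OF pr(2)])
  then have "rad m w" for w
    using rad_minus[OF im] rad_cancel[OF prm, of "disc x * q z"] h prm_mult[OF prm] by force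
  then show False using v.ex_trace[OF prm] unfolding rad_def by blast
qed

definition same :: "'m \<Rightarrow> 'm \<Rightarrow> 'm \<Rightarrow> 'm \<Rightarrow> bool"
  where "same x y z v \<longleftrightarrow> K2 x y z v \<and> E x (y \<diamondop> z) (x \<diamondop> (y \<diamondop> z)) v = 0"

definition oppo :: "'m \<Rightarrow> 'm \<Rightarrow> 'm \<Rightarrow> 'm \<Rightarrow> bool"
  where "oppo x y z v \<longleftrightarrow> K2 x y z v \<and> G x (y \<diamondop> z) (x \<diamondop> (y \<diamondop> z)) v = 0"

text \<open>The obstruction \<open>D\<close> to the third equation is orthogonal to seven of the
  eight basis elements, hence proportional to the vector \<open>g\<close> dual to \<open>F\<close>.
  Comparing norms gives \<open>c * (c + h * q v) = 0\<close> up to a power of \<open>h\<close>. The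
  root \<open>0\<close> is the equation for \<open>\<diamondop>\<close>, the root
  \<open>- (h * q v)\<close> the one for its opposite.\<close>

lemma dichotomy:
  assumes bas: "v.basic x y z" and k: "K2 x y z v"
  defines "h \<equiv> v.hgt x y z"
  shows "\<exists>c. same x y z ((h ^ 4 * q v * (c + h * q v)) \<cdot> v) \<and> oppo x y z ((h ^ 4 * q v * c) \<cdot> v)"
proof -
  note pr = basic_pairs[OF bas]
  define d where "d = y \<diamondop> z"
  define F where "F = x \<diamondop> d"
  have i: "imag y" "imag z" "b x y = 0" "b x z = 0" "b y z = 0" "b (x \<diamondop> y) z = 0"
    using bas by (auto simp: v.basic_def)
  note yz = v.basic_yz[OF bas, folded d_def, folded F_def]
  have k1: "(x \<diamondop> y) \<bullet> v = x \<bullet> (y \<bullet> v)" and k2: "(x \<diamondop> z) \<bullet> v = x \<bullet> (z \<bullet> v)"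
    using k by (auto simp: K2_def E_def)
  have prd: "pair x d F" using pr(3) by (simp add: d_def F_def)
  have pd: "imag d" "b x d = 0" "imag F" "b x F = 0" "q F = q x * q d" "b d F = b x un * q d"
    using prd by (auto simp: pair_def)
  have qd: "q d = q y * q z" by (simp add: d_def v.q_mu)
  have Fo: "b F (x \<diamondop> y) = 0" "b F (x \<diamondop> z) = 0"
    using v.b_mu_left[of x d y] v.b_mu_left[of x d z] yz by (simp_all add: F_def b_commute)
  \<comment> \<open>\<open>D \<bullet> v\<close> is \<open>q v\<close> times
    \<open>E x d F v\<close>. Multiplying by \<open>cj v\<close> moves the obstruction next to
    \<open>F\<close>, and pairing it with \<open>k\<close> brings in \<open>k \<bullet> v\<close>,
    to which the equations of \<open>K2\<close> apply.\<close>
  define D where "D = (x \<bullet> (d \<bullet> v)) \<bullet> cj v - q v \<cdot> F"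
  have Db: "b D k = b (x \<bullet> (d \<bullet> v)) (k \<bullet> v) - q v * b F k" for k
    by (simp add: D_def b_lin adj_right[of _ "cj v"])
  have xw: "b (x \<bullet> (d \<bullet> v)) w = b x un * b (d \<bullet> v) w - b (d \<bullet> v) (x \<bullet> w)" for w
    by (simp add: adj_left[of x] cj_def lin b_lin)
  have u: "b (d \<bullet> v) v = b d un * q v" using b_mu_right[of d v un] by (simp add: un_mu)
  have Dun: "b D un = 0"
    using pd by (simp add: Db un_mu xw u b_mu_right imag_def b_commute[of d x])
  have Dx: "b D x = 0"
    using pd by (simp add: Db b_mu_left u imag_def b_commute[of F x])
  have Dy: "b D y = 0"
    using yz Fo by (simp add: Db xw flip: k1) (simp add: b_mu_right b_commute[of d])
  have Dp1: "b D (x \<diamondop> y) = 0"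
    using yz Fo by (simp add: Db k1 b_mu_left b_mu_right b_commute[of d])
  have Dz: "b D z = 0"
    using yz Fo by (simp add: Db xw flip: k2) (simp add: b_mu_right b_commute[of d])
  have Dp2: "b D (x \<diamondop> z) = 0"
    using yz Fo by (simp add: Db k2 b_mu_left b_mu_right b_commute[of d])
  have Dd: "b D d = 0"
    using pd by (simp add: Db b_plane q_mu b_commute[of F d] algebra_simps)
  define c where "c = b D F"
  \<comment> \<open>In the plane of \<open>d\<close> and \<open>F\<close>, the direction orthogonal
    to \<open>d\<close>; it is orthogonal to every basis element except \<open>F\<close>.\<close>
  define g where "g = 2 \<cdot> F - b x un \<cdot> d"
  have h: "h = disc x * q d" by (simp add: h_def v.hgt_def qd mult.assoc)
  have gF: "b g F = h" "b g d = 0"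
    using pd by (simp_all add: g_def b_lin b_self b_commute[of F d] h disc_def algebra_simps)
  have g0: "b g un = 0" "b g x = 0" "b g y = 0" "b g (x \<diamondop> y) = 0" "b g z = 0" "b g (x \<diamondop> z) = 0"
    using pd yz Fo by (simp_all add: g_def b_lin imag_def b_commute[of F x] b_commute[of d])
  have "v.orth8 x y z (h \<cdot> D - c \<cdot> g)"
    unfolding v.orth8_def d_def[symmetric] F_def[symmetric]
    by (simp add: b_lin Dun Dx Dy Dp1 Dz Dp2 Dd g0 gF c_def)
  then have "h \<cdot> (h \<cdot> D - c \<cdot> g) = 0" using v.span[OF bas] by (simp add: h_def)
  then have hD: "(h * h) \<cdot> D = (h * c) \<cdot> g" by (simp add: lin)
  have qg: "q g = h" 
    using pd by (simp add: g_def q_diff q_sc b_lin b_commute[of F d] h disc_def algebra_simps)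
  \<comment> \<open>By definition \<open>D + q v \<cdot> F\<close> is a product, so its norm is
    known, and expanding that norm yields \<open>q D\<close>.\<close>
  have "q (D + q v \<cdot> F) = q x * q d * q v * q v"
    by (simp add: D_def q_mu q_cj)
  then have qD: "q D = - (q v * c)"
    using pd by (simp add: q_add q_sc sc_b c_def eq_neg_iff_add_eq_0 algebra_simps)
  have "h ^ 3 * c * (c + h * q v) = q ((h * c) \<cdot> g) - q ((h * h) \<cdot> D)"
    by (simp add: q_sc qD qg algebra_simps power3_eq_cube)
  then have key: "h ^ 3 * c * (c + h * q v) = 0" by (simp add: hD)
  have "(h * h) \<cdot> D \<bullet> v = (h * h * q v) \<cdot> (x \<bullet> (d \<bullet> v) - F \<bullet> v)"
    by (simp add: D_def lin mu_cj_mu_right mult.assoc)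
  then have main: "(h * h * q v) \<cdot> (x \<bullet> (d \<bullet> v) - F \<bullet> v) = (h * c) \<cdot> (g \<bullet> v)"
    using hD by (simp add: sc_mu)
  \<comment> \<open>The exponent 4 is a budget: \<open>main\<close> trades
    \<open>h * h * q v\<close> for \<open>h * c\<close>, and the remaining \<open>h ^ 2\<close>
    completes the \<open>h ^ 3\<close> required by \<open>key\<close>.\<close>
  have r1: "h ^ 4 * q v * (c + h * q v) = (h ^ 2 * (c + h * q v)) * (h * h * q v)"
    and r2: "(h ^ 2 * (c + h * q v)) * (h * c) = h ^ 3 * c * (c + h * q v)"
    and r3: "h ^ 4 * q v * c = (h ^ 2 * c) * (h * h * q v)"
    and r4: "(h ^ 2 * c) * (h * c + h * h * q v) = h ^ 3 * c * (c + h * q v)"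
    by (simp_all add: power2_eq_square power3_eq_cube power4_eq_xxxx algebra_simps)
  have "E x d F ((h ^ 4 * q v * (c + h * q v)) \<cdot> v)
    = (h ^ 2 * (c + h * q v)) \<cdot> (h * h * q v) \<cdot> (x \<bullet> (d \<bullet> v) - F \<bullet> v)"
    by (simp only: E_lin(2) r1 sc_sc) (simp only: E_def)
  also have "\<dots> = 0"
    unfolding main sc_sc r2 key by simp
  finally have 1: "E x d F ((h ^ 4 * q v * (c + h * q v)) \<cdot> v) = 0" .
  have "G x d F v = (x \<bullet> (d \<bullet> v) - F \<bullet> v) + g \<bullet> v"
    by (simp add: G_def g_def lin two_sc)
  then have "G x d F ((h ^ 4 * q v * c) \<cdot> v)
    = (h ^ 2 * c) \<cdot> (h * h * q v) \<cdot> ((x \<bullet> (d \<bullet> v) - F \<bullet> v) + g \<bullet> v)"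
    by (simp only: G_lin(2) r3 sc_sc)
  also have "\<dots> = (h ^ 2 * c) \<cdot> ((h * c) \<cdot> (g \<bullet> v) + (h * h * q v) \<cdot> (g \<bullet> v))"
    unfolding sc_add[of "h * h * q v"] main ..
  also have "\<dots> = 0"
    unfolding sc_add sc_sc add_sc[symmetric] r4 key by simp
  finally have 2: "G x d F ((h ^ 4 * q v * c) \<cdot> v) = 0" .
  show ?thesis
    using 1 2 k by (intro exI[of _ c]) (simp add: same_def oppo_def K2_def E_lin d_def F_def)
qed

section \<open>The relation of \<open>y\<close> and \<open>z\<close> with their product
  \<open>d\<close>\<close>

context
  fixes x y z d F :: 'm
  assumes bas: "v.basic x y z" and d: "d = y \<diamondop> z" and F: "F = x \<diamondop> d"
begin

lemma same_iff: "same x y z v \<longleftrightarrow>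
    (x \<diamondop> y) \<bullet> v = x \<bullet> (y \<bullet> v) \<and> (x \<diamondop> z) \<bullet> v = x \<bullet> (z \<bullet> v) \<and> F \<bullet> v = x \<bullet> (d \<bullet> v)"
  by (auto simp: same_def K2_def E_def d F)

lemma imags: "imag y" "imag z" "imag d" "b x y = 0" "b x z = 0" "b x d = 0"
    "b y z = 0" "b y d = 0" "b z d = 0" "b (x \<diamondop> y) z = 0" "b (x \<diamondop> z) d = 0" "b F y = 0"
    "b un y = 0" "b un z = 0" "b un d = 0"
    "b x (x \<diamondop> y) = 0" "b x (x \<diamondop> z) = 0" "b x F = 0"
    "b un (x \<diamondop> y) = 0" "b un (x \<diamondop> z) = 0" "b un F = 0" "q d = q y * q z"
  using bas v.basic_yz[OF bas] basic_pairs[OF bas]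
  by (auto simp: v.basic_def pair_def imag_def d F b_commute[of un] v.q_mu)

lemma words:
  "y \<bullet> (y \<bullet> w) = - (q y \<cdot> w)" "z \<bullet> (z \<bullet> w) = - (q z \<cdot> w)" "d \<bullet> (d \<bullet> w) = - ((q y * q z) \<cdot> w)"
  "z \<bullet> (y \<bullet> w) = - (y \<bullet> (z \<bullet> w))" "d \<bullet> (y \<bullet> w) = - (y \<bullet> (d \<bullet> w))"
  "d \<bullet> (z \<bullet> w) = - (z \<bullet> (d \<bullet> w))"
  "y \<bullet> (x \<bullet> w) = b x un \<cdot> (y \<bullet> w) - x \<bullet> (y \<bullet> w)"
  "z \<bullet> (x \<bullet> w) = b x un \<cdot> (z \<bullet> w) - x \<bullet> (z \<bullet> w)"
  "d \<bullet> (x \<bullet> w) = b x un \<cdot> (d \<bullet> w) - x \<bullet> (d \<bullet> w)"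
  using imags imag_square[of y w] imag_square[of z w] imag_square[of d w]
    imag_swap[of y z w] imag_swap[of y d w] imag_swap[of z d w]
    imag_any[of y x w] imag_any[of z x w] imag_any[of d x w]
  by simp_all

text \<open>The volume element of the Clifford algebra generated by the anticommuting
  \<open>y\<close>, \<open>z\<close>, \<open>d\<close>. Its square is the scalar with root
  \<open>q y * q z\<close>, so it divides the solutions of \<open>same\<close> into two
  halves.\<close>

definition T :: "'m \<Rightarrow> 'm" where "T w = y \<bullet> (z \<bullet> (d \<bullet> w))"

text \<open>Where the scalars involved are invertible, this is a multiple of the projection onto the
  half on which \<open>T\<close> acts as \<open>- (q y * q z)\<close>; there
  \<open>y \<bullet> (z \<bullet> u) = d \<bullet> u\<close> holds.\<close>

definition U :: "'m \<Rightarrow> 'm" where "U w = T w - (q y * q z) \<cdot> w"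

lemma T_lin: "T (v + w) = T v + T w" "T (r \<cdot> w) = r \<cdot> T w" "T (v - w) = T v - T w"
  by (simp_all add: T_def lin)

lemma same_lin: "same x y z v \<Longrightarrow> same x y z w \<Longrightarrow> same x y z (v - w)"
  "same x y z v \<Longrightarrow> same x y z (r \<cdot> v)"
  by (simp_all add: same_iff lin)

lemma same_x: "same x y z v \<Longrightarrow> same x y z (x \<bullet> v)"
  using basic_pairs(1,2,3)[OF bas] by (simp add: same_def K2_def pair_x)

text \<open>Each operator \<open>E\<close> passes one of the three factors of \<open>T\<close> with
  a sign and is exchanged with \<open>G\<close> by the other two, so it comes out as
  \<open>E\<close> again.\<close>

lemma same_T: "same x y z v \<Longrightarrow> same x y z (T v)"
  unfolding same_def K2_def T_def unfolding d
  using basic_pairs[OF bas] by (simp add: E_self E_swap G_swap G_self E_lin G_lin)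

lemma same_U: "same x y z v \<Longrightarrow> same x y z (U v)"
  by (simp add: U_def same_lin same_T)

lemma U_yz: "y \<bullet> (z \<bullet> U v) = d \<bullet> U v"
  by (simp add: U_def T_def words lin algebra_simps)

lemma T_x: "T (x \<bullet> v) = b x un \<cdot> T v - x \<bullet> T v"
  by (simp add: T_def words lin)

lemma q_T: "q (T v) = (q y * q z) * (q y * q z) * q v"
  by (simp add: T_def q_mu imags ac_simps)

lemma q_U: "q (U v) = (q y * q z) * (2 * (q y * q z) * q v - b v (T v))"
  by (simp add: U_def q_diff q_sc q_T b_lin b_commute algebra_simps)

lemma b_T_x: "b (x \<bullet> v) (T (x \<bullet> v)) = b x un * b (x \<bullet> v) (T v) - q x * b v (T v)"
  by (simp add: T_x b_lin b_mu_left)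

text \<open>Passing \<open>x\<close> through \<open>T\<close> conjugates it, and conjugation negates
  \<open>2 \<cdot> x - b x un \<cdot> un\<close>. Multiplying \<open>v\<close> by this element thus
  scales \<open>b v (T v)\<close> and \<open>q v\<close> by \<open>disc x\<close> with opposite
  signs.\<close>

lemma b_T_disc:
  "b (2 \<cdot> (x \<bullet> v) - b x un \<cdot> v) (T (2 \<cdot> (x \<bullet> v) - b x un \<cdot> v)) = - (disc x * b v (T v))"
proof -
  have "b (x \<bullet> T v) v = b x un * b v (T v) - b (x \<bullet> v) (T v)"
    by (simp add: adj_left[of x] cj_def lin b_lin b_commute)
  then have *: "b v (x \<bullet> T v) = b x un * b v (T v) - b (x \<bullet> v) (T v)"
    by (simp add: b_commute)
  show ?thesis
    by (simp add: T_x T_lin b_lin b_mu_left disc_def * algebra_simps)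
qed

lemma q_disc_mu: "q (2 \<cdot> (x \<bullet> v) - b x un \<cdot> v) = disc x * q v"
  using q_disc[of x] q_mu[of "2 \<cdot> x - b x un \<cdot> un" v] by (simp add: lin)

lemma T_cyc: "T v = z \<bullet> (d \<bullet> (y \<bullet> v))" "T v = d \<bullet> (y \<bullet> (z \<bullet> v))"
  by (simp_all add: T_def words lin)

text \<open>Multiplication by an imaginary element is skew-adjoint. The common factor
  \<open>f\<close> splits off, and what is left are inner products of \<open>k\<close> with
  \<open>g\<close> and with \<open>x \<diamondop> g\<close>.\<close>

lemma triple_orth:
  assumes "imag f" "imag g" "b g k = 0" "b x f = 0" "b x g = 0"
    and "x \<bullet> (g \<bullet> v) = (x \<diamondop> g) \<bullet> v" "b (x \<diamondop> g) k = 0"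
  shows "b (f \<bullet> (g \<bullet> (k \<bullet> v))) (f \<bullet> v) = 0" "b (f \<bullet> (g \<bullet> (k \<bullet> v))) (x \<bullet> (f \<bullet> v)) = 0"
proof -
  have g: "b (g \<bullet> w) w' = - b w (g \<bullet> w')" for w w'
    using assms by (simp add: adj_left[of g] imag_cj minus_mu b_minus)
  have kg: "b (k \<bullet> v) (g \<bullet> v) = 0" using assms by (simp add: b_mu_right b_commute)
  show 1: "b (f \<bullet> (g \<bullet> (k \<bullet> v))) (f \<bullet> v) = 0"
    by (simp add: b_mu_left g kg)
  have "b (k \<bullet> v) (g \<bullet> (x \<bullet> v)) = 0"
    using imag_any[of g x v] assms kg by (simp add: b_lin b_mu_right b_commute[of k])
  then have "b (f \<bullet> (g \<bullet> (k \<bullet> v))) (f \<bullet> (x \<bullet> v)) = 0"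
    by (simp add: b_mu_left g)
  moreover have "x \<bullet> (f \<bullet> v) = b x un \<cdot> (f \<bullet> v) - f \<bullet> (x \<bullet> v)"
    using imag_any[of f x v] assms by simp
  ultimately show "b (f \<bullet> (g \<bullet> (k \<bullet> v))) (x \<bullet> (f \<bullet> v)) = 0"
    using 1 by (simp add: b_lin)
qed

lemma T_orth:
  assumes s: "same x y z v"
  shows "b (T v) (y \<bullet> v) = 0" "b (T v) ((x \<diamondop> y) \<bullet> v) = 0" "b (T v) (z \<bullet> v) = 0"
    "b (T v) ((x \<diamondop> z) \<bullet> v) = 0" "b (T v) (d \<bullet> v) = 0" "b (T v) (F \<bullet> v) = 0"
proof -
  have k: "(x \<diamondop> y) \<bullet> v = x \<bullet> (y \<bullet> v)" "(x \<diamondop> z) \<bullet> v = x \<bullet> (z \<bullet> v)" "F \<bullet> v = x \<bullet> (d \<bullet> v)"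
    using s by (auto simp: same_iff)
  have "b d y = 0" using imags b_commute[of d y] by simp
  then show "b (T v) (y \<bullet> v) = 0" "b (T v) ((x \<diamondop> y) \<bullet> v) = 0" "b (T v) (z \<bullet> v) = 0"
    "b (T v) ((x \<diamondop> z) \<bullet> v) = 0" "b (T v) (d \<bullet> v) = 0" "b (T v) (F \<bullet> v) = 0"
    using triple_orth[of y z d v] triple_orth[of z d y v] triple_orth[of d y z v] k imags
    by (simp_all add: F flip: T_cyc T_def)
qed

text \<open>By \<open>T_orth\<close>, \<open>T v\<close> is orthogonal to
  \<open>k \<bullet> v\<close> for the six basis elements \<open>k\<close> other than
  \<open>un\<close> and \<open>x\<close>. Subtracting \<open>plane x v (T v)\<close>, whose
  coefficients are \<open>\<alpha>\<close> and \<open>\<beta>\<close>, handles the last two, and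
  multiplication by \<open>cj v\<close> makes \<open>span\<close> applicable.\<close>

lemma T_span:
  assumes s: "same x y z v"
  defines "f0 \<equiv> b v (T v)" and "f1 \<equiv> b (x \<bullet> v) (T v)"
  defines "\<alpha> \<equiv> 2 * q x * f0 - b x un * f1" and "\<beta> \<equiv> 2 * f1 - b x un * f0"
  shows "(v.hgt x y z * q v) \<cdot> ((disc x * q v) \<cdot> T v - \<alpha> \<cdot> v - \<beta> \<cdot> (x \<bullet> v)) = 0"
proof -
  define v' where "v' = (disc x * q v) \<cdot> T v - \<alpha> \<cdot> v - \<beta> \<cdot> (x \<bullet> v)"
  have k: "x \<bullet> (y \<bullet> v) = (x \<diamondop> y) \<bullet> v" "x \<bullet> (z \<bullet> v) = (x \<diamondop> z) \<bullet> v" "x \<bullet> (d \<bullet> v) = F \<bullet> v"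
    using s by (auto simp: same_iff)
  have Wb: "b (v' \<bullet> cj v) k = b v' (k \<bullet> v)" for k
    by (simp add: adj_right[of _ "cj v"])
  have vk: "b v (k \<bullet> v) = b un k * q v" for k
    using b_mu_right[of un v k] by (simp add: un_mu)
  have Tv: "b (T v) v = f0" "b (T v) (x \<bullet> v) = f1"
    by (simp_all add: f0_def f1_def b_commute)
  have vx: "b v (x \<bullet> v) = b x un * q v" "b (x \<bullet> v) v = b x un * q v"
    by (simp_all add: b_plane)
  have "v.orth8 x y z (v' \<bullet> cj v)"
    unfolding v.orth8_def d[symmetric] F[symmetric] Wb
    by (simp add: v'_def b_lin T_orth[OF s] vk b_mu_right imags un_mu Tv vx b_self q_mu b_commute[of un x]
        \<alpha>_def \<beta>_def disc_def algebra_simps)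
  then have "v.hgt x y z \<cdot> (v' \<bullet> cj v) = 0" using v.span[OF bas] by blast
  then have "(v.hgt x y z \<cdot> (v' \<bullet> cj v)) \<bullet> v = 0" by simp
  then show ?thesis unfolding sc_mu mu_cj_mu_right sc_sc v'_def .
qed

text \<open>Otherwise \<open>q (U w)\<close> is in \<open>m\<close> for every solution
  \<open>w\<close> of \<open>same\<close>. If 2 is not in \<open>m\<close>, comparing
  \<open>v\<close> with \<open>2 \<cdot> (x \<bullet> v) - b x un \<cdot> v\<close>, where
  \<open>b_T_disc\<close> flips a sign, puts \<open>4 * K * q v\<close> into \<open>m\<close>. If 2
  is in \<open>m\<close>, then \<open>v\<close> and \<open>x \<bullet> v\<close> show that
  \<open>T v\<close> pairs with both of them into \<open>m\<close>; by \<open>T_span\<close> its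
  norm would be in \<open>m\<close> too, but \<open>q_T\<close> says it is not.\<close>

lemma ex_same_yz:
  assumes prm: "prm e m" and h: "v.hgt x y z \<notin> m" and s: "same x y z v" and qv: "q v \<notin> m"
  shows "\<exists>u. same x y z u \<and> y \<bullet> (z \<bullet> u) = d \<bullet> u \<and> q u \<notin> m"
proof (rule ccontr)
  assume no: "\<not> ?thesis"
  note im = prm_idl[OF prm]
  have hm: "disc x \<notin> m" "q y \<notin> m" "q z \<notin> m"
    using h by (auto simp: v.hgt_def prm_mult[OF prm])
  have U: "q (U w) \<in> m" if "same x y z w" for w
    using no same_U[OF that] U_yz by blast
  define K where "K = q y * q z"
  have Km: "K \<notin> m" using hm by (simp add: K_def prm_mult[OF prm])
  have U': "2 * K * q w - b w (T w) \<in> m" if "same x y z w" for w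
    using U[OF that] Km unfolding q_U K_def[symmetric] prm_mult[OF prm, of K] by blast
  define f0 where "f0 = b v (T v)"
  define f1 where "f1 = b (x \<bullet> v) (T v)"
  have 1: "2 * K * q v - f0 \<in> m" using U'[OF s] by (simp add: f0_def)
  show False
  proof (cases "2 \<in> m")
    case False
    have "same x y z (2 \<cdot> (x \<bullet> v) - b x un \<cdot> v)"
      using s by (intro same_lin same_x)
    from U'[OF this] have "disc x * (2 * K * q v + f0) \<in> m"
      unfolding q_disc_mu b_T_disc by (simp add: f0_def algebra_simps)
    then have "2 * K * q v + f0 \<in> m" using hm by (simp add: prm_mult[OF prm])
    then have "(2 * K * q v - f0) + (2 * K * q v + f0) \<in> m" using idl_add[OF im 1] by blast
    also have "(2 * K * q v - f0) + (2 * K * q v + f0) = 2 * (2 * (K * q v))" by simp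
    finally show False using False Km qv unfolding prm_mult[OF prm] by blast
  next
    case True
    have two: "2 * r \<in> m" for r using idl_mult_right[OF im True] .
    have f0: "f0 \<in> m" using idl_diff[OF im two[of "K * q v"] 1] by (simp add: mult.assoc)
    have "2 * K * q (x \<bullet> v) - (b x un * f1 - q x * f0) \<in> m"
      using U'[OF same_x[OF s]] by (simp add: b_T_x f0_def f1_def)
    then have "2 * (K * q (x \<bullet> v)) - (2 * K * q (x \<bullet> v) - (b x un * f1 - q x * f0)) + q x * f0 \<in> m"
      using idl_add[OF im idl_diff[OF im two] idl_mult[OF im f0]] by blast
    then have "b x un * f1 \<in> m" by (simp add: mult.assoc)
    moreover have "b x un \<notin> m"
    proof
      assume "b x un \<in> m"
      then have "2 * (2 * q x) - b x un * b x un \<in> m" by (intro idl_diff im two idl_mult)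
      then show False using hm(1) by (simp add: disc_def)
    qed
    ultimately have f1: "f1 \<in> m" by (simp add: prm_mult[OF prm])
    define \<alpha> where "\<alpha> = 2 * q x * f0 - b x un * f1"
    define \<beta> where "\<beta> = 2 * f1 - b x un * f0"
    define g where "g = v.hgt x y z * q v"
    have ab: "\<alpha> \<in> m" "\<beta> \<in> m"
      unfolding \<alpha>_def \<beta>_def using f0 f1 by (auto intro!: idl_diff im idl_mult)
    have "g \<cdot> ((disc x * q v) \<cdot> T v - \<alpha> \<cdot> v - \<beta> \<cdot> (x \<bullet> v)) = 0"
      using T_span[OF s] by (simp add: g_def \<alpha>_def \<beta>_def f0_def f1_def)
    then have "(g * (disc x * q v)) \<cdot> T v = g \<cdot> (\<alpha> \<cdot> v + \<beta> \<cdot> (x \<bullet> v))"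
      by (simp add: sc_diff sc_add sc_sc algebra_simps)
    then have "q ((g * (disc x * q v)) \<cdot> T v) = q (g \<cdot> (\<alpha> \<cdot> v + \<beta> \<cdot> (x \<bullet> v)))" by simp
    moreover have "q (g \<cdot> (\<alpha> \<cdot> v + \<beta> \<cdot> (x \<bullet> v))) \<in> m"
      unfolding q_sc q_add b_lin mult.assoc
      by ((rule idl_mult[OF im])+, intro idl_add[OF im] ab[THEN idl_mult_right[OF im]])
    moreover have "q ((g * (disc x * q v)) \<cdot> T v) \<notin> m"
      using Km hm h qv unfolding q_sc q_T K_def[symmetric] g_def by (simp add: prm_mult[OF prm])
    ultimately show False by simp
  qed
qed

end

section \<open>From a basic triple to all products\<close>

definition twist :: "'m \<Rightarrow> bool" where "twist u \<longleftrightarrow> (\<forall>a c. (a \<diamondop> c) \<bullet> u = a \<bullet> (c \<bullet> u))"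

lemma all_of_eight:
  assumes bas: "v.basic x y z"
    and f: "\<And>v w. f (v + w) = f v + f w" "\<And>r v. f (r \<cdot> v) = r \<cdot> f v"
    and zero: "f un = 0" "f x = 0" "f y = 0" "f (x \<diamondop> y) = 0" "f z = 0" "f (x \<diamondop> z) = 0"
      "f (y \<diamondop> z) = 0" "f (x \<diamondop> (y \<diamondop> z)) = 0"
  shows "(v.hgt x y z * v.hgt x y z) \<cdot> f v = 0"
proof -
  obtain c1 c2 c3 c4 c5 c6 c7 c8 where *: "(v.hgt x y z * v.hgt x y z) \<cdot> v =
    c1 \<cdot> un + c2 \<cdot> x + c3 \<cdot> y + c4 \<cdot> (x \<diamondop> y) + c5 \<cdot> z + c6 \<cdot> (x \<diamondop> z)
    + c7 \<cdot> (y \<diamondop> z) + c8 \<cdot> (x \<diamondop> (y \<diamondop> z))"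
    using v.expand_ex[OF bas] by blast
  show ?thesis unfolding f(2)[symmetric] * by (simp add: f zero)
qed

definition ok :: "'m \<Rightarrow> 'm \<Rightarrow> 'm \<Rightarrow> bool" where "ok u a c \<longleftrightarrow> (a \<diamondop> c) \<bullet> u = a \<bullet> (c \<bullet> u)"

lemma ok_sc: "ok u a c \<Longrightarrow> ok (r \<cdot> u) a c"
  by (simp add: ok_def mu_sc)

lemma ok_un: "ok u a un" "ok u un a"
  by (simp_all add: ok_def v.mu_un v.un_mu un_mu)

lemma ok_square: "ok u a a"
  by (simp add: ok_def v.mu_self square lin)

lemma ok_twice: "ok u a c \<Longrightarrow> ok u a (a \<diamondop> c)"
  by (simp add: ok_def v.square square lin)

lemma ok_eight_right:
  assumes bas: "v.basic x y z" and ok: "ok u a un" "ok u a x" "ok u a y" "ok u a (x \<diamondop> y)" "ok u a z"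
    "ok u a (x \<diamondop> z)" "ok u a (y \<diamondop> z)" "ok u a (x \<diamondop> (y \<diamondop> z))"
  shows "ok ((v.hgt x y z * v.hgt x y z) \<cdot> u) a c"
  using all_of_eight[OF bas, of "\<lambda>c. (a \<diamondop> c) \<bullet> u - a \<bullet> (c \<bullet> u)" c] ok
  by (simp add: ok_def lin v.mu_add v.mu_sc)

text \<open>Both products satisfy \<open>clifford\<close>, so \<open>a\<close> and \<open>x\<close>
  can be exchanged on the two sides alike. Afterwards \<open>x\<close> is the outer factor, where
  the equation is known for all arguments, and \<open>a\<close> meets only \<open>c\<close>.\<close>

lemma ok_step:
  assumes x: "\<And>c. ok u x c" and a: "ok u a c"
  shows "ok u a (x \<diamondop> c)"
proof -
  have x': "(cj x \<diamondop> c) \<bullet> u = cj x \<bullet> (c \<bullet> u)" for c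
    using x[of c] by (simp add: ok_def cj_def lin v.diff_mu v.sc_mu v.un_mu)
  have a': "(cj a \<diamondop> c) \<bullet> u = cj a \<bullet> (c \<bullet> u)"
    using a by (simp add: ok_def cj_def lin v.diff_mu v.sc_mu v.un_mu)
  have "a \<diamondop> (x \<diamondop> c) = b a (cj x) \<cdot> c - cj x \<diamondop> (cj a \<diamondop> c)"
    using v.clifford[of a "cj x" c] by (simp add: algebra_simps)
  moreover have "a \<bullet> (x \<bullet> (c \<bullet> u)) = b a (cj x) \<cdot> (c \<bullet> u) - cj x \<bullet> (cj a \<bullet> (c \<bullet> u))"
    using clifford[of a "cj x" "c \<bullet> u"] by (simp add: algebra_simps)
  ultimately show ?thesis
    using x[of c] by (simp add: ok_def lin x' a')
qed

text \<open>Each of four rounds pays one factor \<open>s\<close> to \<open>ok_eight_right\<close>: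
  the left factor is \<open>x\<close>, then \<open>y\<close>, then \<open>z\<close>, then
  arbitrary.\<close>

lemma twist_of_same:
  assumes bas: "v.basic x y z" and same: "same x y z u" and yz: "y \<bullet> (z \<bullet> u) = (y \<diamondop> z) \<bullet> u"
  defines "s \<equiv> v.hgt x y z * v.hgt x y z"
  shows "twist (s \<cdot> s \<cdot> s \<cdot> s \<cdot> u)"
proof -
  have k: "ok u x y" "ok u x z" "ok u x (y \<diamondop> z)" "ok u y z"
    using same yz by (auto simp: same_iff[OF bas refl refl] ok_def)
  have x: "ok (s \<cdot> u) x c" for c
    unfolding s_def by (intro ok_eight_right[OF bas] ok_twice k ok_un ok_square)
  have st: "ok v a un \<Longrightarrow> ok v a y \<Longrightarrow> ok v a z \<Longrightarrow> ok v a (y \<diamondop> z) \<Longrightarrow> (\<And>c. ok v x c) \<Longrightarrow> ok (s \<cdot> v) a c"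
    for v a c
    unfolding s_def using ok_step[of v x a un]
    by (intro ok_eight_right[OF bas]) (auto intro: ok_step simp: v.mu_un)
  have y: "ok (s \<cdot> s \<cdot> u) y c" for c
    by (rule st[OF ok_un(1) ok_square ok_sc[OF k(4)] ok_twice[OF ok_sc[OF k(4)]] x])
  \<comment> \<open>With \<open>c = un\<close>, \<open>ok_step\<close> turns a left factor that is
    good for all arguments into a right factor that is good for all arguments.\<close>
  have yy: "ok (s \<cdot> s \<cdot> u) a y" for a
    using ok_step[OF y ok_un(1)] by (simp add: v.mu_un)
  have z: "ok (s \<cdot> s \<cdot> s \<cdot> u) z c" for c
    by (rule st[OF ok_un(1) yy ok_square ok_step[OF y ok_square] ok_sc[OF x]])
  have zz: "ok (s \<cdot> s \<cdot> s \<cdot> u) a z" for a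
    using ok_step[OF z ok_un(1)] by (simp add: v.mu_un)
  have "ok (s \<cdot> s \<cdot> s \<cdot> s \<cdot> u) a c" for a c
    by (rule st[OF ok_un(1) ok_sc[OF yy] zz ok_step[OF ok_sc[OF y] zz] ok_sc[OF ok_sc[OF x]]])
  then show ?thesis by (simp add: twist_def ok_def)
qed

lemma opposite: "two_products sc mu (\<lambda>a c. c \<diamondop> a) un q e"
  by (unfold_locales; (fact sc_add add_sc sc_sc one_sc q_sc polar_add polar_sc q_un v.idem v.rank
      | erule nondegenerate)?)
    (simp_all add: v.add_mu v.mu_add v.sc_mu v.mu_sc v.un_mu v.mu_un v.q_mu mult.commute)

definition cotwist :: "'m \<Rightarrow> bool" where "cotwist u \<longleftrightarrow> (\<forall>a c. (c \<diamondop> a) \<bullet> u = a \<bullet> (c \<bullet> u))"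

lemma cotwist_eq: "cotwist = two_products.twist mu (\<lambda>a c. c \<diamondop> a)"
  by (intro ext) (simp add: cotwist_def two_products.twist_def[OF opposite])

lemma ex_twist_of_same:
  assumes prm: "prm e m" and bas: "v.basic x y z" and h: "v.hgt x y z \<notin> m"
    and s: "same x y z v" and qv: "q v \<notin> m"
  shows "\<exists>u. twist u \<and> q u \<notin> m"
proof -
  obtain u where u: "same x y z u" "y \<bullet> (z \<bullet> u) = (y \<diamondop> z) \<bullet> u" "q u \<notin> m"
    using ex_same_yz[OF bas refl refl prm h s qv] by blast
  show ?thesis
    using twist_of_same[OF bas u(1,2)] u(3) h
    by (intro exI conjI) (assumption, simp add: q_sc prm_mult[OF prm])
qed

text \<open>A prime that contains both \<open>c\<close> and \<open>c + ?h * q v\<close> contains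
  \<open>?h * q v\<close>. So at least one of the two multiples of \<open>v\<close> supplied by
  \<open>dichotomy\<close> has norm outside \<open>m\<close>.\<close>

lemma ex_twist:
  assumes prm: "prm e m"
  shows "\<exists>u. (twist u \<or> cotwist u) \<and> q u \<notin> m"
proof -
  note im = prm_idl[OF prm]
  interpret o: two_products sc mu "\<lambda>a c. c \<diamondop> a" un q e by (rule opposite)
  obtain x y z where bas: "v.basic x y z" and h: "v.hgt x y z \<notin> m"
    using v.ex_basic[OF prm] by blast
  obtain v where k: "K2 x y z v" and qv: "q v \<notin> m"
    using ex_K2[OF prm bas h] by blast
  let ?h = "v.hgt x y z"
  obtain c where c: "same x y z ((?h ^ 4 * q v * (c + ?h * q v)) \<cdot> v)"
    "oppo x y z ((?h ^ 4 * q v * c) \<cdot> v)"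
    using dichotomy[OF bas k] by blast
  have h4: "?h ^ 4 \<notin> m" using prm_power[OF prm] h by blast
  show ?thesis
  proof (cases "c \<in> m")
    case True
    have "c + ?h * q v \<notin> m"
      using idl_diff[OF im _ True, of "c + ?h * q v"] h qv by (auto simp: prm_mult[OF prm])
    then have "q ((?h ^ 4 * q v * (c + ?h * q v)) \<cdot> v) \<notin> m"
      using h4 qv unfolding q_sc by (simp add: prm_mult[OF prm])
    then show ?thesis using ex_twist_of_same[OF prm bas h c(1)] by blast
  next
    case False
    define v1 where "v1 = (?h ^ 4 * q v * c) \<cdot> v"
    have q1: "q v1 \<notin> m"
      using h4 qv False unfolding v1_def q_sc by (simp add: prm_mult[OF prm])
    note pr = basic_pairs[OF bas]
    have E1: "E x y (x \<diamondop> y) v1 = 0" "E x z (x \<diamondop> z) v1 = 0"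
      "G x (y \<diamondop> z) (x \<diamondop> (y \<diamondop> z)) v1 = 0"
      using c(2) by (auto simp: v1_def oppo_def K2_def)
    \<comment> \<open>At \<open>v1\<close> the operators for \<open>y\<close> and \<open>z\<close>
      vanish as \<open>E\<close>, the one for \<open>y \<diamondop> z\<close> as \<open>G\<close>.
      Multiplication by \<open>z\<close> and \<open>y\<close> changes the first two to
      \<open>G\<close> and restores the third, so \<open>w\<close> satisfies \<open>same\<close> for
      the opposite product.\<close>
    define w where "w = y \<bullet> (z \<bullet> v1)"
    have G: "G x y (x \<diamondop> y) w = 0" "G x z (x \<diamondop> z) w = 0" "G x (y \<diamondop> z) (x \<diamondop> (y \<diamondop> z)) w = 0"
      using E1 pr by (simp_all add: w_def G_self E_self G_swap E_swap E_lin G_lin)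
    have i: "imag y" "imag z" "b x y = 0" "b x z = 0" "b y z = 0" "b (x \<diamondop> y) z = 0"
      using bas by (auto simp: v.basic_def)
    have yz: "imag (y \<diamondop> z)" "b x (y \<diamondop> z) = 0" using v.basic_yz[OF bas] by auto
    have sw: "y \<diamondop> x = b x un \<cdot> y - x \<diamondop> y" "z \<diamondop> x = b x un \<cdot> z - x \<diamondop> z" "z \<diamondop> y = - (y \<diamondop> z)"
      "(y \<diamondop> z) \<diamondop> x = b x un \<cdot> (y \<diamondop> z) - x \<diamondop> (y \<diamondop> z)"
      using v.imag_any_right[OF i(1,3)] v.imag_any_right[OF i(2,4)] v.imag_swap[OF i(1,2,5), of un]
        v.imag_any_right[OF yz] by (simp_all add: v.mu_un)
    have "o.v.basic x y z" using i unfolding o.v.basic_def sw by (simp add: b_lin)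
    moreover have "o.same x y z w"
      unfolding o.same_iff[OF calculation refl refl] sw
      using G by (simp add: G_def lin v.minus_mu sw algebra_simps)
    moreover have "o.v.hgt x y z \<notin> m" using h by (simp add: o.v.hgt_def v.hgt_def)
    moreover have "q w \<notin> m"
      using h q1 by (simp add: w_def q_mu v.hgt_def prm_mult[OF prm])
    ultimately show ?thesis
      using o.ex_twist_of_same[OF prm] unfolding cotwist_eq by blast
  qed
qed

end

section \<open>The nucleus and the gluing of local solutions\<close>

context ranked_composition_algebra
begin

text \<open>Cramer's rule for two equations in \<open>b w f\<close> and
  \<open>b w (x \<bullet> f)\<close> whose determinant is \<open>disc x\<close> up to sign.\<close>

lemma plane_annihilated:
  assumes "r * (2 * b w (x \<bullet> f) - b x un * b w f) = 0"
    and "r * (b x un * b w (x \<bullet> f) - 2 * q x * b w f) = 0"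
  shows "(r * disc x) * b w f = 0" "(r * disc x) * b w (x \<bullet> f) = 0"
proof -
  have "(r * disc x) * b w f = b x un * (r * (2 * b w (x \<bullet> f) - b x un * b w f))
    - 2 * (r * (b x un * b w (x \<bullet> f) - 2 * q x * b w f))"
    by (simp add: disc_def algebra_simps)
  then show "(r * disc x) * b w f = 0" by (simp add: assms)
  have "(r * disc x) * b w (x \<bullet> f) = 2 * q x * (r * (2 * b w (x \<bullet> f) - b x un * b w f))
    - b x un * (r * (b x un * b w (x \<bullet> f) - 2 * q x * b w f))"
    by (simp add: disc_def algebra_simps)
  then show "(r * disc x) * b w (x \<bullet> f) = 0" by (simp add: assms)
qed

text \<open>The second equation of the system is the first one with \<open>x \<bullet> f\<close> in
  place of \<open>f\<close>.\<close>

lemma orth_of_planes: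
  assumes P: "\<And>f. P f \<Longrightarrow> r * (2 * b w (x \<bullet> f) - b x un * b w f) = 0"
    and "P f" "P (x \<bullet> f)"
  shows "(r * disc x) * b w f = 0" "(r * disc x) * b w (x \<bullet> f) = 0"
proof -
  have 1: "r * (2 * b w (x \<bullet> f) - b x un * b w f) = 0" using P assms by blast
  have "r * (b x un * b w (x \<bullet> f) - 2 * q x * b w f) = r * (2 * b w (x \<bullet> (x \<bullet> f)) - b x un * b w (x \<bullet> f))"
    by (simp add: square b_lin algebra_simps)
  then have 2: "r * (b x un * b w (x \<bullet> f) - 2 * q x * b w f) = 0" using P assms by simp
  show "(r * disc x) * b w f = 0" "(r * disc x) * b w (x \<bullet> f) = 0"
    using plane_annihilated[OF 1 2] by auto
qed

text \<open>Taking adjoints of the hypothesis: \<open>w\<close> is orthogonal to all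
  associators.\<close>

lemma nucleus_orth:
  assumes w: "\<And>a c. (a \<bullet> c) \<bullet> w = a \<bullet> (c \<bullet> w)"
  shows "b w ((a \<bullet> c) \<bullet> k) = b w (a \<bullet> (c \<bullet> k))"
proof -
  have "b ((cj c \<bullet> cj a) \<bullet> w) k = b w ((a \<bullet> c) \<bullet> k)"
    by (simp add: adj_left[of "cj c \<bullet> cj a"] cj_mult)
  moreover have "b (cj c \<bullet> (cj a \<bullet> w)) k = b w (a \<bullet> (c \<bullet> k))"
    by (simp add: adj_left[of "cj c"] adj_left[of "cj a"])
  ultimately show ?thesis by (simp add: w)
qed

text \<open>The associator of \<open>x\<close>, \<open>g\<close> and \<open>g \<bullet> f\<close> is
  \<open>q g\<close> times \<open>2 \<cdot> (x \<bullet> f) - b x un \<cdot> f\<close>.\<close>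

lemma nucleus_plane:
  assumes w: "\<And>a c. (a \<bullet> c) \<bullet> w = a \<bullet> (c \<bullet> w)"
    and g: "imag g" "b x g = 0" and f: "imag f" "b f x = 0" "b f g = 0" "b f (x \<bullet> g) = 0"
  shows "q g * (2 * b w (x \<bullet> f) - b x un * b w f) = 0"
proof -
  have xg: "imag (x \<bullet> g)" using imag_mu[OF g] .
  have xgg: "(x \<bullet> g) \<bullet> g = - (q g \<cdot> x)"
    using mu_mu_cj[of x g] g by (simp add: imag_cj mu_minus minus_equation_iff[of _ "q g \<cdot> x"])
  have "g \<bullet> ((x \<bullet> g) \<bullet> f) = - (q g \<cdot> (x \<bullet> f))"
    using doubling[of f g "x \<bullet> g"] f by (simp add: xgg b_lin lin)
  moreover have "(x \<bullet> g) \<bullet> (g \<bullet> f) = - (b (x \<bullet> g) g \<cdot> f) - g \<bullet> ((x \<bullet> g) \<bullet> f)"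
    using imag_imag[OF xg g(1)] .
  ultimately have "(x \<bullet> g) \<bullet> (g \<bullet> f) = q g \<cdot> (x \<bullet> f) - (q g * b x un) \<cdot> f"
    by (simp add: b_plane algebra_simps)
  then have "b w (q g \<cdot> (x \<bullet> f) - (q g * b x un) \<cdot> f) = b w (x \<bullet> (g \<bullet> (g \<bullet> f)))"
    using nucleus_orth[OF w, of x g "g \<bullet> f"] by simp
  then have "q g * b w (x \<bullet> f) - q g * b x un * b w f = - (q g * b w (x \<bullet> f))"
    using g by (simp add: imag_square lin b_lin)
  then show ?thesis by (simp add: algebra_simps eq_neg_iff_add_eq_0)
qed

lemma nucleus_planes:
  assumes w: "\<And>a c. (a \<bullet> c) \<bullet> w = a \<bullet> (c \<bullet> w)"
    and g: "imag g" "b x g = 0" and f: "imag f" "b x f = 0" "b f g = 0" "b f (x \<bullet> g) = 0"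
  shows "(q g * disc x) * b w f = 0" "(q g * disc x) * b w (x \<bullet> f) = 0"
proof -
  let ?P = "\<lambda>f. imag f \<and> b f x = 0 \<and> b f g = 0 \<and> b f (x \<bullet> g) = 0"
  have "?P f" using f by (simp add: b_commute[of f x])
  moreover have "b (x \<bullet> f) x = 0"
    using b_mu_left[of x f un] f by (simp add: mu_un imag_def)
  then have "?P (x \<bullet> f)"
    using imag_mu[OF f(1,2)] b_mu_cross[OF f(1,2), of g] f by (simp add: b_mu_left)
  ultimately show "(q g * disc x) * b w f = 0" "(q g * disc x) * b w (x \<bullet> f) = 0"
    using orth_of_planes[where f = f and x = x and P = ?P and r = "q g" and w = w] nucleus_plane[OF w g] f by blast+
qed

text \<open>Associators make \<open>w\<close> orthogonal to the planes at \<open>y\<close>,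
  \<open>z\<close> and \<open>y \<bullet> z\<close>. In the plane of \<open>un\<close> and
  \<open>x\<close> the associator of \<open>y\<close>, \<open>z\<close> and
  \<open>x \<bullet> (y \<bullet> z)\<close> supplies only the direction
  \<open>2 \<cdot> x - b x un \<cdot> un\<close>, and what is left is a multiple of the
  unit.\<close>

lemma nucleus_scalar:
  assumes w: "\<And>a c. (a \<bullet> c) \<bullet> w = a \<bullet> (c \<bullet> w)"
  shows "\<exists>s. e \<cdot> w = s \<cdot> un"
proof -
  define I where "I = {r. \<exists>s. r \<cdot> w = s \<cdot> un}"
  have "idl I"
    unfolding idl_def I_def
  proof (intro conjI ballI allI)
    show "0 \<in> {r. \<exists>s. r \<cdot> w = s \<cdot> un}" by (auto intro: exI[of _ 0])
  next
    fix a c assume "a \<in> {r. \<exists>s. r \<cdot> w = s \<cdot> un}" "c \<in> {r. \<exists>s. r \<cdot> w = s \<cdot> un}"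
    then show "a + c \<in> {r. \<exists>s. r \<cdot> w = s \<cdot> un}" by (auto simp: add_sc) (metis add_sc)
  next
    fix r a assume "a \<in> {r. \<exists>s. r \<cdot> w = s \<cdot> un}"
    then show "r * a \<in> {r. \<exists>s. r \<cdot> w = s \<cdot> un}" by (auto simp flip: sc_sc) (auto simp: sc_sc)
  qed
  moreover have "\<exists>r\<in>I. r \<notin> m" if prm: "prm e m" for m
  proof -
    obtain x y z where bas: "basic x y z" and h: "hgt x y z \<notin> m"
      using ex_basic[OF prm] by blast
    have i: "imag y" "imag z" "b x y = 0" "b x z = 0" "b y z = 0" "b (x \<bullet> y) z = 0"
      using bas by (auto simp: basic_def)
    note yz = basic_yz[OF bas]
    have zy: "b z y = 0" "b y (x \<bullet> z) = 0" "b z (x \<bullet> y) = 0" "b (y \<bullet> z) y = 0" "b (y \<bullet> z) (x \<bullet> y) = 0"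
      using i yz by (simp_all add: b_commute[of z y] b_commute[of z "x \<bullet> y"] b_commute[of y "x \<bullet> z"]
          b_commute[of "y \<bullet> z"])
    let ?h = "hgt x y z"
    let ?d = "y \<bullet> z"
    have hy: "?h * r = q z * (q y * disc x * r)" "?h * r = q y * (q z * disc x * r)" for r
      by (simp_all add: hgt_def ac_simps)
    have o: "?h * b w y = 0" "?h * b w (x \<bullet> y) = 0" "?h * b w z = 0" "?h * b w (x \<bullet> z) = 0"
      "?h * b w ?d = 0" "?h * b w (x \<bullet> ?d) = 0"
      using nucleus_planes[OF w i(2,4,1,3,5) zy(2)] nucleus_planes[OF w i(1,3,2,4) zy(1,3)]
        nucleus_planes[OF w i(1,3) yz(1,2) zy(4,5)]
      by (simp_all only: hy(2)[of "b w y"] hy(2)[of "b w (x \<bullet> y)"] hy(1)[of "b w z"]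
          hy(1)[of "b w (x \<bullet> z)"] hy(1)[of "b w ?d"] hy(1)[of "b w (x \<bullet> ?d)"] mult_zero_right)
    have dd: "?d \<bullet> ?d = - ((q y * q z) \<cdot> un)"
      using imag_square[OF yz(1), of un] by (simp add: mu_un q_mu)
    have dxd: "?d \<bullet> (x \<bullet> ?d) = (q y * q z) \<cdot> x - (q y * q z * b x un) \<cdot> un"
      using imag_any[OF yz(1,2), of ?d] by (simp add: dd lin mult.commute)
    have zd: "z \<bullet> ?d = q z \<cdot> y"
      using imag_swap[of z y z] imag_swap[of z y un] imag_square[of z y] imag_square[of z un]
        imag_square[of z "y"] i zy imag_swap[of y z un]
      by (simp add: mu_un mu_minus)
    have yy: "y \<bullet> y = - (q y \<cdot> un)" using imag_square[OF i(1), of un] by (simp add: mu_un)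
    have yzxd: "y \<bullet> (z \<bullet> (x \<bullet> ?d)) = - ((q y * q z) \<cdot> x)"
      using imag_any[OF i(2,4), of ?d] imag_any[OF i(1,3), of y]
      by (simp add: zd lin yy ac_simps)
    have "(q y * q z) * (2 * b w x - b x un * b w un) = 0"
      using nucleus_orth[OF w, of y z "x \<bullet> ?d"] unfolding dxd yzxd
      by (simp add: b_lin algebra_simps eq_neg_iff_add_eq_0)
    moreover have "?h * r = disc x * (q y * q z * r)" for r by (simp add: hgt_def ac_simps)
    ultimately have ox: "?h * (2 * b w x - b x un * b w un) = 0" by simp
    \<comment> \<open>The coefficient of \<open>un\<close> in \<open>plane x un w\<close>; by
      \<open>ox\<close> the coefficient of \<open>x\<close> is killed by \<open>?h\<close>.\<close>
    define \<alpha> where "\<alpha> = 2 * q x * b w un - b x un * b w x"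
    have "b ((?h * disc x) \<cdot> w - (?h * \<alpha>) \<cdot> un) un
        = b x un * (?h * (2 * b w x - b x un * b w un))"
      by (simp add: b_lin \<alpha>_def disc_def b_self q_un algebra_simps)
    moreover have "b ((?h * disc x) \<cdot> w - (?h * \<alpha>) \<cdot> un) x
        = 2 * q x * (?h * (2 * b w x - b x un * b w un))"
      by (simp add: b_lin \<alpha>_def disc_def b_commute[of un x] algebra_simps)
    moreover have "b ((?h * disc x) \<cdot> w - (?h * \<alpha>) \<cdot> un) f = 0" if "?h * b w f = 0" "imag f" for f
    proof -
      have "b ((?h * disc x) \<cdot> w - (?h * \<alpha>) \<cdot> un) f = disc x * (?h * b w f)"
        using that(2) by (simp add: b_lin imag_def b_commute[of un f] ac_simps)
      then show ?thesis by (simp only: that(1) mult_zero_right)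
    qed
    ultimately have "orth8 x y z ((?h * disc x) \<cdot> w - (?h * \<alpha>) \<cdot> un)"
      unfolding orth8_def using o i yz imag_mu by (simp add: ox)
    from span[OF bas this] have "(?h * (?h * disc x)) \<cdot> w = (?h * (?h * \<alpha>)) \<cdot> un"
      by (simp add: lin)
    moreover have "?h * (?h * disc x) \<notin> m" using h by (auto simp: hgt_def prm_mult[OF prm])
    ultimately show ?thesis unfolding I_def by blast
  qed
  ultimately have "e \<in> I" by (rule idempotent_in_idl[OF idem])
  then show ?thesis by (simp add: I_def)
qed

lemma reversed_orth:
  assumes w: "\<And>a c. a \<bullet> (c \<bullet> w) = (c \<bullet> a) \<bullet> w"
  shows "b w (c \<bullet> (a \<bullet> k)) = b w ((a \<bullet> c) \<bullet> k)"
proof -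
  have "b ((cj c \<bullet> cj a) \<bullet> w) k = b w ((a \<bullet> c) \<bullet> k)"
    by (simp add: adj_left[of "cj c \<bullet> cj a"] cj_mult)
  moreover have "b (cj a \<bullet> (cj c \<bullet> w)) k = b w (c \<bullet> (a \<bullet> k))"
    by (simp add: adj_left[of "cj c"] adj_left[of "cj a"])
  ultimately show ?thesis by (simp add: w)
qed

text \<open>By adjunction \<open>w\<close> is orthogonal to all
  \<open>c \<bullet> (a \<bullet> k) - (a \<bullet> c) \<bullet> k\<close>. With
  \<open>k = un\<close> these are commutators and reach every plane orthogonal to \<open>un\<close>
  and \<open>x\<close>; for the plane of \<open>un\<close> and \<open>x\<close> two choices
  involving \<open>y\<close> give both equations of the system. So \<open>w\<close> is orthogonal to
  all eight basis elements, up to \<open>?h\<close>.\<close>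

lemma reversed_zero:
  assumes w: "\<And>a c. a \<bullet> (c \<bullet> w) = (c \<bullet> a) \<bullet> w"
  shows "e \<cdot> w = 0"
proof -
  define I where "I = {r. r \<cdot> w = 0}"
  have "idl I"
    unfolding idl_def I_def by (auto simp: add_sc simp flip: sc_sc)
  moreover have "\<exists>r\<in>I. r \<notin> m" if prm: "prm e m" for m
  proof -
    obtain x y z where bas: "basic x y z" and h: "hgt x y z \<notin> m"
      using ex_basic[OF prm] by blast
    have i: "imag y" "imag z" "b x y = 0" "b x z = 0" "b y z = 0" "b (x \<bullet> y) z = 0"
      using bas by (auto simp: basic_def)
    note yz = basic_yz[OF bas]
    let ?h = "hgt x y z"
    let ?P = "\<lambda>f. imag f \<and> b x f = 0"
    have P: "1 * (2 * b w (x \<bullet> f) - b x un * b w f) = 0" if "?P f" for f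
    proof -
      have "b w (f \<bullet> x) = b w (x \<bullet> f)" using reversed_orth[OF w, of f x un] by (simp add: mu_un)
      then show ?thesis using that by (simp add: imag_any_right b_lin)
    qed
    have o: "disc x * b w f = 0" "disc x * b w (x \<bullet> f) = 0" if f: "imag f" "b x f = 0" for f
    proof -
      have "b x (x \<bullet> f) = 0" using b_mu_left[of x un f] f by (simp add: mu_un imag_def b_commute[of un f])
      then show "disc x * b w f = 0" "disc x * b w (x \<bullet> f) = 0"
        using orth_of_planes[where f = f and x = x and P = ?P and r = 1 and w = w, OF P] imag_mu[OF f] f by auto
    qed
    have yy: "y \<bullet> y = - (q y \<cdot> un)" using imag_square[OF i(1), of un] by (simp add: mu_un)
    have yxy: "y \<bullet> (x \<bullet> y) = q y \<cdot> x - (q y * b x un) \<cdot> un"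
      using imag_any[OF i(1,3), of y] by (simp add: yy lin mult.commute)
    have xyy: "(x \<bullet> y) \<bullet> y = - (q y \<cdot> x)"
      using mu_mu_cj[of x y] i by (simp add: imag_cj mu_minus minus_equation_iff[of _ "q y \<cdot> x"])
    have xyxy: "(x \<bullet> y) \<bullet> (x \<bullet> y) = - ((q x * q y) \<cdot> un)"
      using imag_square[OF imag_mu[OF i(1,3)], of un] by (simp add: mu_un q_mu)
    have 1: "q y * (2 * b w (x \<bullet> un) - b x un * b w un) = 0"
      using reversed_orth[OF w, of y x y] unfolding yxy xyy
      by (simp add: b_lin mu_un algebra_simps eq_neg_iff_add_eq_0)
    have "b w (y \<bullet> (x \<bullet> (x \<bullet> y))) = b w ((x \<bullet> y) \<bullet> (x \<bullet> y))"
      by (rule reversed_orth[OF w])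
    then have "q y * (b x un * b w x - b x un * b x un * b w un + 2 * q x * b w un) = 0"
      unfolding xyxy by (simp add: square lin yxy yy b_lin algebra_simps eq_neg_iff_add_eq_0)
    moreover have "q y * (b x un * b w (x \<bullet> un) - 2 * q x * b w un)
      = b x un * (q y * (2 * b w (x \<bullet> un) - b x un * b w un))
        - q y * (b x un * b w x - b x un * b x un * b w un + 2 * q x * b w un)"
      by (simp add: mu_un algebra_simps)
    ultimately have 2: "q y * (b x un * b w (x \<bullet> un) - 2 * q x * b w un) = 0"
      using 1 by simp
    have oun: "q y * disc x * b w un = 0" "q y * disc x * b w x = 0"
      using plane_annihilated[OF 1 2] by (simp_all add: mu_un)
    have hy: "?h * r = q z * (q y * disc x * r)" "?h * r = (q y * q z) * (disc x * r)" for r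
      by (simp_all add: hgt_def ac_simps)
    have "?h * b w un = 0" "?h * b w x = 0"
      unfolding hy(1) oun by simp_all
    moreover have "?h * b w f = 0" "?h * b w (x \<bullet> f) = 0" if "imag f" "b x f = 0" for f
      unfolding hy(2) using o[OF that] by simp_all
    ultimately have "orth8 x y z (?h \<cdot> w)"
      unfolding orth8_def using i yz by (simp add: b_lin)
    from span[OF bas this] have "(?h * ?h) \<cdot> w = 0" by (simp add: lin)
    moreover have "?h * ?h \<notin> m" using h by (simp add: prm_mult[OF prm])
    ultimately show ?thesis unfolding I_def by blast
  qed
  ultimately have "e \<in> I" by (rule idempotent_in_idl[OF idem])
  then show ?thesis by (simp add: I_def)
qed

end

section \<open>Uniqueness of the local solutions and their gluing\<close>

context two_products
begin

lemma ranked_mu: "ranked_composition_algebra sc mu un q e"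
  by unfold_locales (fact v.idem, fact v.rank)

text \<open>The adjoint of the equation in \<open>twist\<close>: right multiplication by
  \<open>u\<close> becomes right multiplication by \<open>cj u\<close>, and the two products change
  places.\<close>

lemma twist_cj:
  assumes u: "twist u"
  shows "(x \<bullet> y) \<bullet> cj u = x \<diamondop> (y \<bullet> cj u)"
proof (rule b_ext)
  fix z
  have "b ((x \<bullet> y) \<bullet> cj u) z = b y (cj x \<bullet> (z \<bullet> u))"
    by (simp add: adj_right[of _ "cj u"] adj_left[of x])
  also have "\<dots> = b y ((cj x \<diamondop> z) \<bullet> u)" using u by (simp add: twist_def)
  also have "\<dots> = b (x \<diamondop> (y \<bullet> cj u)) z"
    by (simp add: v.adj_left[of x] adj_right[of _ "cj u"])
  finally show "b ((x \<bullet> y) \<bullet> cj u) z = b (x \<diamondop> (y \<bullet> cj u)) z" .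
qed

text \<open>Going from \<open>\<bullet>\<close> to \<open>\<diamondop>\<close> by
  \<open>cj u\<close> and back by \<open>u'\<close> shows that \<open>cj u \<bullet> u'\<close> lies
  in the nucleus of \<open>\<bullet>\<close>.\<close>

lemma twist_twist:
  assumes u: "twist u" and u': "twist u'" and e: "e \<cdot> u' = u'"
  shows "\<exists>s. cj u \<bullet> u' = s \<cdot> un"
proof -
  interpret m: ranked_composition_algebra sc mu un q e by (rule ranked_mu)
  have A: "((x \<bullet> y) \<bullet> cj u) \<bullet> u' = x \<bullet> ((y \<bullet> cj u) \<bullet> u')" for x y
    using u' by (simp add: twist_cj[OF u] twist_def)
  have "(x \<bullet> cj u) \<bullet> u' = x \<bullet> (cj u \<bullet> u')" for x
    using A[of x un] by (simp add: mu_un un_mu)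
  then have "(a \<bullet> c) \<bullet> (cj u \<bullet> u') = a \<bullet> (c \<bullet> (cj u \<bullet> u'))" for a c
    using A[of a c] by simp
  then obtain s where "e \<cdot> (cj u \<bullet> u') = s \<cdot> un" using m.nucleus_scalar by blast
  then show ?thesis using e mu_sc[of "cj u" e u'] by auto
qed

text \<open>Going from \<open>\<diamondop>\<close> to \<open>\<bullet>\<close> by \<open>v\<close>
  and back by \<open>cj u\<close> now reverses the factors, which is the situation of
  \<open>reversed_zero\<close>.\<close>

lemma twist_cotwist:
  assumes u: "twist u" and v: "cotwist v" and e: "e \<cdot> v = v"
  shows "v \<bullet> cj u = 0"
proof -
  have B: "((c \<diamondop> a) \<bullet> v) \<bullet> cj u = a \<diamondop> ((c \<bullet> v) \<bullet> cj u)" for a c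
    using v by (simp add: cotwist_def twist_cj[OF u])
  have "(a \<bullet> v) \<bullet> cj u = a \<diamondop> (v \<bullet> cj u)" for a
    using B[of un a] by (simp add: v.un_mu un_mu)
  then have "a \<diamondop> (c \<diamondop> (v \<bullet> cj u)) = (c \<diamondop> a) \<diamondop> (v \<bullet> cj u)" for a c
    using B[of c a] by simp
  then have "e \<cdot> (v \<bullet> cj u) = 0" by (rule v.reversed_zero)
  then show ?thesis using e sc_mu[of e v "cj u"] by simp
qed

text \<open>The map \<open>\<tau>\<close> records whether \<open>u\<close> twists \<open>\<diamondop>\<close> itself or its opposite, to which conjugation
  carries \<open>\<diamondop>\<close>.\<close>

definition sols :: "('m \<times> ('m \<Rightarrow> 'm)) set"
  where "sols = {(u, \<tau>). e \<cdot> u = u \<and> (twist u \<and> \<tau> = id \<or> cotwist u \<and> \<tau> = cj)}"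

lemma sols_e: "(u, \<tau>) \<in> sols \<Longrightarrow> e \<cdot> u = u"
  by (auto simp: sols_def)

lemma sols_q: "(u, \<tau>) \<in> sols \<Longrightarrow> q u * e = q u"
  using q_sc[of e u] v.idem by (auto simp: sols_def mult.commute)

lemma sols_inv: "(u, \<tau>) \<in> sols \<Longrightarrow> \<tau> (\<tau> x) = x" "(u, \<tau>) \<in> sols \<Longrightarrow> \<tau> un = un"
  by (auto simp: sols_def)

lemma sols_lin: "(u, \<tau>) \<in> sols \<Longrightarrow> \<tau> (x + y) = \<tau> x + \<tau> y" "(u, \<tau>) \<in> sols \<Longrightarrow> \<tau> (r \<cdot> x) = r \<cdot> \<tau> x"
  by (auto simp: sols_def cj_add cj_sc)

lemma sols_mu: "(u, \<tau>) \<in> sols \<Longrightarrow> \<tau> x \<bullet> (\<tau> y \<bullet> u) = \<tau> (x \<diamondop> y) \<bullet> u"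
  by (auto simp: sols_def twist_def cotwist_def v.cj_mult)

text \<open>In the second alternative every prime contains \<open>q u\<close> or
  \<open>q u'\<close>, so the two solutions live on disjoint parts of the spectrum. This is always
  so for solutions of different kinds.\<close>

lemma sols_pair:
  assumes "(u, \<tau>) \<in> sols" "(u', \<tau>') \<in> sols"
  shows "(\<tau> = \<tau>' \<and> (\<exists>s. q u \<cdot> u' = s \<cdot> u \<and> q u' \<cdot> u = s \<cdot> u')) \<or> (q u \<cdot> u' = 0 \<and> q u' \<cdot> u = 0)"
proof -
  interpret o: two_products sc mu "\<lambda>a c. c \<diamondop> a" un q e by (rule opposite)
  have scal: ?thesis if s: "cj u \<bullet> u' = s \<cdot> un" and \<tau>: "\<tau> = \<tau>'" for s
  proof -
    have "q u \<cdot> u' = s \<cdot> u"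
      using mu_cj_mu[of u u'] by (simp add: s mu_sc mu_un)
    moreover have "cj u' \<bullet> u = s \<cdot> un" using cj_mult[of "cj u" u'] by (simp add: s cj_sc)
    then have "q u' \<cdot> u = s \<cdot> u'"
      using mu_cj_mu[of u' u] by (simp add: mu_sc mu_un)
    ultimately show ?thesis using \<tau> by blast
  qed
  have zero: "q u \<cdot> v = 0 \<and> q v \<cdot> u = 0" if "twist u" "cotwist v" "e \<cdot> v = v" for u v
  proof -
    have 0: "v \<bullet> cj u = 0" using twist_cotwist that by blast
    have "q v \<cdot> cj u = 0" using cj_mu_mu[of v "cj u"] by (simp add: 0)
    then have "cj (q v \<cdot> u) = 0" by (simp add: cj_sc)
    then have "q v \<cdot> u = 0" using cj_cj[of "q v \<cdot> u"] cj_def[of 0] by simp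
    moreover have "q u \<cdot> v = 0" using mu_cj_mu_right[of v u] by (simp add: 0)
    ultimately show ?thesis by blast
  qed
  from assms consider "twist u" "twist u'" "\<tau> = \<tau>'" | "cotwist u" "cotwist u'" "\<tau> = \<tau>'"
    | "twist u" "cotwist u'" | "twist u'" "cotwist u"
    by (auto simp: sols_def)
  then show ?thesis
  proof cases
    case 1
    then show ?thesis using twist_twist sols_e[OF assms(2)] scal by blast
  next
    case 2
    then show ?thesis using o.twist_twist sols_e[OF assms(2)] scal unfolding cotwist_eq by blast
  next
    case 3
    then show ?thesis using zero sols_e[OF assms(2)] by blast
  next
    case 4
    then show ?thesis using zero sols_e[OF assms(1)] by blast
  qed
qed

text \<open>By \<open>ex_twist\<close> no prime avoiding \<open>e\<close> contains all norms of
  solutions, hence none contains a power of each. Scaling a local solution by \<open>e\<close> makes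
  it a member of \<open>sols\<close> without moving its norm into the prime.\<close>

lemma sols_generate:
  assumes I: "idl I" and k: "\<And>u \<tau>. (u, \<tau>) \<in> sols \<Longrightarrow> \<exists>k. q u ^ k \<in> I"
  shows "e \<in> I"
proof (rule idempotent_in_idl[OF v.idem I])
  fix m assume prm: "prm e m"
  obtain u where u: "twist u \<or> cotwist u" "q u \<notin> m" using ex_twist[OF prm] by blast
  have "e \<cdot> e \<cdot> u = e \<cdot> u" by (simp add: sc_sc v.idem)
  moreover have "twist (e \<cdot> u) \<or> cotwist (e \<cdot> u)"
    using u by (auto simp: twist_def cotwist_def mu_sc)
  ultimately obtain \<tau> where "(e \<cdot> u, \<tau>) \<in> sols"
    by (auto simp: sols_def)
  then obtain k where k: "q (e \<cdot> u) ^ k \<in> I" using k by blast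
  have "q (e \<cdot> u) \<notin> m" using u prm by (auto simp: q_sc prm_mult[OF prm] prm_def)
  then show "\<exists>r\<in>I. r \<notin> m" using k prm_power[OF prm] by blast
qed

lemma sols_zero:
  assumes "\<And>u \<tau>. (u, \<tau>) \<in> sols \<Longrightarrow> \<exists>k. q u ^ k \<cdot> w = 0"
  shows "e \<cdot> w = 0"
proof -
  have "idl {r. r \<cdot> w = 0}"
    unfolding idl_def by (auto simp: add_sc simp flip: sc_sc)
  then have "e \<in> {r. r \<cdot> w = 0}"
    by (rule sols_generate) (use assms in auto)
  then show ?thesis by simp
qed

lemma sols_eq:
  assumes "\<And>u \<tau>. (u, \<tau>) \<in> sols \<Longrightarrow> \<exists>k. q u ^ k \<cdot> w = q u ^ k \<cdot> w'"
  shows "e \<cdot> w = e \<cdot> w'"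
  using sols_zero[of "w - w'"] assms by (simp add: sc_diff)

text \<open>By \<open>compat\<close> the fractions of \<open>g u \<tau>\<close> by
  \<open>q u\<close> agree on overlaps. The scalars \<open>r\<close> for which \<open>r\<close>
  times these fractions has a global value form the ideal \<open>J\<close>; it contains each
  \<open>q u\<close>, with witness \<open>g u \<tau>\<close>, and therefore
  \<open>e\<close>.\<close>

lemma glue:
  assumes compat: "\<And>u \<tau> u' \<tau>'. (u, \<tau>) \<in> sols \<Longrightarrow> (u', \<tau>') \<in> sols \<Longrightarrow> q u \<cdot> g u' \<tau>' = q u' \<cdot> g u \<tau>"
    and e: "\<And>u \<tau>. (u, \<tau>) \<in> sols \<Longrightarrow> e \<cdot> g u \<tau> = g u \<tau>"
  shows "\<exists>p. e \<cdot> p = p \<and> (\<forall>(u, \<tau>)\<in>sols. q u \<cdot> p = g u \<tau>)"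
proof -
  define J where "J = {r. \<exists>p. \<forall>(u, \<tau>)\<in>sols. q u \<cdot> p = r \<cdot> g u \<tau>}"
  have "idl J"
    unfolding idl_def
  proof (intro conjI ballI allI)
    show "0 \<in> J" unfolding J_def by (auto intro!: exI[of _ 0])
  next
    fix r s assume "r \<in> J" "s \<in> J"
    then obtain p p' where "\<forall>(u, \<tau>)\<in>sols. q u \<cdot> p = r \<cdot> g u \<tau>" "\<forall>(u, \<tau>)\<in>sols. q u \<cdot> p' = s \<cdot> g u \<tau>"
      unfolding J_def by blast
    then have "q u \<cdot> (p + p') = (r + s) \<cdot> g u \<tau>" if "(u, \<tau>) \<in> sols" for u \<tau>
      using that unfolding sc_add add_sc by (metis (mono_tags, lifting) case_prodD)
    then show "r + s \<in> J" unfolding J_def by blast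
  next
    fix s r assume "r \<in> J"
    then obtain p where p: "\<forall>(u, \<tau>)\<in>sols. q u \<cdot> p = r \<cdot> g u \<tau>" unfolding J_def by blast
    have "q u \<cdot> (s \<cdot> p) = (s * r) \<cdot> g u \<tau>" if "(u, \<tau>) \<in> sols" for u \<tau>
    proof -
      have "q u \<cdot> (s \<cdot> p) = s \<cdot> (q u \<cdot> p)" by (simp add: sc_sc mult.commute)
      also have "\<dots> = s \<cdot> (r \<cdot> g u \<tau>)" using p that by auto
      finally show ?thesis by (simp add: sc_sc)
    qed
    then show "s * r \<in> J" unfolding J_def by blast
  qed
  moreover have "q u ^ 1 \<in> J" if "(u, \<tau>) \<in> sols" for u \<tau>
    unfolding J_def using compat[OF _ that] by auto
  ultimately have "e \<in> J" using sols_generate by blast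
  then obtain p where p: "\<forall>(u, \<tau>)\<in>sols. q u \<cdot> p = e \<cdot> g u \<tau>" unfolding J_def by blast
  have "q u \<cdot> (e \<cdot> p) = g u \<tau>" if "(u, \<tau>) \<in> sols" for u \<tau>
  proof -
    have "q u \<cdot> (e \<cdot> p) = e \<cdot> (q u \<cdot> p)" by (simp add: sc_sc mult.commute)
    then show ?thesis using p that e by auto
  qed
  moreover have "e \<cdot> (e \<cdot> p) = e \<cdot> p" by (simp add: sc_sc v.idem)
  ultimately show ?thesis by blast
qed

lemma sols_cj:
  assumes "q u \<cdot> u' = s \<cdot> u"
  shows "q u \<cdot> cj u' = s \<cdot> cj u"
  using arg_cong[OF assms, of cj] by (simp add: cj_sc)

text \<open>All three expressions are quadratic in the solution, as is the norm, so they agree for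
  proportional solutions. For solutions with disjoint support both sides vanish.\<close>

lemma sols_sandwich:
  assumes D: "(u, \<tau>) \<in> sols" "(u', \<tau>') \<in> sols"
  shows "q u \<cdot> ((cj u' \<bullet> \<tau>' x) \<bullet> u') = q u' \<cdot> ((cj u \<bullet> \<tau> x) \<bullet> u)"
    "q u \<cdot> \<tau>' ((u' \<bullet> x) \<bullet> cj u') = q u' \<cdot> \<tau> ((u \<bullet> x) \<bullet> cj u)"
    "q u \<cdot> (cj u' \<bullet> cj u') = q u' \<cdot> (cj u \<bullet> cj u)"
proof -
  have eq: "q u \<cdot> ((cj u' \<bullet> X) \<bullet> u') = q u' \<cdot> ((cj u \<bullet> X) \<bullet> u)
     \<and> q u \<cdot> ((u' \<bullet> x) \<bullet> cj u') = q u' \<cdot> ((u \<bullet> x) \<bullet> cj u)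
     \<and> q u \<cdot> (cj u' \<bullet> cj u') = q u' \<cdot> (cj u \<bullet> cj u)"
    if s: "q u \<cdot> u' = s \<cdot> u" "q u' \<cdot> u = s \<cdot> u'" for s X
  proof -
    note c = sols_cj[OF s(1)] sols_cj[OF s(2)]
    have "q u \<cdot> ((cj u' \<bullet> X) \<bullet> u') = ((q u \<cdot> cj u') \<bullet> X) \<bullet> u'" by (simp add: lin)
    also have "\<dots> = (cj u \<bullet> X) \<bullet> (q u' \<cdot> u)" unfolding c(1) s(2) by (simp add: lin)
    finally have 1: "q u \<cdot> ((cj u' \<bullet> X) \<bullet> u') = q u' \<cdot> ((cj u \<bullet> X) \<bullet> u)" by (simp add: lin)
    have "q u \<cdot> ((u' \<bullet> x) \<bullet> cj u') = ((q u \<cdot> u') \<bullet> x) \<bullet> cj u'" by (simp add: lin)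
    also have "\<dots> = (u \<bullet> x) \<bullet> (q u' \<cdot> cj u)" unfolding c(2) s(1) by (simp add: lin)
    finally have 2: "q u \<cdot> ((u' \<bullet> x) \<bullet> cj u') = q u' \<cdot> ((u \<bullet> x) \<bullet> cj u)" by (simp add: lin)
    have "q u \<cdot> (cj u' \<bullet> cj u') = (q u \<cdot> cj u') \<bullet> cj u'" by (simp add: lin)
    also have "\<dots> = cj u \<bullet> (q u' \<cdot> cj u)" unfolding c by (simp add: lin)
    finally have 3: "q u \<cdot> (cj u' \<bullet> cj u') = q u' \<cdot> (cj u \<bullet> cj u)" by (simp add: lin)
    show ?thesis using 1 2 3 by blast
  qed
  have zero: "q u \<cdot> ((cj u' \<bullet> X) \<bullet> u') = 0 \<and> q u \<cdot> ((u' \<bullet> X) \<bullet> cj u') = 0 \<and> q u \<cdot> (cj u' \<bullet> cj u') = 0"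
    if "q u \<cdot> u' = 0" for u u' X
  proof -
    have "q u \<cdot> cj u' = 0" using sols_cj[of u u' 0] that by simp
    then show ?thesis
      using that mu_sc[of "cj u' \<bullet> X" "q u" u'] mu_sc[of "u' \<bullet> X" "q u" "cj u'"]
        mu_sc[of "cj u'" "q u" "cj u'"] by simp
  qed
  from sols_pair[OF D] consider s where "\<tau> = \<tau>'" "q u \<cdot> u' = s \<cdot> u" "q u' \<cdot> u = s \<cdot> u'"
    | "q u \<cdot> u' = 0" "q u' \<cdot> u = 0" by blast
  then show "q u \<cdot> ((cj u' \<bullet> \<tau>' x) \<bullet> u') = q u' \<cdot> ((cj u \<bullet> \<tau> x) \<bullet> u)"
    "q u \<cdot> \<tau>' ((u' \<bullet> x) \<bullet> cj u') = q u' \<cdot> \<tau> ((u \<bullet> x) \<bullet> cj u)"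
    "q u \<cdot> (cj u' \<bullet> cj u') = q u' \<cdot> (cj u \<bullet> cj u)"
  proof (atomize (full), cases)
    case 1
    then show "q u \<cdot> ((cj u' \<bullet> \<tau>' x) \<bullet> u') = q u' \<cdot> ((cj u \<bullet> \<tau> x) \<bullet> u) \<and>
      q u \<cdot> \<tau>' ((u' \<bullet> x) \<bullet> cj u') = q u' \<cdot> \<tau> ((u \<bullet> x) \<bullet> cj u) \<and>
      q u \<cdot> (cj u' \<bullet> cj u') = q u' \<cdot> (cj u \<bullet> cj u)"
      using eq[OF 1(2,3)] sols_lin(2)[OF D(1)] by metis
  next
    case 2
    have "\<tau> 0 = 0" "\<tau>' 0 = 0" using sols_lin(2)[OF D(1), of 0 0] sols_lin(2)[OF D(2), of 0 0] by auto
    then show "q u \<cdot> ((cj u' \<bullet> \<tau>' x) \<bullet> u') = q u' \<cdot> ((cj u \<bullet> \<tau> x) \<bullet> u) \<and>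
      q u \<cdot> \<tau>' ((u' \<bullet> x) \<bullet> cj u') = q u' \<cdot> \<tau> ((u \<bullet> x) \<bullet> cj u) \<and>
      q u \<cdot> (cj u' \<bullet> cj u') = q u' \<cdot> (cj u \<bullet> cj u)"
      using zero[OF 2(1)] zero[OF 2(2)] sols_lin(2)[OF D(1)] sols_lin(2)[OF D(2)] by metis
  qed
qed

lemma sols_fixed:
  assumes D: "(u, \<tau>) \<in> sols"
  shows "e \<cdot> ((cj u \<bullet> x) \<bullet> u) = (cj u \<bullet> x) \<bullet> u" "e \<cdot> \<tau> ((u \<bullet> x) \<bullet> cj u) = \<tau> ((u \<bullet> x) \<bullet> cj u)"
    "e \<cdot> (cj u \<bullet> cj u) = cj u \<bullet> cj u"
proof -
  have c: "e \<cdot> cj u = cj u" using arg_cong[OF sols_e[OF D], of cj] by (simp add: cj_sc)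
  show "e \<cdot> ((cj u \<bullet> x) \<bullet> u) = (cj u \<bullet> x) \<bullet> u" "e \<cdot> (cj u \<bullet> cj u) = cj u \<bullet> cj u"
    using mu_sc[of _ e u] mu_sc[of _ e "cj u"] c sols_e[OF D] by (metis)+
  show "e \<cdot> \<tau> ((u \<bullet> x) \<bullet> cj u) = \<tau> ((u \<bullet> x) \<bullet> cj u)"
    using mu_sc[of "u \<bullet> x" e "cj u"] c sols_lin(2)[OF D, of e] by metis
qed

text \<open>Three families are glued: conjugation by \<open>u\<close>, its inverse, and the square
  of \<open>cj u\<close>, each divided by \<open>q u\<close>. Every identity is then tested after
  multiplication by a power of \<open>q u\<close>, where it becomes a computation with
  \<open>u\<close>.\<close>

theorem isotope_exists:
  "\<exists>a \<phi> \<psi>. q a = e \<and> (\<forall>x y. \<phi> (x + y) = \<phi> x + \<phi> y) \<and> (\<forall>r x. \<phi> (r \<cdot> x) = r \<cdot> \<phi> x)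
    \<and> \<phi> un = e \<cdot> un \<and> (\<forall>x. \<phi> (\<psi> x) = e \<cdot> x) \<and> (\<forall>x. \<psi> (\<phi> x) = e \<cdot> x)
    \<and> (\<forall>x y. \<phi> (x \<diamondop> y) = (\<phi> x \<bullet> a) \<bullet> (cj a \<bullet> \<phi> y))"
proof -
  have "\<exists>p. e \<cdot> p = p \<and> (\<forall>(u, \<tau>)\<in>sols. q u \<cdot> p = (cj u \<bullet> \<tau> x) \<bullet> u)" for x
    by (rule glue[where g = "\<lambda>u \<tau>. (cj u \<bullet> \<tau> x) \<bullet> u"]) (rule sols_sandwich sols_fixed; assumption)+
  then obtain \<phi> where \<phi>e: "\<And>x. e \<cdot> \<phi> x = \<phi> x"
    and \<phi>: "\<And>x u \<tau>. (u, \<tau>) \<in> sols \<Longrightarrow> q u \<cdot> \<phi> x = (cj u \<bullet> \<tau> x) \<bullet> u"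
    by (metis (mono_tags, lifting) case_prodD)
  have "\<exists>p. e \<cdot> p = p \<and> (\<forall>(u, \<tau>)\<in>sols. q u \<cdot> p = \<tau> ((u \<bullet> x) \<bullet> cj u))" for x
    by (rule glue[where g = "\<lambda>u \<tau>. \<tau> ((u \<bullet> x) \<bullet> cj u)"]) (rule sols_sandwich sols_fixed; assumption)+
  then obtain \<psi> where \<psi>e: "\<And>x. e \<cdot> \<psi> x = \<psi> x"
    and \<psi>: "\<And>x u \<tau>. (u, \<tau>) \<in> sols \<Longrightarrow> q u \<cdot> \<psi> x = \<tau> ((u \<bullet> x) \<bullet> cj u)"
    by (metis (mono_tags, lifting) case_prodD)
  have "\<exists>p. e \<cdot> p = p \<and> (\<forall>(u, \<tau>)\<in>sols. q u \<cdot> p = cj u \<bullet> cj u)"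
    by (rule glue[where g = "\<lambda>u \<tau>. cj u \<bullet> cj u"]) (rule sols_sandwich sols_fixed; assumption)+
  then obtain a where ae: "e \<cdot> a = a" and a: "\<And>u \<tau>. (u, \<tau>) \<in> sols \<Longrightarrow> q u \<cdot> a = cj u \<bullet> cj u"
    by auto
  have eqI: "w = w'" if "e \<cdot> w = w" "e \<cdot> w' = w'"
    "\<And>u \<tau>. (u, \<tau>) \<in> sols \<Longrightarrow> \<exists>k. q u ^ k \<cdot> w = q u ^ k \<cdot> w'" for w w'
    using sols_eq[of w w'] that by simp
  have eqI1: "w = w'" if "e \<cdot> w = w" "e \<cdot> w' = w'"
    "\<And>u \<tau>. (u, \<tau>) \<in> sols \<Longrightarrow> q u \<cdot> w = q u \<cdot> w'" for w w'
  proof (rule eqI[OF that(1,2)])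
    show "\<exists>k. q u ^ k \<cdot> w = q u ^ k \<cdot> w'" if "(u, \<tau>) \<in> sols" for u \<tau>
      using \<open>\<And>u \<tau>. (u, \<tau>) \<in> sols \<Longrightarrow> q u \<cdot> w = q u \<cdot> w'\<close>[OF that] by (intro exI[of _ 1]) simp
  qed
  have ee: "e \<cdot> e \<cdot> x = e \<cdot> x" for x by (simp add: sc_sc v.idem)
  have qe: "q u \<cdot> e \<cdot> x = q u \<cdot> x" if "(u, \<tau>) \<in> sols" for u \<tau> x
    using sols_q[OF that] by (simp add: sc_sc)
  have sw: "r \<cdot> s \<cdot> x = s \<cdot> r \<cdot> x" for r s x by (simp add: sc_sc mult.commute)
  have add: "\<phi> (x + y) = \<phi> x + \<phi> y" for x y
    by (rule eqI1) (simp_all add: \<phi>e sc_add \<phi> sols_lin add_mu mu_add)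
  have scl: "\<phi> (r \<cdot> x) = r \<cdot> \<phi> x" for r x
  proof (rule eqI1)
    show "e \<cdot> r \<cdot> \<phi> x = r \<cdot> \<phi> x" using sw[of e r] \<phi>e by simp
    show "q u \<cdot> \<phi> (r \<cdot> x) = q u \<cdot> r \<cdot> \<phi> x" if "(u, \<tau>) \<in> sols" for u \<tau>
      using that sw[of "q u" r] by (simp add: \<phi> sols_lin mu_sc sc_mu)
  qed (rule \<phi>e)
  have one: "\<phi> un = e \<cdot> un"
    by (rule eqI1) (simp_all add: \<phi>e ee \<phi> qe sols_inv mu_un cj_mu)
  have \<phi>\<psi>: "\<phi> (\<psi> x) = e \<cdot> x" for x
  proof (rule eqI)
    fix u \<tau> assume D: "(u, \<tau>) \<in> sols"
    have "q u ^ 2 \<cdot> \<phi> (\<psi> x) = q u \<cdot> ((cj u \<bullet> \<tau> (\<psi> x)) \<bullet> u)"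
      by (simp add: power2_eq_square \<phi>[OF D] flip: sc_sc)
    also have "\<dots> = (cj u \<bullet> \<tau> (q u \<cdot> \<psi> x)) \<bullet> u"
      by (simp add: sols_lin[OF D] lin)
    also have "\<dots> = (cj u \<bullet> ((u \<bullet> x) \<bullet> cj u)) \<bullet> u" by (simp add: \<psi>[OF D] sols_inv[OF D])
    also have "\<dots> = q u ^ 2 \<cdot> x"
      by (simp add: flexible[symmetric] cj_mu_mu lin cj_mu power2_eq_square mu_cj_mu_right)
    finally show "\<exists>k. q u ^ k \<cdot> \<phi> (\<psi> x) = q u ^ k \<cdot> e \<cdot> x"
      using qe[OF D] by (auto simp: power2_eq_square simp flip: sc_sc intro!: exI[of _ 2])
  qed (simp_all add: \<phi>e ee)
  have \<psi>\<phi>: "\<psi> (\<phi> x) = e \<cdot> x" for x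
  proof (rule eqI)
    fix u \<tau> assume D: "(u, \<tau>) \<in> sols"
    have "q u ^ 2 \<cdot> \<psi> (\<phi> x) = q u \<cdot> \<tau> ((u \<bullet> \<phi> x) \<bullet> cj u)"
      by (simp add: power2_eq_square \<psi>[OF D] flip: sc_sc)
    also have "\<dots> = \<tau> ((u \<bullet> (q u \<cdot> \<phi> x)) \<bullet> cj u)"
      by (simp add: lin flip: sols_lin[OF D])
    also have "\<dots> = \<tau> ((u \<bullet> (cj u \<bullet> (\<tau> x \<bullet> u))) \<bullet> cj u)" by (simp add: \<phi>[OF D] flexible_cj)
    also have "\<dots> = q u ^ 2 \<cdot> x"
      by (simp add: mu_cj_mu lin mu_mu_cj sols_lin[OF D] sols_inv[OF D] power2_eq_square)
    finally show "\<exists>k. q u ^ k \<cdot> \<psi> (\<phi> x) = q u ^ k \<cdot> e \<cdot> x"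
      using qe[OF D] by (auto simp: power2_eq_square simp flip: sc_sc intro!: exI[of _ 2])
  qed (simp_all add: \<psi>e ee)
  have qa: "q a = e"
  proof -
    have "idl {r. r * (q a - e) = 0}"
      unfolding idl_def by (auto simp: distrib_right mult.assoc)
    then have "e \<in> {r. r * (q a - e) = 0}"
    proof (rule sols_generate)
      fix u \<tau> assume D: "(u, \<tau>) \<in> sols"
      have "q u * q u * q a = q (q u \<cdot> a)" by (simp add: q_sc)
      also have "\<dots> = q u * q u * e" by (simp add: a[OF D] q_mu q_cj sols_q[OF D] mult.assoc)
      finally show "\<exists>k. q u ^ k \<in> {r. r * (q a - e) = 0}"
        by (intro exI[of _ 2]) (simp add: power2_eq_square algebra_simps)
    qed
    moreover have "e * q a = q a" using q_sc[of e a] by (simp add: ae v.idem)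
    ultimately show ?thesis using v.idem by (simp add: right_diff_distrib)
  qed
  have mult: "\<phi> (x \<diamondop> y) = (\<phi> x \<bullet> a) \<bullet> (cj a \<bullet> \<phi> y)" for x y
  proof (rule eqI)
    show "e \<cdot> \<phi> (x \<diamondop> y) = \<phi> (x \<diamondop> y)" by (rule \<phi>e)
    show "e \<cdot> ((\<phi> x \<bullet> a) \<bullet> (cj a \<bullet> \<phi> y)) = (\<phi> x \<bullet> a) \<bullet> (cj a \<bullet> \<phi> y)"
      using \<phi>e ae by (simp flip: mu_sc)
    fix u \<tau> assume D: "(u, \<tau>) \<in> sols"
    have ca: "q u \<cdot> cj a = u \<bullet> u"
      using arg_cong[OF a[OF D], of cj] by (simp add: cj_sc cj_mult)
    have A: "((cj u \<bullet> \<tau> x) \<bullet> u) \<bullet> (cj u \<bullet> cj u) = q u \<cdot> ((cj u \<bullet> \<tau> x) \<bullet> cj u)"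
      by (simp add: right_alternative mu_mu_cj lin)
    have B: "(u \<bullet> u) \<bullet> ((cj u \<bullet> \<tau> y) \<bullet> u) = q u \<cdot> (u \<bullet> (\<tau> y \<bullet> u))"
      by (simp add: left_alternative flexible_cj mu_cj_mu lin)
    have "q u ^ 4 \<cdot> ((\<phi> x \<bullet> a) \<bullet> (cj a \<bullet> \<phi> y))
      = ((q u \<cdot> \<phi> x) \<bullet> (q u \<cdot> a)) \<bullet> ((q u \<cdot> cj a) \<bullet> (q u \<cdot> \<phi> y))"
      by (simp add: lin power4_eq_xxxx mult.assoc)
    also have "\<dots> = (q u \<cdot> ((cj u \<bullet> \<tau> x) \<bullet> cj u)) \<bullet> (q u \<cdot> (u \<bullet> (\<tau> y \<bullet> u)))"
      unfolding \<phi>[OF D] a[OF D] ca A B ..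
    \<comment> \<open>\<open>left_moufang\<close> with \<open>a = cj u\<close> opens the left
      factor, so that \<open>cj u\<close> cancels against \<open>u\<close> and the product of
      \<open>sols_mu\<close> appears.\<close>
    also have "\<dots> = q u ^ 2 \<cdot> (cj u \<bullet> (\<tau> x \<bullet> (cj u \<bullet> (u \<bullet> (\<tau> y \<bullet> u)))))"
      by (simp add: lin left_moufang power2_eq_square)
    also have "\<dots> = q u ^ 3 \<cdot> (cj u \<bullet> (\<tau> (x \<diamondop> y) \<bullet> u))"
      by (simp add: cj_mu_mu lin sols_mu[OF D] power2_eq_square power3_eq_cube mult.assoc)
    also have "\<dots> = q u ^ 3 \<cdot> q u \<cdot> \<phi> (x \<diamondop> y)"
      by (simp add: \<phi>[OF D] flexible_cj)
    also have "\<dots> = q u ^ 4 \<cdot> \<phi> (x \<diamondop> y)"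
      by (simp add: sc_sc power3_eq_cube power4_eq_xxxx mult.assoc)
    finally show "\<exists>k. q u ^ k \<cdot> \<phi> (x \<diamondop> y) = q u ^ k \<cdot> ((\<phi> x \<bullet> a) \<bullet> (cj a \<bullet> \<phi> y))"
      by metis
  qed
  show ?thesis
    using qa add scl one \<phi>\<psi> \<psi>\<phi> mult by blast
qed

end

section \<open>Uniqueness of the norm\<close>

locale two_norms = ranked_composition_algebra sc mu un q e + w: composition_algebra sc mu un q'
  for sc :: "'r::comm_ring_1 \<Rightarrow> 'm::ab_group_add \<Rightarrow> 'm" (infixr "\<cdot>" 75)
    and mu :: "'m \<Rightarrow> 'm \<Rightarrow> 'm" (infixl "\<bullet>" 70)
    and un :: 'm
    and q :: "'m \<Rightarrow> 'r"
    and e :: 'r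
    and q' :: "'m \<Rightarrow> 'r"
begin

definition defect :: "'m \<Rightarrow> 'r" where "defect x = b x un - w.b x un"

lemma defect_add: "defect (x + y) = defect x + defect y"
  by (simp add: defect_def b_lin w.b_lin)

text \<open>Subtract the quadratic equations that \<open>x\<close> satisfies for the two
  norms.\<close>

lemma defect_sc: "defect x \<cdot> x = (q x - q' x) \<cdot> un"
  using mu_self[of x] w.mu_self[of x] by (simp add: defect_def diff_sc algebra_simps)

lemma defect_orth: "b un c = 0 \<Longrightarrow> defect x * b x c = 0"
  using arg_cong[OF defect_sc, of "\<lambda>v. b v c" x] by (simp add: b_lin)

text \<open>Polarize \<open>defect_orth\<close> in \<open>x\<close> and multiply by
  \<open>b y c\<close>, which \<open>defect y\<close> annihilates.\<close>

lemma defect_square: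
  assumes c: "b un c = 0"
  shows "b y c * b y c * defect x = 0"
proof -
  have "defect (x + y) * b (x + y) c - defect x * b x c - defect y * b y c = 0"
    using c by (simp add: defect_orth)
  then have "defect x * b y c = - (defect y * b x c)"
    by (simp add: defect_add b_lin algebra_simps eq_neg_iff_add_eq_0)
  then have "b y c * b y c * defect x = - ((defect y * b y c) * b x c)"
    by (simp add: ac_simps)
  then show ?thesis using c by (simp add: defect_orth)
qed

text \<open>If a prime contained all \<open>b y c\<close> with \<open>c\<close> orthogonal to
  \<open>un\<close>, then for a \<open>c\<close> with trace outside it the vectors
  \<open>b c un \<cdot> x - b x un \<cdot> c\<close> would be in the radical, and \<open>c\<close>
  alone would span.\<close>

lemma e_defect: "e * defect x = 0"
proof -
  have "idl {r. r * defect x = 0}" by (auto simp: idl_def distrib_right mult.assoc)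
  moreover have "\<exists>r\<in>{r. r * defect x = 0}. r \<notin> m" if prm: "prm e m" for m
  proof (rule ccontr)
    assume "\<not> ?thesis"
    then have bm: "b y c \<in> m" if "b un c = 0" for y c
      using defect_square[OF that, of y x] prm_mult[OF prm] by blast
    obtain c where c: "b c un \<notin> m" using ex_trace[OF prm] by blast
    have "rad m (b c un \<cdot> x - (b x un \<cdot> c + 0 \<cdot> 0 + 0 \<cdot> 0 + 0 \<cdot> 0))" for x
    proof -
      have "b un (b c un \<cdot> x - b x un \<cdot> c) = 0"
        by (simp add: b_lin b_commute[of un])
      then have "b y (b c un \<cdot> x - b x un \<cdot> c) \<in> m" for y by (rule bm)
      then show ?thesis by (simp add: rad_def b_commute[of "b c un \<cdot> x - b x un \<cdot> c"])
    qed
    then show False using not_spanned4[OF prm, of c 0 0 0] c by blast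
  qed
  ultimately have "e \<in> {r. r * defect x = 0}" by (rule idempotent_in_idl[OF idem])
  then show ?thesis by simp
qed

theorem norms_eq: "e * q x = e * q' x"
proof -
  have "(e * (q x - q' x)) \<cdot> un = (e * defect x) \<cdot> x"
    by (simp add: defect_sc flip: sc_sc)
  then have un: "(e * (q x - q' x)) \<cdot> un = 0" by (simp add: e_defect)
  have zero: "b c un * (e * (q x - q' x)) = 0" for c
    using arg_cong[OF un, of "b c"] by (simp add: b_lin mult.commute)
  have "idl {r. r * (e * (q x - q' x)) = 0}" by (simp add: idl_def distrib_right mult.assoc)
  moreover have "\<exists>r\<in>{r. r * (e * (q x - q' x)) = 0}. r \<notin> m" if "prm e m" for m
    using ex_trace[OF that] zero by blast
  ultimately have "e \<in> {r. r * (e * (q x - q' x)) = 0}" by (rule idempotent_in_idl[OF idem])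
  then have "(e * e) * (q x - q' x) = 0" by (simp add: mult.assoc)
  then show ?thesis by (simp add: idem right_diff_distrib)
qed

end

section \<open>From carrier sets to types\<close>

text \<open>The product is a parameter instead of the field of \<open>C\<close>, so that a
  transported product can be placed on the same module and unit. Constant rank is kept apart, in
  \<open>rank5\<close>.\<close>

locale comp_on = module R C
  for R :: "('r, 'x) ring_scheme" (structure) and C :: "('r, 'c, 'y) module_scheme" (structure) +
  fixes m :: "'c \<Rightarrow> 'c \<Rightarrow> 'c" and q :: "'c \<Rightarrow> 'r"
  assumes m_closed: "x \<in> carrier C \<Longrightarrow> y \<in> carrier C \<Longrightarrow> m x y \<in> carrier C"
    and one_mem: "\<one>\<^bsub>C\<^esub> \<in> carrier C"
    and m_add_left: "x \<in> carrier C \<Longrightarrow> y \<in> carrier C \<Longrightarrow> z \<in> carrier C \<Longrightarrow>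
      m (x \<oplus>\<^bsub>C\<^esub> y) z = m x z \<oplus>\<^bsub>C\<^esub> m y z"
    and m_add_right: "x \<in> carrier C \<Longrightarrow> y \<in> carrier C \<Longrightarrow> z \<in> carrier C \<Longrightarrow>
      m x (y \<oplus>\<^bsub>C\<^esub> z) = m x y \<oplus>\<^bsub>C\<^esub> m x z"
    and m_smult_left: "r \<in> carrier R \<Longrightarrow> x \<in> carrier C \<Longrightarrow> y \<in> carrier C \<Longrightarrow>
      m (r \<odot>\<^bsub>C\<^esub> x) y = r \<odot>\<^bsub>C\<^esub> m x y"
    and m_smult_right: "r \<in> carrier R \<Longrightarrow> x \<in> carrier C \<Longrightarrow> y \<in> carrier C \<Longrightarrow>
      m x (r \<odot>\<^bsub>C\<^esub> y) = r \<odot>\<^bsub>C\<^esub> m x y"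
    and m_one_left: "x \<in> carrier C \<Longrightarrow> m \<one>\<^bsub>C\<^esub> x = x"
    and m_one_right: "x \<in> carrier C \<Longrightarrow> m x \<one>\<^bsub>C\<^esub> = x"
    and q_mem: "x \<in> carrier C \<Longrightarrow> q x \<in> carrier R"
    and q_smul: "r \<in> carrier R \<Longrightarrow> x \<in> carrier C \<Longrightarrow> q (r \<odot>\<^bsub>C\<^esub> x) = (r \<otimes> r) \<otimes> q x"
    and polar_add_left: "x \<in> carrier C \<Longrightarrow> y \<in> carrier C \<Longrightarrow> z \<in> carrier C \<Longrightarrow>
      polar R C q (x \<oplus>\<^bsub>C\<^esub> y) z = polar R C q x z \<oplus> polar R C q y z"
    and polar_smult_left: "r \<in> carrier R \<Longrightarrow> x \<in> carrier C \<Longrightarrow> y \<in> carrier C \<Longrightarrow>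
      polar R C q (r \<odot>\<^bsub>C\<^esub> x) y = r \<otimes> polar R C q x y"
    and q_m: "x \<in> carrier C \<Longrightarrow> y \<in> carrier C \<Longrightarrow> q (m x y) = q x \<otimes> q y"
    and q_one: "q \<one>\<^bsub>C\<^esub> = \<one>"
    and polar_nondeg: "x \<in> carrier C \<Longrightarrow> (\<And>y. y \<in> carrier C \<Longrightarrow> polar R C q x y = \<zero>) \<Longrightarrow> x = \<zero>\<^bsub>C\<^esub>"

type_synonym ('r, 'x, 'c, 'y) idx = "('r, 'x) ring_scheme \<times> ('r, 'c, 'y) module_scheme \<times> ('c \<Rightarrow> 'r)"

definition valid :: "('r, 'x, 'c, 'y) idx \<Rightarrow> bool"
  where "valid i \<longleftrightarrow> comp_on (fst i) (fst (snd i)) (mult (fst (snd i))) (snd (snd i))"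

abbreviation ring_at :: "('r, 'x, 'c, 'y) idx \<Rightarrow> ('r, 'x) ring_scheme" where "ring_at i \<equiv> fst i"
abbreviation mod_at :: "('r, 'x, 'c, 'y) idx \<Rightarrow> ('r, 'c, 'y) module_scheme" where "mod_at i \<equiv> fst (snd i)"

lemma valid_cring: "valid i \<Longrightarrow> cring (ring_at i)"
  and valid_module: "valid i \<Longrightarrow> module (ring_at i) (mod_at i)"
  and valid_abelian: "valid i \<Longrightarrow> abelian_group (mod_at i)"
  by (auto simp: valid_def comp_on_def module_def)

lemma valid_ring_abelian: "valid i \<Longrightarrow> abelian_group (ring_at i)"
  using cring.axioms(1)[OF valid_cring] ring.is_abelian_group by blast

text \<open>Choosing an element in every composition algebra with carriers in \<open>'r\<close> and \<open>'c\<close> gives a single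
  composition algebra on types, of which each given one is the part cut out by an idempotent. The
  integer coordinate keeps \<open>0 \<noteq> 1\<close> when all the rings involved are zero.\<close>

definition family :: "(('r, 'x, 'c, 'y) idx \<Rightarrow> 'a set) \<Rightarrow> (('r, 'x, 'c, 'y) idx \<Rightarrow> 'a) \<Rightarrow> bool"
  where "family A f \<longleftrightarrow> (\<forall>i. if valid i then f i \<in> A i else f i = undefined)"

lemma familyI: "(\<And>i. valid i \<Longrightarrow> f i \<in> A i) \<Longrightarrow> family A (\<lambda>i. if valid i then f i else undefined)"
  unfolding family_def by metis

lemma familyD: "family A f \<Longrightarrow> valid i \<Longrightarrow> f i \<in> A i"
  unfolding family_def by metis

text \<open>Off the valid indices both families take the value \<open>undefined\<close>.\<close>

lemma family_eqI: "family A f \<Longrightarrow> family A g \<Longrightarrow> (\<And>i. valid i \<Longrightarrow> f i = g i) \<Longrightarrow> f = g"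
  unfolding family_def by (metis ext)

typedef ('r, 'x, 'c, 'y) sca =
  "{p. family (\<lambda>i :: ('r, 'x, 'c, 'y) idx. carrier (ring_at i)) (fst p)}
    :: ((('r, 'x, 'c, 'y) idx \<Rightarrow> 'r) \<times> int) set"
  using familyI[of "\<lambda>i. \<zero>\<^bsub>ring_at i\<^esub>"] abelian_groupE(2)[OF valid_ring_abelian]
  by (metis (no_types, lifting) fst_conv mem_Collect_eq)

typedef ('r, 'x, 'c, 'y) vec =
  "{p. family (\<lambda>i :: ('r, 'x, 'c, 'y) idx. carrier (mod_at i)) (fst p)}
    :: ((('r, 'x, 'c, 'y) idx \<Rightarrow> 'c) \<times> int) set"
  using familyI[of "\<lambda>i. \<zero>\<^bsub>mod_at i\<^esub>"] abelian_groupE(2)[OF valid_abelian]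
  by (metis (no_types, lifting) fst_conv mem_Collect_eq)

definition sval where "sval a = fst (Rep_sca a)"
definition sint where "sint a = snd (Rep_sca a)"
definition smk where "smk f n = Abs_sca (\<lambda>i. if valid i then f i else undefined, n)"
definition vval where "vval a = fst (Rep_vec a)"
definition vint where "vint a = snd (Rep_vec a)"
definition vmk where "vmk f n = Abs_vec (\<lambda>i. if valid i then f i else undefined, n)"

lemma sval_mem [simp]: "valid i \<Longrightarrow> sval a i \<in> carrier (ring_at i)"
  using Rep_sca[of a] familyD unfolding sval_def by fastforce

lemma vval_mem [simp]: "valid i \<Longrightarrow> vval a i \<in> carrier (mod_at i)"
  using Rep_vec[of a] familyD unfolding vval_def by fastforce

lemma Rep_smk: "(\<And>j. valid j \<Longrightarrow> f j \<in> carrier (ring_at j)) \<Longrightarrow>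
    Rep_sca (smk f n) = (\<lambda>i. if valid i then f i else undefined, n)"
  unfolding smk_def using familyI[of f "\<lambda>i. carrier (ring_at i)"] by (subst Abs_sca_inverse) simp_all

lemma Rep_vmk: "(\<And>j. valid j \<Longrightarrow> f j \<in> carrier (mod_at j)) \<Longrightarrow>
    Rep_vec (vmk f n) = (\<lambda>i. if valid i then f i else undefined, n)"
  unfolding vmk_def using familyI[of f "\<lambda>i. carrier (mod_at i)"] by (subst Abs_vec_inverse) simp_all

lemma sval_smk: "(\<And>j. valid j \<Longrightarrow> f j \<in> carrier (ring_at j)) \<Longrightarrow> valid i \<Longrightarrow> sval (smk f n) i = f i"
  and sint_smk: "(\<And>j. valid j \<Longrightarrow> f j \<in> carrier (ring_at j)) \<Longrightarrow> sint (smk f n) = n"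
  by (simp_all add: sval_def sint_def Rep_smk)

lemma vval_vmk: "(\<And>j. valid j \<Longrightarrow> f j \<in> carrier (mod_at j)) \<Longrightarrow> valid i \<Longrightarrow> vval (vmk f n) i = f i"
  and vint_vmk: "(\<And>j. valid j \<Longrightarrow> f j \<in> carrier (mod_at j)) \<Longrightarrow> vint (vmk f n) = n"
  by (simp_all add: vval_def vint_def Rep_vmk)

lemma sca_eqI: "(\<And>i. valid i \<Longrightarrow> sval a i = sval c i) \<Longrightarrow> sint a = sint c \<Longrightarrow> a = c"
  using Rep_sca[of a] Rep_sca[of c] family_eqI[of _ "fst (Rep_sca a)" "fst (Rep_sca c)"]
  by (simp add: sval_def sint_def prod_eq_iff flip: Rep_sca_inject)

lemma vec_eqI: "(\<And>i. valid i \<Longrightarrow> vval a i = vval c i) \<Longrightarrow> vint a = vint c \<Longrightarrow> a = c"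
  using Rep_vec[of a] Rep_vec[of c] family_eqI[of _ "fst (Rep_vec a)" "fst (Rep_vec c)"]
  by (simp add: vval_def vint_def prod_eq_iff flip: Rep_vec_inject)

lemma abelian_group_rules:
  assumes "abelian_group G"
  shows "\<zero>\<^bsub>G\<^esub> \<in> carrier G"
    "x \<in> carrier G \<Longrightarrow> y \<in> carrier G \<Longrightarrow> x \<oplus>\<^bsub>G\<^esub> y \<in> carrier G"
    "x \<in> carrier G \<Longrightarrow> \<ominus>\<^bsub>G\<^esub> x \<in> carrier G"
    "x \<in> carrier G \<Longrightarrow> y \<in> carrier G \<Longrightarrow> x \<ominus>\<^bsub>G\<^esub> y \<in> carrier G"
    "x \<in> carrier G \<Longrightarrow> y \<in> carrier G \<Longrightarrow> z \<in> carrier G \<Longrightarrow> x \<oplus>\<^bsub>G\<^esub> y \<oplus>\<^bsub>G\<^esub> z = x \<oplus>\<^bsub>G\<^esub> (y \<oplus>\<^bsub>G\<^esub> z)"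
    "x \<in> carrier G \<Longrightarrow> y \<in> carrier G \<Longrightarrow> x \<oplus>\<^bsub>G\<^esub> y = y \<oplus>\<^bsub>G\<^esub> x"
    "x \<in> carrier G \<Longrightarrow> \<zero>\<^bsub>G\<^esub> \<oplus>\<^bsub>G\<^esub> x = x"
    "x \<in> carrier G \<Longrightarrow> \<ominus>\<^bsub>G\<^esub> x \<oplus>\<^bsub>G\<^esub> x = \<zero>\<^bsub>G\<^esub>"
proof -
  interpret abelian_group G by fact
  show "\<zero>\<^bsub>G\<^esub> \<in> carrier G"
    "x \<in> carrier G \<Longrightarrow> y \<in> carrier G \<Longrightarrow> x \<oplus>\<^bsub>G\<^esub> y \<in> carrier G"
    "x \<in> carrier G \<Longrightarrow> \<ominus>\<^bsub>G\<^esub> x \<in> carrier G"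
    "x \<in> carrier G \<Longrightarrow> y \<in> carrier G \<Longrightarrow> x \<ominus>\<^bsub>G\<^esub> y \<in> carrier G"
    "x \<in> carrier G \<Longrightarrow> y \<in> carrier G \<Longrightarrow> z \<in> carrier G \<Longrightarrow> x \<oplus>\<^bsub>G\<^esub> y \<oplus>\<^bsub>G\<^esub> z = x \<oplus>\<^bsub>G\<^esub> (y \<oplus>\<^bsub>G\<^esub> z)"
    "x \<in> carrier G \<Longrightarrow> y \<in> carrier G \<Longrightarrow> x \<oplus>\<^bsub>G\<^esub> y = y \<oplus>\<^bsub>G\<^esub> x"
    "x \<in> carrier G \<Longrightarrow> \<zero>\<^bsub>G\<^esub> \<oplus>\<^bsub>G\<^esub> x = x"
    "x \<in> carrier G \<Longrightarrow> \<ominus>\<^bsub>G\<^esub> x \<oplus>\<^bsub>G\<^esub> x = \<zero>\<^bsub>G\<^esub>"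
    by (auto intro: a_assoc a_comm l_neg)
qed

lemmas valid_rules = abelian_group_rules[OF valid_abelian]

lemma cring_rules:
  assumes "cring S"
  shows "\<one>\<^bsub>S\<^esub> \<in> carrier S"
    "x \<in> carrier S \<Longrightarrow> y \<in> carrier S \<Longrightarrow> x \<otimes>\<^bsub>S\<^esub> y \<in> carrier S"
    "x \<in> carrier S \<Longrightarrow> y \<in> carrier S \<Longrightarrow> z \<in> carrier S \<Longrightarrow> x \<otimes>\<^bsub>S\<^esub> y \<otimes>\<^bsub>S\<^esub> z = x \<otimes>\<^bsub>S\<^esub> (y \<otimes>\<^bsub>S\<^esub> z)"
    "x \<in> carrier S \<Longrightarrow> y \<in> carrier S \<Longrightarrow> x \<otimes>\<^bsub>S\<^esub> y = y \<otimes>\<^bsub>S\<^esub> x"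
    "x \<in> carrier S \<Longrightarrow> \<one>\<^bsub>S\<^esub> \<otimes>\<^bsub>S\<^esub> x = x"
    "x \<in> carrier S \<Longrightarrow> y \<in> carrier S \<Longrightarrow> z \<in> carrier S \<Longrightarrow>
      (x \<oplus>\<^bsub>S\<^esub> y) \<otimes>\<^bsub>S\<^esub> z = x \<otimes>\<^bsub>S\<^esub> z \<oplus>\<^bsub>S\<^esub> y \<otimes>\<^bsub>S\<^esub> z"
proof -
  interpret cring S by fact
  show "\<one>\<^bsub>S\<^esub> \<in> carrier S"
    "x \<in> carrier S \<Longrightarrow> y \<in> carrier S \<Longrightarrow> x \<otimes>\<^bsub>S\<^esub> y \<in> carrier S"
    "x \<in> carrier S \<Longrightarrow> y \<in> carrier S \<Longrightarrow> z \<in> carrier S \<Longrightarrow> x \<otimes>\<^bsub>S\<^esub> y \<otimes>\<^bsub>S\<^esub> z = x \<otimes>\<^bsub>S\<^esub> (y \<otimes>\<^bsub>S\<^esub> z)"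
    "x \<in> carrier S \<Longrightarrow> y \<in> carrier S \<Longrightarrow> x \<otimes>\<^bsub>S\<^esub> y = y \<otimes>\<^bsub>S\<^esub> x"
    "x \<in> carrier S \<Longrightarrow> \<one>\<^bsub>S\<^esub> \<otimes>\<^bsub>S\<^esub> x = x"
    "x \<in> carrier S \<Longrightarrow> y \<in> carrier S \<Longrightarrow> z \<in> carrier S \<Longrightarrow>
      (x \<oplus>\<^bsub>S\<^esub> y) \<otimes>\<^bsub>S\<^esub> z = x \<otimes>\<^bsub>S\<^esub> z \<oplus>\<^bsub>S\<^esub> y \<otimes>\<^bsub>S\<^esub> z"
    by (auto intro: m_assoc m_comm l_distr)
qed

lemmas scalar_rules = abelian_group_rules[OF valid_ring_abelian] cring_rules[OF valid_cring]

instantiation sca :: (type, type, type, type) comm_ring_1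
begin

definition "zero_sca = smk (\<lambda>i. \<zero>\<^bsub>ring_at i\<^esub>) 0"
definition "one_sca = smk (\<lambda>i. \<one>\<^bsub>ring_at i\<^esub>) 1"
definition "plus_sca a c = smk (\<lambda>i. sval a i \<oplus>\<^bsub>ring_at i\<^esub> sval c i) (sint a + sint c)"
definition "times_sca a c = smk (\<lambda>i. sval a i \<otimes>\<^bsub>ring_at i\<^esub> sval c i) (sint a * sint c)"
definition "uminus_sca a = smk (\<lambda>i. \<ominus>\<^bsub>ring_at i\<^esub> sval a i) (- sint a)"
definition "minus_sca a c = smk (\<lambda>i. sval a i \<ominus>\<^bsub>ring_at i\<^esub> sval c i) (sint a - sint c)"

lemma sca_simps:
  "valid i \<Longrightarrow> sval 0 i = \<zero>\<^bsub>ring_at i\<^esub>" "sint 0 = 0"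
  "valid i \<Longrightarrow> sval 1 i = \<one>\<^bsub>ring_at i\<^esub>" "sint 1 = 1"
  "valid i \<Longrightarrow> sval (a + c) i = sval a i \<oplus>\<^bsub>ring_at i\<^esub> sval c i" "sint (a + c) = sint a + sint c"
  "valid i \<Longrightarrow> sval (a * c) i = sval a i \<otimes>\<^bsub>ring_at i\<^esub> sval c i" "sint (a * c) = sint a * sint c"
  "valid i \<Longrightarrow> sval (- a) i = \<ominus>\<^bsub>ring_at i\<^esub> sval a i" "sint (- a) = - sint a"
  "valid i \<Longrightarrow> sval (a - c) i = sval a i \<ominus>\<^bsub>ring_at i\<^esub> sval c i" "sint (a - c) = sint a - sint c"
  unfolding zero_sca_def one_sca_def plus_sca_def times_sca_def uminus_sca_def minus_sca_def
  by (subst sval_smk sint_smk; (simp add: scalar_rules)?)+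

instance
proof
  fix a c d :: "('a, 'b, 'c, 'd) sca"
  show "a * c * d = a * (c * d)"
    by (rule sca_eqI) (simp_all add: sca_simps scalar_rules(11))
  show "a * c = c * a"
    by (rule sca_eqI) (simp_all add: sca_simps scalar_rules(12))
  show "1 * a = a"
    by (rule sca_eqI) (simp_all add: sca_simps scalar_rules(13))
  show "a + c + d = a + (c + d)"
    by (rule sca_eqI) (simp_all add: sca_simps scalar_rules(5))
  show "a + c = c + a"
    by (rule sca_eqI) (simp_all add: sca_simps scalar_rules(6))
  show "0 + a = a"
    by (rule sca_eqI) (simp_all add: sca_simps scalar_rules(7))
  show "- a + a = 0"
    by (rule sca_eqI) (simp_all add: sca_simps scalar_rules(8))
  show "a - c = a + - c"
    by (rule sca_eqI) (simp_all add: sca_simps a_minus_def)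
  show "(a + c) * d = a * d + c * d"
    by (rule sca_eqI) (simp_all add: sca_simps scalar_rules(14) distrib_right)
  show "0 \<noteq> (1 :: ('a, 'b, 'c, 'd) sca)"
    by (auto dest: arg_cong[of _ _ sint] simp: sca_simps)
qed

end

instantiation vec :: (type, type, type, type) ab_group_add
begin

definition "zero_vec = vmk (\<lambda>i. \<zero>\<^bsub>mod_at i\<^esub>) 0"
definition "plus_vec a c = vmk (\<lambda>i. vval a i \<oplus>\<^bsub>mod_at i\<^esub> vval c i) (vint a + vint c)"
definition "uminus_vec a = vmk (\<lambda>i. \<ominus>\<^bsub>mod_at i\<^esub> vval a i) (- vint a)"
definition "minus_vec a c = vmk (\<lambda>i. vval a i \<ominus>\<^bsub>mod_at i\<^esub> vval c i) (vint a - vint c)"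

lemma vec_simps:
  "valid i \<Longrightarrow> vval 0 i = \<zero>\<^bsub>mod_at i\<^esub>" "vint 0 = 0"
  "valid i \<Longrightarrow> vval (a + c) i = vval a i \<oplus>\<^bsub>mod_at i\<^esub> vval c i" "vint (a + c) = vint a + vint c"
  "valid i \<Longrightarrow> vval (- a) i = \<ominus>\<^bsub>mod_at i\<^esub> vval a i" "vint (- a) = - vint a"
  "valid i \<Longrightarrow> vval (a - c) i = vval a i \<ominus>\<^bsub>mod_at i\<^esub> vval c i" "vint (a - c) = vint a - vint c"
  unfolding zero_vec_def plus_vec_def uminus_vec_def minus_vec_def
  by (subst vval_vmk vint_vmk; (simp add: valid_rules)?)+

instance
proof
  fix a c d :: "('a, 'b, 'c, 'd) vec"
  show "a + c + d = a + (c + d)"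
    by (rule vec_eqI) (simp_all add: vec_simps valid_rules(5))
  show "a + c = c + a"
    by (rule vec_eqI) (simp_all add: vec_simps valid_rules(6))
  show "0 + a = a"
    by (rule vec_eqI) (simp_all add: vec_simps valid_rules(7))
  show "- a + a = 0"
    by (rule vec_eqI) (simp_all add: vec_simps valid_rules(8))
  show "a - c = a + - c"
    by (rule vec_eqI) (simp_all add: vec_simps a_minus_def)
qed

end

definition vsmul :: "('r, 'x, 'c, 'y) sca \<Rightarrow> ('r, 'x, 'c, 'y) vec \<Rightarrow> ('r, 'x, 'c, 'y) vec"
  where "vsmul r v = vmk (\<lambda>i. sval r i \<odot>\<^bsub>mod_at i\<^esub> vval v i) (sint r * vint v)"

definition vmul :: "(('r, 'x, 'c, 'y) idx \<Rightarrow> 'c \<Rightarrow> 'c \<Rightarrow> 'c) \<Rightarrow> ('r, 'x, 'c, 'y) vec \<Rightarrow>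
    ('r, 'x, 'c, 'y) vec \<Rightarrow> ('r, 'x, 'c, 'y) vec"
  where "vmul M v w = vmk (\<lambda>i. M i (vval v i) (vval w i)) (vint v * vint w)"

definition vone :: "('r, 'x, 'c, 'y) vec" where "vone = vmk (\<lambda>i. \<one>\<^bsub>mod_at i\<^esub>) 1"

definition vnorm :: "(('r, 'x, 'c, 'y) idx \<Rightarrow> 'c \<Rightarrow> 'r) \<Rightarrow> ('r, 'x, 'c, 'y) vec \<Rightarrow> ('r, 'x, 'c, 'y) sca"
  where "vnorm Q v = smk (\<lambda>i. Q i (vval v i)) (vint v * vint v)"

definition vsing :: "('r, 'x, 'c, 'y) idx \<Rightarrow> 'c \<Rightarrow> ('r, 'x, 'c, 'y) vec"
  where "vsing i x = vmk (\<lambda>j. if j = i then x else \<zero>\<^bsub>mod_at j\<^esub>) 0"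

definition ssing :: "('r, 'x, 'c, 'y) idx \<Rightarrow> 'r \<Rightarrow> ('r, 'x, 'c, 'y) sca"
  where "ssing i x = smk (\<lambda>j. if j = i then x else \<zero>\<^bsub>ring_at j\<^esub>) 0"

lemma vsing_simps:
  assumes "x \<in> carrier (mod_at i)"
  shows "valid j \<Longrightarrow> vval (vsing i x) j = (if j = i then x else \<zero>\<^bsub>mod_at j\<^esub>)" "vint (vsing i x) = 0"
  unfolding vsing_def using assms by (subst vval_vmk vint_vmk; simp add: valid_rules)+

lemma ssing_simps:
  assumes "x \<in> carrier (ring_at i)"
  shows "valid j \<Longrightarrow> sval (ssing i x) j = (if j = i then x else \<zero>\<^bsub>ring_at j\<^esub>)" "sint (ssing i x) = 0"
  unfolding ssing_def using assms by (subst sval_smk sint_smk; simp add: scalar_rules)+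

lemma vsmul_simps:
  "valid i \<Longrightarrow> vval (vsmul r v) i = sval r i \<odot>\<^bsub>mod_at i\<^esub> vval v i" "vint (vsmul r v) = sint r * vint v"
  unfolding vsmul_def by (subst vval_vmk vint_vmk; simp add: module.smult_closed[OF valid_module])+

lemma vone_simps: "valid i \<Longrightarrow> vval vone i = \<one>\<^bsub>mod_at i\<^esub>" "vint vone = 1"
  unfolding vone_def by (subst vval_vmk vint_vmk; simp add: valid_def comp_on.one_mem)+

text \<open>Product and norm may be chosen at each index, so one pair of types carries several
  composition algebras with the same scalars, vectors and unit.\<close>

locale comp_family =
  fixes M :: "('r, 'x, 'c, 'y) idx \<Rightarrow> 'c \<Rightarrow> 'c \<Rightarrow> 'c" and Q :: "('r, 'x, 'c, 'y) idx \<Rightarrow> 'c \<Rightarrow> 'r"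
  assumes comp: "valid i \<Longrightarrow> comp_on (ring_at i) (mod_at i) (M i) (Q i)"
begin

lemma vmul_simps: "valid i \<Longrightarrow> vval (vmul M v w) i = M i (vval v i) (vval w i)"
    "vint (vmul M v w) = vint v * vint w"
  unfolding vmul_def by (subst vval_vmk vint_vmk; simp add: comp_on.m_closed[OF comp])+

lemma vnorm_simps: "valid i \<Longrightarrow> sval (vnorm Q v) i = Q i (vval v i)" "sint (vnorm Q v) = vint v * vint v"
  unfolding vnorm_def by (subst sval_smk sint_smk; simp add: comp_on.q_mem[OF comp])+

lemmas fam_simps = sca_simps vec_simps vsmul_simps vone_simps vmul_simps vnorm_simps

lemma polar_sval:
  "valid i \<Longrightarrow> sval (vnorm Q (v + w) - vnorm Q v - vnorm Q w) i
    = polar (ring_at i) (mod_at i) (Q i) (vval v i) (vval w i)"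
  by (simp add: fam_simps polar_def)

lemma composition: "composition_algebra vsmul (vmul M) vone (vnorm Q)"
proof
  fix r s :: "('r, 'x, 'c, 'y) sca" and x y z :: "('r, 'x, 'c, 'y) vec"
  show "vsmul r (x + y) = vsmul r x + vsmul r y"
    by (rule vec_eqI) (simp_all add: fam_simps module.smult_r_distr[OF valid_module] distrib_left)
  show "vsmul (r + s) x = vsmul r x + vsmul s x"
    by (rule vec_eqI) (simp_all add: fam_simps module.smult_l_distr[OF valid_module] distrib_right)
  show "vsmul r (vsmul s x) = vsmul (r * s) x"
    by (rule vec_eqI) (simp_all add: fam_simps module.smult_assoc1[OF valid_module])
  show "vsmul 1 x = x"
    by (rule vec_eqI) (simp_all add: fam_simps module.smult_one[OF valid_module])
  show "vmul M (x + y) z = vmul M x z + vmul M y z"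
    by (rule vec_eqI) (simp_all add: fam_simps comp_on.m_add_left[OF comp] distrib_right)
  show "vmul M x (y + z) = vmul M x y + vmul M x z"
    by (rule vec_eqI) (simp_all add: fam_simps comp_on.m_add_right[OF comp] distrib_left)
  show "vmul M (vsmul r x) y = vsmul r (vmul M x y)"
    by (rule vec_eqI) (simp_all add: fam_simps comp_on.m_smult_left[OF comp])
  show "vmul M x (vsmul r y) = vsmul r (vmul M x y)"
    by (rule vec_eqI) (simp_all add: fam_simps comp_on.m_smult_right[OF comp])
  show "vmul M vone x = x"
    by (rule vec_eqI) (simp_all add: fam_simps comp_on.m_one_left[OF comp])
  show "vmul M x vone = x"
    by (rule vec_eqI) (simp_all add: fam_simps comp_on.m_one_right[OF comp])
  show "vnorm Q (vsmul r x) = r * r * vnorm Q x"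
    by (rule sca_eqI) (simp_all add: fam_simps comp_on.q_smul[OF comp])
  show "vnorm Q (x + y + z) - vnorm Q (x + y) - vnorm Q z
    = (vnorm Q (x + z) - vnorm Q x - vnorm Q z) + (vnorm Q (y + z) - vnorm Q y - vnorm Q z)"
  proof (rule sca_eqI)
    fix i :: "('r, 'x, 'c, 'y) idx" assume i: "valid i"
    show "sval (vnorm Q (x + y + z) - vnorm Q (x + y) - vnorm Q z) i
      = sval ((vnorm Q (x + z) - vnorm Q x - vnorm Q z) + (vnorm Q (y + z) - vnorm Q y - vnorm Q z)) i"
      unfolding sca_simps(5)[OF i] polar_sval[OF i] vec_simps(3)[OF i]
      by (intro comp_on.polar_add_left[OF comp[OF i]]) (simp_all add: i)
  qed (simp only: fam_simps, simp add: algebra_simps)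
  show "vnorm Q (vsmul r x + y) - vnorm Q (vsmul r x) - vnorm Q y
    = r * (vnorm Q (x + y) - vnorm Q x - vnorm Q y)"
  proof (rule sca_eqI)
    fix i :: "('r, 'x, 'c, 'y) idx" assume i: "valid i"
    show "sval (vnorm Q (vsmul r x + y) - vnorm Q (vsmul r x) - vnorm Q y) i
      = sval (r * (vnorm Q (x + y) - vnorm Q x - vnorm Q y)) i"
      unfolding sca_simps(7)[OF i] polar_sval[OF i] vsmul_simps(1)[OF i]
      by (intro comp_on.polar_smult_left[OF comp[OF i]]) (simp_all add: i)
  qed (simp only: fam_simps, simp add: algebra_simps)
  show "vnorm Q (vmul M x y) = vnorm Q x * vnorm Q y"
    by (rule sca_eqI) (simp_all add: fam_simps comp_on.q_m[OF comp])
  show "vnorm Q vone = 1"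
    by (rule sca_eqI) (simp_all add: fam_simps comp_on.q_one[OF comp])
  assume zero: "\<And>y. vnorm Q (x + y) - vnorm Q x - vnorm Q y = 0"
  show "x = 0"
  proof (rule vec_eqI)
    fix i :: "('r, 'x, 'c, 'y) idx"
    assume i: "valid i"
    show "vval x i = vval 0 i"
      unfolding vec_simps(1)[OF i]
    proof (rule comp_on.polar_nondeg[OF comp[OF i]])
      fix c assume c: "c \<in> carrier (mod_at i)"
      show "polar (ring_at i) (mod_at i) (Q i) (vval x i) c = \<zero>\<^bsub>ring_at i\<^esub>"
        \<comment> \<open>Vectors supported at \<open>i\<close> alone test nondegeneracy in that
          coordinate.\<close>
        using arg_cong[OF zero[of "vsing i c"], of "\<lambda>a. sval a i"]
        unfolding polar_sval[OF i] sca_simps(1)[OF i] vsing_simps(1)[OF c i] by simp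
    qed (simp add: i)
  next
    \<comment> \<open>In the integer coordinate the polar form is twice the product, so pairing with
      the unit suffices.\<close>
    show "vint x = vint 0"
      using arg_cong[OF zero[of vone], of sint] by (simp add: fam_simps algebra_simps)
  qed
qed

end

definition comb5 :: "('r, 'c, 'y) module_scheme \<Rightarrow> (nat \<Rightarrow> 'r) \<Rightarrow> (nat \<Rightarrow> 'c) \<Rightarrow> 'c"
  where "comb5 C c X = c 0 \<odot>\<^bsub>C\<^esub> X 0 \<oplus>\<^bsub>C\<^esub> c 1 \<odot>\<^bsub>C\<^esub> X 1 \<oplus>\<^bsub>C\<^esub> c 2 \<odot>\<^bsub>C\<^esub> X 2
    \<oplus>\<^bsub>C\<^esub> c 3 \<odot>\<^bsub>C\<^esub> X 3 \<oplus>\<^bsub>C\<^esub> c 4 \<odot>\<^bsub>C\<^esub> X 4"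

text \<open>The hypothesis \<open>rank\<close> on carriers. Vectors and coefficients are total
  functions on the natural numbers, of which only the first five values enter.\<close>

definition rank5 :: "('r, 'x) ring_scheme \<Rightarrow> ('r, 'c, 'y) module_scheme \<Rightarrow> ('c \<Rightarrow> 'r) \<Rightarrow> bool"
  where "rank5 R C q \<longleftrightarrow> (\<forall>P. primeideal P R \<longrightarrow> (\<exists>X. (\<forall>j. X j \<in> carrier C) \<and>
    (\<forall>c. (\<forall>j. c j \<in> carrier R) \<longrightarrow> (\<forall>y\<in>carrier C. polar R C q (comb5 C c X) y \<in> P) \<longrightarrow> (\<forall>j<5. c j \<in> P))))"

locale two_compositions =
  fixes R :: "('r, 'x) ring_scheme" and C :: "('r, 'c, 'y) module_scheme" and q :: "'c \<Rightarrow> 'r"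
    and m :: "'c \<Rightarrow> 'c \<Rightarrow> 'c" and q' :: "'c \<Rightarrow> 'r"
  assumes comp: "comp_on R C (mult C) q" and comp': "comp_on R C m q'"
begin

definition i0 :: "('r, 'x, 'c, 'y) idx" where "i0 = (R, C, q)"
definition e0 :: "('r, 'x, 'c, 'y) sca" where "e0 = ssing i0 \<one>\<^bsub>R\<^esub>"
text \<open>Every index other than \<open>i0\<close> keeps its own product. Different choices of
  \<open>m\<close> then give algebras on the same types that differ only in the factor cut out by
  \<open>e0\<close>.\<close>

definition M0 :: "('r, 'x, 'c, 'y) idx \<Rightarrow> 'c \<Rightarrow> 'c \<Rightarrow> 'c"
  where "M0 i = (if i = i0 then m else mult (mod_at i))"
definition Q0 :: "('r, 'x, 'c, 'y) idx \<Rightarrow> 'c \<Rightarrow> 'r"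
  where "Q0 i = (if i = i0 then q' else snd (snd i))"

lemma at_i0 [simp]: "ring_at i0 = R" "mod_at i0 = C" "snd (snd i0) = q" "M0 i0 = m" "Q0 i0 = q'"
  by (simp_all add: i0_def M0_def Q0_def)

lemma valid_i0 [simp]: "valid i0"
  using comp by (simp add: valid_def i0_def)

lemma family0: "comp_family M0 Q0"
proof (rule comp_family.intro)
  fix i :: "('r, 'x, 'c, 'y) idx" assume i: "valid i"
  show "comp_on (ring_at i) (mod_at i) (M0 i) (Q0 i)"
  proof (cases "i = i0")
    case True
    then show ?thesis using comp' by (simp only: at_i0)
  next
    case False
    then show ?thesis using i unfolding M0_def Q0_def valid_def by (simp only: if_False)
  qed
qed

lemma ring0: "cring R" "module R C" "abelian_group C"
  using valid_cring[OF valid_i0] valid_module[OF valid_i0] valid_abelian[OF valid_i0] by simp_all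

lemmas rules0 = scalar_rules[OF valid_i0, simplified] valid_rules[OF valid_i0, simplified]

lemma mem0 [simp]: "sval a i0 \<in> carrier R" "vval v i0 \<in> carrier C"
  using sval_mem[OF valid_i0] vval_mem[OF valid_i0] by auto

lemma e0_simps: "valid i \<Longrightarrow> sval e0 i = (if i = i0 then \<one>\<^bsub>R\<^esub> else \<zero>\<^bsub>ring_at i\<^esub>)" "sint e0 = 0"
  using ssing_simps[of "\<one>\<^bsub>R\<^esub>" i0] rules0 by (auto simp: e0_def)

lemma e0_mult: "e0 * a = ssing i0 (sval a i0)"
proof (rule sca_eqI)
  fix i :: "('r, 'x, 'c, 'y) idx" assume i: "valid i"
  interpret S: cring "ring_at i" using valid_cring[OF i] .
  interpret R: cring R by (rule ring0)
  show "sval (e0 * a) i = sval (ssing i0 (sval a i0)) i"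
    using i sval_mem[OF i, of a] by (auto simp: sca_simps e0_simps ssing_simps)
qed (simp add: sca_simps e0_simps ssing_simps)

lemma e0_idem: "e0 * e0 = e0"
  unfolding e0_mult e0_simps(1)[OF valid_i0] by (simp add: e0_def)

lemma e0_vsmul: "vsmul e0 v = vsing i0 (vval v i0)"
proof (rule vec_eqI)
  fix i :: "('r, 'x, 'c, 'y) idx" assume i: "valid i"
  show "vval (vsmul e0 v) i = vval (vsing i0 (vval v i0)) i"
  proof (cases "i = i0")
    case True
    then show ?thesis
      by (simp add: vsmul_simps e0_simps vsing_simps module.smult_one[OF ring0(2)])
  next
    case False
    then show ?thesis
      using i by (simp add: vsmul_simps e0_simps vsing_simps module.smult_l_null[OF valid_module])
  qed
qed (simp add: vsmul_simps e0_simps vsing_simps)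

section \<open>Prime ideals of the product ring and prime ideals of \<open>R\<close>\<close>

context
  fixes I :: "('r, 'x, 'c, 'y) sca set"
  assumes prm: "prm e0 I"
begin

text \<open>\<open>e0\<close> kills the difference of \<open>a\<close> and \<open>c\<close> and is
  not in the prime, so the difference is in it.\<close>

lemma prm_cong: "sval a i0 = sval c i0 \<Longrightarrow> a \<in> I \<Longrightarrow> c \<in> I"
proof -
  assume eq: "sval a i0 = sval c i0" and a: "a \<in> I"
  have "e0 * (c - a) = 0"
  proof -
    have "e0 * c = e0 * a" by (simp add: e0_mult eq)
    then show ?thesis by (simp add: right_diff_distrib)
  qed
  then have "e0 * (c - a) \<in> I" using idl_zero[OF prm_idl[OF prm]] by simp
  then have "c - a \<in> I" using prm_mult[OF prm, of e0 "c - a"] prm unfolding prm_def by blast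
  then have "(c - a) + a \<in> I" using idl_add[OF prm_idl[OF prm] _ a] by blast
  then show "c \<in> I" by simp
qed

definition P0 :: "'r set" where "P0 = (\<lambda>a. sval a i0) ` I"

lemma P0_iff: "sval a i0 \<in> P0 \<longleftrightarrow> a \<in> I"
proof
  assume "sval a i0 \<in> P0"
  then obtain c where "sval c i0 = sval a i0" "c \<in> I" unfolding P0_def by force
  then show "a \<in> I" by (rule prm_cong)
qed (auto simp: P0_def)

lemma P0_lift: "r \<in> carrier R \<Longrightarrow> r \<in> P0 \<longleftrightarrow> ssing i0 r \<in> I"
  using P0_iff[of "ssing i0 r"] by (simp add: ssing_simps)

lemma primeideal_P0: "primeideal P0 R"
proof -
  interpret R: cring R by (rule ring0)
  note im = prm_idl[OF prm]
  have sub: "P0 \<subseteq> carrier R" by (auto simp: P0_def)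
  have "ideal P0 R"
  proof (rule idealI[OF R.ring_axioms])
    show "subgroup P0 (add_monoid R)"
    proof (rule R.add.subgroupI)
      show "P0 \<subseteq> carrier R" by (rule sub)
      show "P0 \<noteq> {}" using idl_zero[OF im] by (auto simp: P0_def)
      show "\<ominus>\<^bsub>R\<^esub> a \<in> P0" if mem: "a \<in> P0" for a
      proof -
        obtain s where "a = sval s i0" "s \<in> I" using mem unfolding P0_def by blast
        then show ?thesis using P0_iff[of "- s"] idl_minus[OF im] by (simp add: sca_simps)
      qed
      show "a \<oplus>\<^bsub>R\<^esub> c \<in> P0" if mem: "a \<in> P0" "c \<in> P0" for a c
      proof -
        obtain s t where "a = sval s i0" "s \<in> I" "c = sval t i0" "t \<in> I" using mem unfolding P0_def by blast
        then show ?thesis using P0_iff[of "s + t"] idl_add[OF im] by (simp add: sca_simps)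
      qed
    qed
  next
    fix a x assume "a \<in> P0" and x: "x \<in> carrier R"
    then obtain s where s: "a = sval s i0" "s \<in> I" unfolding P0_def by blast
    show "x \<otimes>\<^bsub>R\<^esub> a \<in> P0"
      using P0_iff[of "ssing i0 x * s"] idl_mult[OF im s(2)] x s(1) by (simp add: sca_simps ssing_simps)
    then show "a \<otimes>\<^bsub>R\<^esub> x \<in> P0"
      using x s(1) by (simp add: R.m_comm)
  qed
  then show ?thesis
  proof (rule primeidealI)
    show "cring R" by (rule ring0)
    have "1 \<notin> I" by (rule prm_one[OF prm])
    then have "\<one>\<^bsub>R\<^esub> \<notin> P0" using P0_iff[of 1] by (simp add: sca_simps)
    then show "carrier R \<noteq> P0" by auto
  next
    fix a c assume "a \<in> carrier R" "c \<in> carrier R" "a \<otimes>\<^bsub>R\<^esub> c \<in> P0"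
    then show "a \<in> P0 \<or> c \<in> P0"
      using P0_iff[of "ssing i0 a * ssing i0 c"] P0_lift
      by (simp add: sca_simps ssing_simps prm_mult[OF prm])
  qed
qed

end

lemma ranked0:
  assumes rank: "rank5 R C q'"
  shows "ranked_composition_algebra vsmul (vmul M0) vone (vnorm Q0) e0"
proof -
  interpret F: comp_family M0 Q0 by (rule family0)
  interpret A: composition_algebra vsmul "vmul M0" vone "vnorm Q0" by (rule F.composition)
  show ?thesis
  proof (unfold_locales)
    show "e0 * e0 = e0" by (rule e0_idem)
    fix I assume prm: "prm e0 I"
    have "\<exists>X. (\<forall>j. X j \<in> carrier C) \<and> (\<forall>c. (\<forall>j. c j \<in> carrier R) \<longrightarrow>
        (\<forall>y\<in>carrier C. polar R C q' (comb5 C c X) y \<in> P0 I) \<longrightarrow> (\<forall>j<5. c j \<in> P0 I))"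
      using rank[unfolded rank5_def] primeideal_P0[OF prm] by (elim allE impE)
    then obtain X where X': "\<forall>j. X j \<in> carrier C"
      and ind': "\<forall>c. (\<forall>j. c j \<in> carrier R) \<longrightarrow>
        (\<forall>y\<in>carrier C. polar R C q' (comb5 C c X) y \<in> P0 I) \<longrightarrow> (\<forall>j<5. c j \<in> P0 I)"
      by (elim exE conjE) (rule that)
    have X: "X j \<in> carrier C" for j using X' by blast
    have ind: "\<forall>j<5. c j \<in> P0 I" if "\<And>j. c j \<in> carrier R"
      "\<And>y. y \<in> carrier C \<Longrightarrow> polar R C q' (comb5 C c X) y \<in> P0 I" for c
      using ind'[THEN spec[of _ c]] that by simp
    have "\<forall>j<5. c j \<in> I"
      if c: "\<forall>y. vnorm Q0 ((\<Sum>j<5::nat. vsmul (c j) (vsing i0 (X j))) + y)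
        - vnorm Q0 (\<Sum>j<5. vsmul (c j) (vsing i0 (X j))) - vnorm Q0 y \<in> I" for c
    proof -
      define w where "w = (\<Sum>j<5::nat. vsmul (c j) (vsing i0 (X j)))"
      have w: "vval w i0 = comb5 C (\<lambda>j. sval (c j) i0) X"
        by (simp add: w_def eval_nat_numeral comb5_def vec_simps vsmul_simps vsing_simps X)
      have "\<forall>j<5. sval (c j) i0 \<in> P0 I"
      proof (rule ind)
        fix y assume y: "y \<in> carrier C"
        have "sval (vnorm Q0 (w + vsing i0 y) - vnorm Q0 w - vnorm Q0 (vsing i0 y)) i0 \<in> P0 I"
          using c by (simp add: P0_iff[OF prm] w_def)
        then show "polar R C q' (comb5 C (\<lambda>j. sval (c j) i0) X) y \<in> P0 I"
          unfolding F.polar_sval[OF valid_i0] w using y by (simp add: vsing_simps)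
      qed simp
      then show ?thesis by (simp add: P0_iff[OF prm])
    qed
    then show "\<exists>X. \<forall>c. (\<forall>y. vnorm Q0 ((\<Sum>j<5::nat. vsmul (c j) (X j)) + y)
        - vnorm Q0 (\<Sum>j<5. vsmul (c j) (X j)) - vnorm Q0 y \<in> I) \<longrightarrow> (\<forall>j<5. c j \<in> I)"
      by (intro exI[of _ "\<lambda>j. vsing i0 (X j)"]) blast
  qed
qed

end

section \<open>Localization\<close>

text \<open>As an idempotent, \<open>e\<close> has no power in \<open>I\<close>, which is what an
  avoiding prime requires. The maximality argument is that of
  \<open>idempotent_in_idl\<close>.\<close>

lemma (in cring) exists_prime_avoiding:
  assumes I: "ideal I R" and e: "e \<in> carrier R" "e \<otimes> e = e" "e \<notin> I"
  shows "\<exists>P. primeideal P R \<and> I \<subseteq> P \<and> e \<notin> P"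
proof -
  define A where "A = {J. ideal J R \<and> I \<subseteq> J \<and> e \<notin> J}"
  have "I \<in> A" using I e by (simp add: A_def)
  have "\<exists>M\<in>A. \<forall>X\<in>A. M \<subseteq> X \<longrightarrow> X = M"
  proof (rule subset_Zorn_nonempty)
    show "A \<noteq> {}" using \<open>I \<in> A\<close> by blast
  next
    fix K assume ne: "K \<noteq> {}" and ch: "subset.chain A K"
    have "subset.chain {I. ideal I R} K"
      using ch by (auto simp: subset_chain_def A_def)
    from chain_Union_is_ideal[OF this] have "ideal (\<Union>K) R" using ne by simp
    moreover have "J \<in> A" if "J \<in> K" for J using ch that unfolding subset_chain_def by blast
    then have "I \<subseteq> J" "e \<notin> J" if "J \<in> K" for J using that unfolding A_def by auto
    then have "I \<subseteq> \<Union>K" "e \<notin> \<Union>K" using ne by auto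
    ultimately show "\<Union>K \<in> A" by (simp add: A_def)
  qed
  then obtain M where "M \<in> A" and max: "\<And>X. X \<in> A \<Longrightarrow> M \<subseteq> X \<Longrightarrow> X = M" by blast
  then have M: "ideal M R" "I \<subseteq> M" "e \<notin> M" by (auto simp: A_def)
  interpret M: ideal M R by (rule M(1))
  have ext: "\<exists>c\<in>M. \<exists>r\<in>carrier R. e = c \<oplus> r \<otimes> a" if a: "a \<in> carrier R" "a \<notin> M" for a
  proof -
    interpret X: ideal "M <+>\<^bsub>R\<^esub> PIdl a" R by (intro add_ideals M(1) cgenideal_ideal a)
    have sub: "M \<subseteq> M <+>\<^bsub>R\<^esub> PIdl a" and "a \<in> M <+>\<^bsub>R\<^esub> PIdl a"
    proof -
      have z: "\<zero> \<in> PIdl a" using cgenideal_ideal[OF a(1)] by (simp add: additive_subgroup.zero_closed ideal_def)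
      show "M \<subseteq> M <+>\<^bsub>R\<^esub> PIdl a"
      proof
        fix c assume "c \<in> M"
        then have "c = c \<oplus> \<zero>" using M.Icarr by simp
        then show "c \<in> M <+>\<^bsub>R\<^esub> PIdl a" using z \<open>c \<in> M\<close> unfolding set_add_def' by blast
      qed
      have "a = \<zero> \<oplus> a" using a by simp
      then show "a \<in> M <+>\<^bsub>R\<^esub> PIdl a"
        using cgenideal_self[OF a(1)] M.zero_closed unfolding set_add_def' by blast
    qed
    then have "M <+>\<^bsub>R\<^esub> PIdl a \<noteq> M" using a by blast
    then have "e \<in> M <+>\<^bsub>R\<^esub> PIdl a"
      using max[of "M <+>\<^bsub>R\<^esub> PIdl a"] sub M(2) X.is_ideal by (auto simp: A_def)
    then show ?thesis unfolding set_add_def' cgenideal_def by blast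
  qed
  have "primeideal M R"
  proof (rule primeidealI[OF M(1) is_cring])
    show "carrier R \<noteq> M" using e M by blast
    fix a c assume ac: "a \<in> carrier R" "c \<in> carrier R" "a \<otimes> c \<in> M"
    show "a \<in> M \<or> c \<in> M"
    proof (rule ccontr)
      assume "\<not> ?thesis"
      then obtain u r v s where u: "u \<in> M" "r \<in> carrier R" "e = u \<oplus> r \<otimes> a"
        and v: "v \<in> M" "s \<in> carrier R" "e = v \<oplus> s \<otimes> c"
        using ext ac by meson
      have cl: "u \<in> carrier R" "v \<in> carrier R" using u v M.Icarr by auto
      have "e \<otimes> e = (u \<oplus> r \<otimes> a) \<otimes> (v \<oplus> s \<otimes> c)" by (simp only: flip: u(3) v(3))
      also have "\<dots> = (u \<otimes> (v \<oplus> s \<otimes> c) \<oplus> (r \<otimes> a) \<otimes> v) \<oplus> (r \<otimes> s) \<otimes> (a \<otimes> c)"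
        using cl u(2) v(2) ac(1,2) by algebra
      also have "\<dots> \<in> M"
        using u(2) v(2) ac(1,2) cl
          by (intro M.a_closed M.I_r_closed[OF u(1)] M.I_l_closed[OF v(1)] M.I_l_closed[OF ac(3)]) simp_all
      finally show False using e M by simp
    qed
  qed
  then show ?thesis using M by blast
qed

lemma self_module: "cring R \<Longrightarrow> module R (self_module R)"
proof -
  assume "cring R"
  then interpret cring R .
  have "abelian_group (self_module R)"
  proof (rule abelian_groupI)
    show "\<exists>y\<in>carrier (self_module R). y \<oplus>\<^bsub>self_module R\<^esub> x = \<zero>\<^bsub>self_module R\<^esub>"
      if "x \<in> carrier (self_module R)" for x
      using that by (auto simp: self_module_def intro!: bexI[of _ "\<ominus>\<^bsub>R\<^esub> x"] l_neg)
  qed (auto simp: self_module_def intro: a_assoc a_comm)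
  then show ?thesis
    by (intro module.intro is_cring) (auto simp: module_axioms_def self_module_def l_distr r_distr m_assoc)
qed

text \<open>Operations on fractions are unions over representatives. Once all members coincide, the
  union is their common value, provided that representatives exist.\<close>

lemma UN_const2:
  assumes "X \<noteq> {}" "Y \<noteq> {}" "\<And>m s n t. (m, s) \<in> X \<Longrightarrow> (n, t) \<in> Y \<Longrightarrow> f m s n t = c"
  shows "(\<Union>(m, s)\<in>X. \<Union>(n, t)\<in>Y. f m s n t) = c"
proof (rule SUP_eq_const[OF assms(1)])
  fix p assume "p \<in> X"
  then obtain m s where p: "p = (m, s)" "(m, s) \<in> X" by (cases p) auto
  have "(\<Union>(n, t)\<in>Y. f m s n t) = c"
  proof (rule SUP_eq_const[OF assms(2)])
    fix r assume "r \<in> Y"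
    then obtain n t where r: "r = (n, t)" "(n, t) \<in> Y" by (cases r) auto
    show "(case r of (n, t) \<Rightarrow> f m s n t) = c" using assms(3)[OF p(2) r(2)] by (simp add: r(1))
  qed
  then show "(case p of (m, s) \<Rightarrow> \<Union>(n, t)\<in>Y. f m s n t) = c" by (simp add: p(1))
qed

locale fractions = module R M for R :: "('r, 'x) ring_scheme" (structure) and M :: "('r, 'm, 'y) module_scheme" +
  fixes S :: "'r set"
  assumes S_sub: "S \<subseteq> carrier R" and S_one: "\<one> \<in> S" and S_mult: "s \<in> S \<Longrightarrow> t \<in> S \<Longrightarrow> s \<otimes> t \<in> S"
begin

lemma S_carrier [simp]: "s \<in> S \<Longrightarrow> s \<in> carrier R"
  using S_sub by blast

lemma fraction_iff: "(n, t) \<in> fraction M S m s \<longleftrightarrow>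
    n \<in> carrier M \<and> t \<in> S \<and> (\<exists>u\<in>S. u \<odot>\<^bsub>M\<^esub> (t \<odot>\<^bsub>M\<^esub> m) = u \<odot>\<^bsub>M\<^esub> (s \<odot>\<^bsub>M\<^esub> n))"
  by (auto simp: fraction_def)

lemma fraction_self: "m \<in> carrier M \<Longrightarrow> s \<in> S \<Longrightarrow> (m, s) \<in> fraction M S m s"
  using S_one by (auto simp: fraction_iff)

lemma fraction_subset:
  assumes m: "m \<in> carrier M" "s \<in> S" "m' \<in> carrier M" "s' \<in> S" "u \<in> S"
    and eq: "u \<odot>\<^bsub>M\<^esub> (s' \<odot>\<^bsub>M\<^esub> m) = u \<odot>\<^bsub>M\<^esub> (s \<odot>\<^bsub>M\<^esub> m')"
  shows "fraction M S m s \<subseteq> fraction M S m' s'"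
proof safe
  fix n t assume "(n, t) \<in> fraction M S m s"
  then obtain v where n: "n \<in> carrier M" "t \<in> S" "v \<in> S"
    and v: "v \<odot>\<^bsub>M\<^esub> (t \<odot>\<^bsub>M\<^esub> m) = v \<odot>\<^bsub>M\<^esub> (s \<odot>\<^bsub>M\<^esub> n)"
    by (auto simp: fraction_iff)
  \<comment> \<open>Transitivity of equality of fractions: the product of the two witnesses with the
    middle denominator.\<close>
  let ?w = "u \<otimes> v \<otimes> s"
  have "?w \<odot>\<^bsub>M\<^esub> (t \<odot>\<^bsub>M\<^esub> m') = (v \<otimes> t) \<odot>\<^bsub>M\<^esub> (u \<odot>\<^bsub>M\<^esub> (s \<odot>\<^bsub>M\<^esub> m'))"
    using m n by (simp add: smult_assoc1[symmetric] m_ac)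
  also have "\<dots> = (u \<otimes> s') \<odot>\<^bsub>M\<^esub> (v \<odot>\<^bsub>M\<^esub> (t \<odot>\<^bsub>M\<^esub> m))"
    unfolding eq[symmetric] using m n by (simp add: smult_assoc1[symmetric] m_ac)
  also have "\<dots> = ?w \<odot>\<^bsub>M\<^esub> (s' \<odot>\<^bsub>M\<^esub> n)"
    unfolding v using m n by (simp add: smult_assoc1[symmetric] m_ac)
  finally have "?w \<odot>\<^bsub>M\<^esub> (t \<odot>\<^bsub>M\<^esub> m') = ?w \<odot>\<^bsub>M\<^esub> (s' \<odot>\<^bsub>M\<^esub> n)" .
  moreover have "?w \<in> S" using m n by (simp add: S_mult)
  ultimately show "(n, t) \<in> fraction M S m' s'" using n by (auto simp: fraction_iff)
qed

lemma fraction_eqI: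
  assumes "m \<in> carrier M" "s \<in> S" "m' \<in> carrier M" "s' \<in> S" "u \<in> S"
    and "u \<odot>\<^bsub>M\<^esub> (s' \<odot>\<^bsub>M\<^esub> m) = u \<odot>\<^bsub>M\<^esub> (s \<odot>\<^bsub>M\<^esub> m')"
  shows "fraction M S m s = fraction M S m' s'"
  using fraction_subset[OF assms] fraction_subset[OF assms(3,4,1,2,5) assms(6)[symmetric]] by blast

lemma fraction_add:
  assumes m: "m \<in> carrier M" "s \<in> S" "n \<in> carrier M" "t \<in> S"
  shows "(\<Union>(m', s')\<in>fraction M S m s. \<Union>(n', t')\<in>fraction M S n t.
      fraction M S (t' \<odot>\<^bsub>M\<^esub> m' \<oplus>\<^bsub>M\<^esub> s' \<odot>\<^bsub>M\<^esub> n') (s' \<otimes> t'))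
    = fraction M S (t \<odot>\<^bsub>M\<^esub> m \<oplus>\<^bsub>M\<^esub> s \<odot>\<^bsub>M\<^esub> n) (s \<otimes> t)"
proof -
  have c: "fraction M S (t' \<odot>\<^bsub>M\<^esub> m' \<oplus>\<^bsub>M\<^esub> s' \<odot>\<^bsub>M\<^esub> n') (s' \<otimes> t')
      = fraction M S (t \<odot>\<^bsub>M\<^esub> m \<oplus>\<^bsub>M\<^esub> s \<odot>\<^bsub>M\<^esub> n) (s \<otimes> t)"
    if mem: "(m', s') \<in> fraction M S m s" "(n', t') \<in> fraction M S n t" for m' s' n' t'
  proof -
    obtain u v where u: "m' \<in> carrier M" "s' \<in> S" "u \<in> S" "n' \<in> carrier M" "t' \<in> S" "v \<in> S"
      and eu: "u \<odot>\<^bsub>M\<^esub> (s' \<odot>\<^bsub>M\<^esub> m) = u \<odot>\<^bsub>M\<^esub> (s \<odot>\<^bsub>M\<^esub> m')"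
      and ev: "v \<odot>\<^bsub>M\<^esub> (t' \<odot>\<^bsub>M\<^esub> n) = v \<odot>\<^bsub>M\<^esub> (t \<odot>\<^bsub>M\<^esub> n')"
      using mem by (auto simp: fraction_iff)
    have "(u \<otimes> v) \<odot>\<^bsub>M\<^esub> ((s \<otimes> t) \<odot>\<^bsub>M\<^esub> (t' \<odot>\<^bsub>M\<^esub> m' \<oplus>\<^bsub>M\<^esub> s' \<odot>\<^bsub>M\<^esub> n'))
      = (v \<otimes> t \<otimes> t') \<odot>\<^bsub>M\<^esub> (u \<odot>\<^bsub>M\<^esub> (s \<odot>\<^bsub>M\<^esub> m')) \<oplus>\<^bsub>M\<^esub> (u \<otimes> s \<otimes> s') \<odot>\<^bsub>M\<^esub> (v \<odot>\<^bsub>M\<^esub> (t \<odot>\<^bsub>M\<^esub> n'))"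
      using u m by (simp add: smult_assoc1[symmetric] smult_r_distr m_ac)
    also have "\<dots> = (u \<otimes> v) \<odot>\<^bsub>M\<^esub> ((s' \<otimes> t') \<odot>\<^bsub>M\<^esub> (t \<odot>\<^bsub>M\<^esub> m \<oplus>\<^bsub>M\<^esub> s \<odot>\<^bsub>M\<^esub> n))"
      unfolding eu[symmetric] ev[symmetric]
      using u m by (simp add: smult_assoc1[symmetric] smult_r_distr m_ac)
    finally show ?thesis
      using u m by (intro fraction_eqI[of _ _ _ _ "u \<otimes> v"]) (simp_all add: S_mult)
  qed
  have "fraction M S m s \<noteq> {}" "fraction M S n t \<noteq> {}"
    using fraction_self[OF m(1,2)] fraction_self[OF m(3,4)] by blast+
  then show ?thesis by (rule UN_const2) (rule c)
qed

lemma fraction_smult: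
  assumes a: "a \<in> carrier R" "s \<in> S" and m: "m \<in> carrier M" "t \<in> S"
  shows "(\<Union>(a', s')\<in>fraction (self_module R) S a s. \<Union>(m', t')\<in>fraction M S m t.
      fraction M S (a' \<odot>\<^bsub>M\<^esub> m') (s' \<otimes> t')) = fraction M S (a \<odot>\<^bsub>M\<^esub> m) (s \<otimes> t)"
proof -
  have c: "fraction M S (a' \<odot>\<^bsub>M\<^esub> m') (s' \<otimes> t') = fraction M S (a \<odot>\<^bsub>M\<^esub> m) (s \<otimes> t)"
    if mem: "(a', s') \<in> fraction (self_module R) S a s" "(m', t') \<in> fraction M S m t" for a' s' m' t'
  proof -
    obtain u v where u: "a' \<in> carrier R" "s' \<in> S" "u \<in> S" "m' \<in> carrier M" "t' \<in> S" "v \<in> S"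
      and eu: "u \<otimes> (s' \<otimes> a) = u \<otimes> (s \<otimes> a')"
      and ev: "v \<odot>\<^bsub>M\<^esub> (t' \<odot>\<^bsub>M\<^esub> m) = v \<odot>\<^bsub>M\<^esub> (t \<odot>\<^bsub>M\<^esub> m')"
      using mem by (auto simp: fraction_def self_module_def)
    have "(u \<otimes> v) \<odot>\<^bsub>M\<^esub> ((s \<otimes> t) \<odot>\<^bsub>M\<^esub> (a' \<odot>\<^bsub>M\<^esub> m'))
      = (u \<otimes> (s \<otimes> a')) \<odot>\<^bsub>M\<^esub> (v \<odot>\<^bsub>M\<^esub> (t \<odot>\<^bsub>M\<^esub> m'))"
      using u m a by (simp add: smult_assoc1[symmetric] m_ac)
    also have "\<dots> = (u \<otimes> v) \<odot>\<^bsub>M\<^esub> ((s' \<otimes> t') \<odot>\<^bsub>M\<^esub> (a \<odot>\<^bsub>M\<^esub> m))"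
      unfolding eu[symmetric] ev[symmetric] using u m a by (simp add: smult_assoc1[symmetric] m_ac)
    finally show ?thesis
      using u m a by (intro fraction_eqI[of _ _ _ _ "u \<otimes> v"]) (simp_all add: S_mult)
  qed
  have "(a, s) \<in> fraction (self_module R) S a s"
    using a S_one by (auto simp: fraction_def self_module_def)
  then have "fraction (self_module R) S a s \<noteq> {}" "fraction M S m t \<noteq> {}"
    using fraction_self[OF m] by blast+
  then show ?thesis by (rule UN_const2) (rule c)
qed

end

lemma self_module_simps [simp]:
  "carrier (self_module R) = carrier R" "add (self_module R) = add R" "zero (self_module R) = \<zero>\<^bsub>R\<^esub>"
  "smult (self_module R) = mult R"
  by (simp_all add: self_module_def)

locale prime_localization = module R C + primeideal P R
  for R :: "('r, 'x) ring_scheme" (structure) and C :: "('r, 'c, 'y) module_scheme" and P :: "'r set" +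
  fixes g :: "('c \<times> 'r) set \<Rightarrow> nat \<Rightarrow> ('r \<times> 'r) set" and n :: nat
  assumes g: "g \<in> linear_maps (localized_ring R (carrier R - P)) (localized_module R (carrier R - P) C)
      (free_module (localized_ring R (carrier R - P)) n)"
    and g_bij: "bij_betw g (carrier (localized_module R (carrier R - P) C))
      (carrier (free_module (localized_ring R (carrier R - P)) n))"
begin

definition S where "S = carrier R - P"
definition L where "L = localized_ring R S"
definition fr where "fr = fraction (self_module R) S"
definition coord where "coord j x = g (fraction C S x \<one>) j"
text \<open>The maximal ideal of the local ring \<open>L\<close>.\<close>

definition PL where "PL = {fr a s |a s. a \<in> P \<and> s \<in> S}"

lemma S_rules: "S \<subseteq> carrier R" "\<one> \<in> S" "s \<in> S \<Longrightarrow> t \<in> S \<Longrightarrow> s \<otimes> t \<in> S"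
proof -
  show "S \<subseteq> carrier R" by (auto simp: S_def)
  show "\<one> \<in> S" using one_imp_carrier I_notcarr by (auto simp: S_def)
  show "s \<otimes> t \<in> S" if "s \<in> S" "t \<in> S" using that I_prime by (auto simp: S_def)
qed

sublocale A: fractions R "self_module R" S
  using self_module[OF is_cring] S_rules by (simp add: fractions_def fractions_axioms_def)

sublocale B: fractions R C S
  using module_axioms S_rules by (simp add: fractions_def fractions_axioms_def)

lemma g': "g \<in> linear_maps L (localized_module R S C) (free_module L n)"
    "bij_betw g (carrier (localized_module R S C)) (carrier (free_module L n))"
  using g g_bij by (simp_all add: L_def S_def)

lemma L_simps:
  "carrier L = {fr a s |a s. a \<in> carrier R \<and> s \<in> S}" "\<zero>\<^bsub>L\<^esub> = fr \<zero> \<one>" "\<one>\<^bsub>L\<^esub> = fr \<one> \<one>"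
  by (simp_all add: L_def localized_ring_def fr_def Let_def)

lemma L_add: "a \<in> carrier R \<Longrightarrow> s \<in> S \<Longrightarrow> c \<in> carrier R \<Longrightarrow> t \<in> S \<Longrightarrow>
    fr a s \<oplus>\<^bsub>L\<^esub> fr c t = fr (t \<otimes> a \<oplus> s \<otimes> c) (s \<otimes> t)"
  using A.fraction_add[of a s c t] by (simp add: L_def localized_ring_def fr_def Let_def)

lemma L_mult: "a \<in> carrier R \<Longrightarrow> s \<in> S \<Longrightarrow> c \<in> carrier R \<Longrightarrow> t \<in> S \<Longrightarrow>
    fr a s \<otimes>\<^bsub>L\<^esub> fr c t = fr (a \<otimes> c) (s \<otimes> t)"
  using A.fraction_smult[of a s c t] by (simp add: L_def localized_ring_def fr_def Let_def)

lemma loc_mem: "x \<in> carrier C \<Longrightarrow> s \<in> S \<Longrightarrow> fraction C S x s \<in> carrier (localized_module R S C)"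
  by (auto simp: localized_module_def)

lemma fr_mem: "a \<in> carrier R \<Longrightarrow> s \<in> S \<Longrightarrow> fr a s \<in> carrier L"
  by (auto simp: L_simps)

lemma coord_mem: "x \<in> carrier C \<Longrightarrow> j < n \<Longrightarrow> coord j x \<in> carrier L"
  using g'(1) loc_mem[OF _ S_rules(2)] by (auto simp: linear_maps_def free_module_def coord_def)

lemma coord_add:
  assumes "x \<in> carrier C" "y \<in> carrier C" "j < n"
  shows "coord j (x \<oplus>\<^bsub>C\<^esub> y) = coord j x \<oplus>\<^bsub>L\<^esub> coord j y"
proof -
  have "fraction C S x \<one> \<oplus>\<^bsub>localized_module R S C\<^esub> fraction C S y \<one> = fraction C S (x \<oplus>\<^bsub>C\<^esub> y) \<one>"
    using B.fraction_add[of x \<one> y \<one>] assms S_rules by (simp add: localized_module_def smult_one)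
  then have "g (fraction C S (x \<oplus>\<^bsub>C\<^esub> y) \<one>)
      = g (fraction C S x \<one>) \<oplus>\<^bsub>free_module L n\<^esub> g (fraction C S y \<one>)"
    using g'(1) loc_mem[OF _ S_rules(2)] assms by (auto simp: linear_maps_def simp flip: \<open>_ = fraction C S (x \<oplus>\<^bsub>C\<^esub> y) \<one>\<close>)
  then show ?thesis using assms by (simp add: coord_def free_module_def)
qed

lemma g_smult:
  assumes "r \<in> carrier R" "s \<in> S" "x \<in> carrier C" "t \<in> S" "j < n"
  shows "g (fraction C S (r \<odot>\<^bsub>C\<^esub> x) (s \<otimes> t)) j = fr r s \<otimes>\<^bsub>L\<^esub> g (fraction C S x t) j"
proof -
  have eq: "fr r s \<odot>\<^bsub>localized_module R S C\<^esub> fraction C S x t = fraction C S (r \<odot>\<^bsub>C\<^esub> x) (s \<otimes> t)"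
    using B.fraction_smult[of r s x t] assms by (simp add: localized_module_def fr_def)
  have "g (fraction C S (r \<odot>\<^bsub>C\<^esub> x) (s \<otimes> t)) = fr r s \<odot>\<^bsub>free_module L n\<^esub> g (fraction C S x t)"
    using g'(1) loc_mem[OF assms(3,4)] fr_mem[OF assms(1,2)]
    by (auto simp: linear_maps_def simp flip: eq)
  then show ?thesis using assms by (simp add: free_module_def)
qed

lemma coord_smult:
  assumes "r \<in> carrier R" "x \<in> carrier C" "j < n"
  shows "coord j (r \<odot>\<^bsub>C\<^esub> x) = fr r \<one> \<otimes>\<^bsub>L\<^esub> coord j x"
  using g_smult[of r \<one> x \<one> j] assms S_rules by (simp add: coord_def)

text \<open>A preimage of a standard basis vector is a fraction with denominator \<open>s\<close>;
  its numerator has coordinate \<open>s\<close> there and zero elsewhere.\<close>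

lemma coord_basis:
  assumes j: "j < n"
  shows "\<exists>x\<in>carrier C. \<exists>s\<in>S. \<forall>k<n. coord k x = fr (if k = j then s else \<zero>) \<one>"
proof -
  define E where "E = (\<lambda>k\<in>{..<n}. if k = j then \<one>\<^bsub>L\<^esub> else \<zero>\<^bsub>L\<^esub>)"
  have "fr \<one> \<one> \<in> carrier L" "fr \<zero> \<one> \<in> carrier L"
    by (simp_all add: fr_mem S_rules(2))
  then have "E \<in> carrier (free_module L n)"
    unfolding E_def free_module_def L_simps(2,3) by simp
  then have "E \<in> g ` carrier (localized_module R S C)"
    by (simp add: bij_betw_imp_surj_on[OF g'(2)])
  then obtain X where "X \<in> carrier (localized_module R S C)" and gX: "g X = E" by blast
  then obtain x s where x: "x \<in> carrier C" "s \<in> S" "X = fraction C S x s"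
    by (auto simp: localized_module_def)
  have "fraction C S x \<one> = fraction C S (s \<odot>\<^bsub>C\<^esub> x) (\<one> \<otimes> s)"
    using x S_rules by (intro B.fraction_eqI[of _ _ _ _ \<one>]) (auto simp: smult_one)
  then have "coord k x = fr s \<one> \<otimes>\<^bsub>L\<^esub> E k" if "k < n" for k
    using g_smult[of s \<one> x s k] x that S_rules gX by (simp add: coord_def)
  then have "coord k x = fr (if k = j then s else \<zero>) \<one>" if "k < n" for k
    using x that S_rules by (simp add: E_def L_simps L_mult)
  then show ?thesis using x by blast
qed

lemma PL_add: "X \<in> PL \<Longrightarrow> Y \<in> PL \<Longrightarrow> X \<oplus>\<^bsub>L\<^esub> Y \<in> PL"
proof -
  assume "X \<in> PL" "Y \<in> PL"
  then obtain a s c t where *: "X = fr a s" "Y = fr c t" "a \<in> P" "s \<in> S" "c \<in> P" "t \<in> S"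
    by (auto simp: PL_def)
  from * have "t \<otimes> a \<oplus> s \<otimes> c \<in> P"
    by (intro a_closed I_l_closed) simp_all
  moreover from * have "s \<otimes> t \<in> S" by (simp add: S_rules)
  moreover from * have "X \<oplus>\<^bsub>L\<^esub> Y = fr (t \<otimes> a \<oplus> s \<otimes> c) (s \<otimes> t)" by (simp add: L_add Icarr)
  ultimately show ?thesis unfolding PL_def by (intro CollectI exI conjI)
qed

lemma PL_mult: "X \<in> PL \<Longrightarrow> Y \<in> carrier L \<Longrightarrow> X \<otimes>\<^bsub>L\<^esub> Y \<in> PL"
proof -
  assume "X \<in> PL" "Y \<in> carrier L"
  then obtain a s c t where *: "X = fr a s" "Y = fr c t" "a \<in> P" "s \<in> S" "c \<in> carrier R" "t \<in> S"
    by (auto simp: PL_def L_simps)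
  then have "a \<otimes> c \<in> P" "s \<otimes> t \<in> S" "X \<otimes>\<^bsub>L\<^esub> Y = fr (a \<otimes> c) (s \<otimes> t)"
    by (simp_all add: L_mult Icarr I_r_closed S_rules)
  then show ?thesis unfolding PL_def by (intro CollectI exI conjI)
qed

lemma PL_fr: "a \<in> P \<Longrightarrow> fr a \<one> \<in> PL"
  using S_rules by (auto simp: PL_def)

lemma fr_one_in_PL: "a \<in> carrier R \<Longrightarrow> fr a \<one> \<in> PL \<Longrightarrow> a \<in> P"
proof -
  assume a: "a \<in> carrier R" and "fr a \<one> \<in> PL"
  then obtain c s where c: "fr a \<one> = fr c s" "c \<in> P" "s \<in> S" by (auto simp: PL_def)
  have "(a, \<one>) \<in> fr c s"
    using A.fraction_self[of a \<one>] a S_rules c(1) by (simp add: fr_def)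
  then obtain u where u: "u \<in> S" "u \<otimes> c = u \<otimes> (s \<otimes> a)"
    using A.fraction_iff[of a \<one> c s] c(2) Icarr by (auto simp: fr_def)
  have "u \<otimes> (s \<otimes> a) \<in> P" using c u I_l_closed[of c u] by simp
  then show "a \<in> P" using a u c I_prime[of u "s \<otimes> a"] I_prime[of s a] by (auto simp: S_def)
qed

lemma fr_eq_zero: "a \<in> carrier R \<Longrightarrow> fr a \<one> = fr \<zero> \<one> \<Longrightarrow> \<exists>u\<in>S. u \<otimes> a = \<zero>"
  using A.fraction_self[of a \<one>] A.fraction_iff[of a \<one> \<zero> \<one>] S_rules by (auto simp: fr_def)

lemma fr_sum: "a \<in> carrier R \<Longrightarrow> c \<in> carrier R \<Longrightarrow> fr a \<one> \<oplus>\<^bsub>L\<^esub> fr c \<one> = fr (a \<oplus> c) \<one>"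
  and fr_prod: "a \<in> carrier R \<Longrightarrow> c \<in> carrier R \<Longrightarrow> fr a \<one> \<otimes>\<^bsub>L\<^esub> fr c \<one> = fr (a \<otimes> c) \<one>"
  using S_rules by (simp_all add: L_add L_mult)

text \<open>\<open>p v\<close> is a combination of images of standard basis vectors with
  coefficients in \<open>P\<close>. The induction adds the coordinates of \<open>v\<close> one at a
  time, with \<open>t l\<close> keeping the first \<open>l\<close>.\<close>

lemma coord_free_image:
  assumes p: "p \<in> linear_maps R (free_module R d) C" and v: "v \<in> carrier (free_module R d)"
    and vP: "\<And>k. k < d \<Longrightarrow> v k \<in> P" and j: "j < n"
  shows "coord j (p v) \<in> PL"
proof -
  let ?F = "free_module R d"
  define t where "t l = (\<lambda>k\<in>{..<d}. if k < l then v k else \<zero>)" for l :: nat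
  define \<epsilon> where "\<epsilon> l = (\<lambda>k\<in>{..<d}. if k = l then \<one> else \<zero>)" for l :: nat
  have vc: "v k \<in> carrier R" if "k < d" for k using vP[OF that] Icarr by blast
  have mem: "t l \<in> carrier ?F" "\<epsilon> l \<in> carrier ?F" for l
    using vc by (auto simp: t_def \<epsilon>_def free_module_def)
  have pc: "p w \<in> carrier C" if "w \<in> carrier ?F" for w using p that by (auto simp: linear_maps_def)
  have step: "t (Suc l) = t l \<oplus>\<^bsub>?F\<^esub> v l \<odot>\<^bsub>?F\<^esub> \<epsilon> l" if "l < d" for l
    using vc vc[OF that] by (intro ext) (auto simp: t_def \<epsilon>_def free_module_def less_Suc_eq)
  have claim: "coord j (p (t l)) \<in> PL" if "l \<le> d" for l
    using that
  proof (induction l)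
    case 0
    have t0: "t 0 = \<zero> \<odot>\<^bsub>?F\<^esub> t 0" by (intro ext) (auto simp: t_def free_module_def)
    have lin: "p (\<zero> \<odot>\<^bsub>?F\<^esub> t 0) = \<zero> \<odot>\<^bsub>C\<^esub> p (t 0)"
      using p mem(1)[of 0] by (simp add: linear_maps_def)
    have "coord j (p (t 0)) = coord j (\<zero> \<odot>\<^bsub>C\<^esub> p (t 0))"
      by (rule arg_cong[OF trans[OF arg_cong[OF t0, of p] lin]])
    also have "\<dots> = fr \<zero> \<one> \<otimes>\<^bsub>L\<^esub> coord j (p (t 0))"
      by (rule coord_smult[OF R.zero_closed pc[OF mem(1)] j])
    finally have eq: "coord j (p (t 0)) = fr \<zero> \<one> \<otimes>\<^bsub>L\<^esub> coord j (p (t 0))" .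
    show ?case
      by (subst eq) (rule PL_mult[OF PL_fr[OF zero_closed] coord_mem[OF pc[OF mem(1)] j]])
  next
    case (Suc l)
    then have l: "l < d" by simp
    have "p (t (Suc l)) = p (t l) \<oplus>\<^bsub>C\<^esub> v l \<odot>\<^bsub>C\<^esub> p (\<epsilon> l)"
    proof -
      have "v l \<odot>\<^bsub>?F\<^esub> \<epsilon> l \<in> carrier ?F" using vc[OF l] by (auto simp: \<epsilon>_def free_module_def)
      then show ?thesis using p mem vc[OF l] unfolding step[OF l] by (auto simp: linear_maps_def)
    qed
    then have "coord j (p (t (Suc l))) = coord j (p (t l)) \<oplus>\<^bsub>L\<^esub> fr (v l) \<one> \<otimes>\<^bsub>L\<^esub> coord j (p (\<epsilon> l))"
      using pc[OF mem(1)] pc[OF mem(2)] vc[OF l] j by (simp add: coord_add coord_smult)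
    then show ?case
      using Suc PL_add PL_mult[OF PL_fr[OF vP[OF l]] coord_mem[OF pc[OF mem(2)] j]] by simp
  qed
  have "t d = v"
  proof
    show "t d k = v k" for k
      using v by (cases "k < d") (simp_all add: t_def free_module_def PiE_def extensional_def)
  qed
  then show ?thesis using claim[OF order_refl] by simp
qed

end

context octonion_algebra
begin

lemma polar_commute: "x \<in> carrier C \<Longrightarrow> y \<in> carrier C \<Longrightarrow> polar R C q x y = polar R C q y x"
  by (simp add: polar_def M.a_comm a_minus_def R.a_assoc R.a_comm[of "\<ominus> q x"] q_closed)

lemma localization:
  assumes "primeideal P R"
  shows "\<exists>g. prime_localization R C P g 8"
proof -
  interpret P: primeideal P R by fact
  have "module_isomorphic (localized_ring R (carrier R - P)) (localized_module R (carrier R - P) C)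
      (free_module (localized_ring R (carrier R - P)) 8)"
    using rank_8 assms by (simp add: has_constant_rank_def Let_def)
  then show ?thesis
    unfolding module_isomorphic_def prime_localization_def prime_localization_axioms_def
    using module_axioms assms by blast
qed

text \<open>If \<open>w\<close> pairs into \<open>P\<close> with everything, its local coordinates
  lie in the maximal ideal: by regularity each coordinate of the embedding \<open>i\<close> is a
  form \<open>polar R C q y\<close>, so \<open>i w\<close> has entries in \<open>P\<close>, and
  \<open>w = p (i w)\<close>. For a combination of five vectors from \<open>coord_basis\<close> the
  coordinates are the coefficients times denominators outside \<open>P\<close>.\<close>

lemma rank5: "rank5 R C q"
  unfolding rank5_def
proof (intro allI impI)
  fix P assume prime: "primeideal P R"
  obtain g where "prime_localization R C P g 8" using localization[OF prime] by blast
  then interpret L: prime_localization R C P g 8 .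
  obtain n i p where i: "i \<in> linear_maps R C (free_module R n)" and p: "p \<in> linear_maps R (free_module R n) C"
    and pi: "\<And>x. x \<in> carrier C \<Longrightarrow> p (i x) = x"
    using projective unfolding fg_projective_def by blast
  have rad: "L.coord j w \<in> L.PL" if w: "w \<in> carrier C" "\<And>y. y \<in> carrier C \<Longrightarrow> polar R C q w y \<in> P" and j: "j < 8" for w j
  proof -
    have iw: "i w \<in> carrier (free_module R n)" using i w by (auto simp: linear_maps_def)
    have "i w k \<in> P" if k: "k < n" for k
    proof -
      have ik: "i z k \<in> carrier R" if "z \<in> carrier C" for z
        using i that k by (auto simp: linear_maps_def free_module_def)
      have "(\<lambda>z\<in>carrier C. i z k) \<in> linear_maps R C (self_module R) \<inter> extensional (carrier C)"
        using i k ik by (auto simp: linear_maps_def free_module_def)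
      then obtain y where y: "y \<in> carrier C" "(\<lambda>z\<in>carrier C. i z k) = (\<lambda>z\<in>carrier C. polar R C q y z)"
        using polar_bij unfolding bij_betw_def by blast
      have "i w k = polar R C q y w" using fun_cong[OF y(2), of w] w by simp
      then show ?thesis using w y polar_commute[OF y(1) w(1)] by simp
    qed
    then show ?thesis using L.coord_free_image[OF p iw _ j] pi w by simp
  qed
  have "\<forall>j. \<exists>x s. j < 8 \<longrightarrow> x \<in> carrier C \<and> s \<in> L.S \<and> (\<forall>k<8. L.coord k x = L.fr (if k = j then s else \<zero>) \<one>)"
    using L.coord_basis by blast
  then obtain X0 s where X0: "\<And>j. j < 8 \<Longrightarrow> X0 j \<in> carrier C \<and> s j \<in> L.S \<and>
      (\<forall>k<8. L.coord k (X0 j) = L.fr (if k = j then s j else \<zero>) \<one>)" by metis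
  define X where "X j = (if j < 8 then X0 j else \<zero>\<^bsub>C\<^esub>)" for j :: nat
  have X: "X j \<in> carrier C" for j using X0 by (simp add: X_def)
  have sj: "s j \<in> carrier R" "s j \<notin> P" if "j < 8" for j using X0[OF that] by (auto simp: L.S_def)
  have ind: "\<forall>j<5. c j \<in> P" if c: "\<forall>j. c j \<in> carrier R"
    and cP: "\<forall>y\<in>carrier C. polar R C q (comb5 C c X) y \<in> P" for c
  proof (intro allI impI)
    fix k :: nat assume k: "k < 5"
    then have k8: "k < 8" by simp
    have tm: "L.coord k (c j \<odot>\<^bsub>C\<^esub> X j) = L.fr (c j \<otimes> (if k = j then s j else \<zero>)) \<one>" if "j < 8" for j
      using L.coord_smult[of "c j" "X j" k] c X k8 X0[OF that] sj[OF that] that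
      by (simp add: X_def L.fr_prod)
    have mem: "c j \<odot>\<^bsub>C\<^esub> X j \<in> carrier C" "c j \<otimes> (if k = j then s j else \<zero>) \<in> carrier R" if "j < 8" for j
      using c X sj[OF that] by auto
    have "L.coord k (comb5 C c X) = L.fr (c 0 \<otimes> (if k = 0 then s 0 else \<zero>) \<oplus> c 1 \<otimes> (if k = 1 then s 1 else \<zero>)
        \<oplus> c 2 \<otimes> (if k = 2 then s 2 else \<zero>) \<oplus> c 3 \<otimes> (if k = 3 then s 3 else \<zero>)
        \<oplus> c 4 \<otimes> (if k = 4 then s 4 else \<zero>)) \<one>"
      unfolding comb5_def using mem k8
      by (simp only: L.coord_add tm M.add.m_closed L.fr_sum R.add.m_closed)
    also have "\<dots> = L.fr (c k \<otimes> s k) \<one>"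
    proof -
      have "k = 0 \<or> k = 1 \<or> k = 2 \<or> k = 3 \<or> k = 4" using k by auto
      then show ?thesis using c sj by (elim disjE) simp_all
    qed
    finally have "L.fr (c k \<otimes> s k) \<one> \<in> L.PL"
      using rad[of "comb5 C c X" k] cP k8 mem unfolding comb5_def by simp
    then have "c k \<otimes> s k \<in> P" using L.fr_one_in_PL c sj[OF k8] by simp
    then have "c k \<in> P \<or> s k \<in> P" using c sj[OF k8] by (intro L.I_prime) simp_all
    then show "c k \<in> P" using sj[OF k8] by simp
  qed
  show "\<exists>X. (\<forall>j. X j \<in> carrier C) \<and> (\<forall>c. (\<forall>j. c j \<in> carrier R) \<longrightarrow>
      (\<forall>y\<in>carrier C. polar R C q (comb5 C c X) y \<in> P) \<longrightarrow> (\<forall>j<5. c j \<in> P))"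
    by (intro exI[of _ X] conjI allI impI X) (rule ind[THEN spec, THEN mp]; assumption)
qed

text \<open>A nonzero idempotent avoids some prime. There the localization of \<open>C\<close> is
  free of positive rank, and the idempotent cannot kill a basis vector.\<close>

lemma faithful:
  assumes r: "r \<in> carrier R" "r \<otimes> r = r" and zero: "\<And>x. x \<in> carrier C \<Longrightarrow> r \<odot>\<^bsub>C\<^esub> x = \<zero>\<^bsub>C\<^esub>"
  shows "r = \<zero>"
proof (rule ccontr)
  assume "r \<noteq> \<zero>"
  then obtain P where P: "primeideal P R" "r \<notin> P"
    using R.exists_prime_avoiding[OF R.zeroideal r] by auto
  obtain g where "prime_localization R C P g 8" using localization[OF P(1)] by blast
  then interpret L: prime_localization R C P g 8 .
  obtain x s where x: "x \<in> carrier C" "s \<in> L.S" "L.coord 0 x = L.fr s \<one>"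
    using L.coord_basis[of 0] by auto
  have s: "s \<in> carrier R" "s \<notin> P" using x by (auto simp: L.S_def)
  have "L.fr (r \<otimes> s) \<one> = L.coord 0 (r \<odot>\<^bsub>C\<^esub> x)"
    using L.coord_smult[of r x 0] x r s by (simp add: L.fr_prod)
  also have "\<dots> = L.coord 0 (\<zero> \<odot>\<^bsub>C\<^esub> x)" using zero[OF x(1)] x by (simp add: smult_l_null)
  also have "\<dots> = L.fr \<zero> \<one>"
    using L.coord_smult[of \<zero> x 0] x s by (simp add: L.fr_prod)
  finally have eq: "L.fr (r \<otimes> s) \<one> = L.fr \<zero> \<one>" .
  have "r \<otimes> s \<in> carrier R" using r s by simp
  from L.fr_eq_zero[OF this eq] obtain u where u: "u \<in> L.S" "u \<otimes> (r \<otimes> s) = \<zero>" by blast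
  have "u \<otimes> (r \<otimes> s) \<in> P" unfolding u(2) by (rule L.zero_closed)
  moreover have "u \<in> carrier R" and uP: "u \<notin> P" using u(1) by (simp_all add: L.S_def)
  ultimately have "u \<in> P \<or> r \<otimes> s \<in> P" using r(1) s(1) by (intro L.I_prime) simp_all
  with uP have "r \<otimes> s \<in> P" by simp
  then have "r \<in> P \<or> s \<in> P" by (rule L.I_prime[OF r(1) s(1)])
  then show False using s(2) P(2) by simp
qed

lemma polar_inject: "x \<in> carrier C \<Longrightarrow> y \<in> carrier C \<Longrightarrow>
    (\<And>z. z \<in> carrier C \<Longrightarrow> polar R C q x z = polar R C q y z) \<Longrightarrow> x = y"
  using inj_onD[OF bij_betw_imp_inj_on[OF polar_bij], of x y] restrict_ext[of "carrier C" "polar R C q x"]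
  by simp

lemma polar_rules:
  assumes "x \<in> carrier C" "y \<in> carrier C" "z \<in> carrier C"
  shows "polar R C q x y \<in> carrier R"
    "polar R C q (x \<oplus>\<^bsub>C\<^esub> y) z = polar R C q x z \<oplus> polar R C q y z"
    "r \<in> carrier R \<Longrightarrow> polar R C q (r \<odot>\<^bsub>C\<^esub> x) y = r \<otimes> polar R C q x y"
  using polar_linear_left[OF assms(2)] polar_linear_left[OF assms(3)] assms
  by (auto simp: linear_maps_def)

text \<open>By multiplicativity \<open>?d\<close> fixes every norm, hence the polar form and, by
  nondegeneracy, every vector. So \<open>\<one> \<ominus> ?d\<close> is an idempotent that kills
  \<open>C\<close>, and \<open>faithful\<close> applies.\<close>

lemma q_unit: "q \<one>\<^bsub>C\<^esub> = \<one>"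
proof -
  let ?d = "q \<one>\<^bsub>C\<^esub>"
  have d: "?d \<in> carrier R" using unit_closed q_closed by blast
  have qd: "?d \<otimes> q x = q x" if "x \<in> carrier C" for x
    using q_mult[OF unit_closed that] mult_unit_left[OF that] by simp
  have "?d \<odot>\<^bsub>C\<^esub> x = x" if x: "x \<in> carrier C" for x
  proof (rule polar_inject)
    fix z assume z: "z \<in> carrier C"
    have "polar R C q (?d \<odot>\<^bsub>C\<^esub> x) z = ?d \<otimes> polar R C q x z" by (rule polar_rules(3)[OF x z z d])
    also have "\<dots> = polar R C q x z"
      using x z d qd by (simp add: polar_def a_minus_def R.r_distr R.r_minus q_closed)
    finally show "polar R C q (?d \<odot>\<^bsub>C\<^esub> x) z = polar R C q x z" .
  qed (use x d in auto)
  then have "(\<one> \<ominus> ?d) \<odot>\<^bsub>C\<^esub> x = \<zero>\<^bsub>C\<^esub>" if "x \<in> carrier C" for x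
    using that d by (simp add: a_minus_def smult_l_distr smult_l_minus smult_one M.r_neg)
  moreover have "?d \<otimes> ?d = ?d" using qd[OF unit_closed] by simp
  then have "(\<one> \<ominus> ?d) \<otimes> (\<one> \<ominus> ?d) = \<one> \<ominus> ?d"
    using d by (simp add: a_minus_def R.l_distr R.r_distr R.l_minus R.r_minus R.l_neg R.r_neg R.a_assoc)
  ultimately have "\<one> \<ominus> ?d = \<zero>" using faithful d by simp
  then have "\<one> = ?d" using R.r_right_minus_eq[of \<one> ?d] d by simp
  then show ?thesis ..
qed

lemma comp_on_mult: "comp_on R C (mult C) q"
proof
  fix x y z r
  assume x: "x \<in> carrier C" and y: "y \<in> carrier C"
  show "x \<otimes>\<^bsub>C\<^esub> y \<in> carrier C" using x y by (rule mult_closed)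
  show "q (x \<otimes>\<^bsub>C\<^esub> y) = q x \<otimes> q y" using x y by (rule q_mult)
  {
    assume z: "z \<in> carrier C"
    show "(x \<oplus>\<^bsub>C\<^esub> y) \<otimes>\<^bsub>C\<^esub> z = x \<otimes>\<^bsub>C\<^esub> z \<oplus>\<^bsub>C\<^esub> y \<otimes>\<^bsub>C\<^esub> z"
      using mult_linear_left[OF z] x y by (auto simp: linear_maps_def)
    show "x \<otimes>\<^bsub>C\<^esub> (y \<oplus>\<^bsub>C\<^esub> z) = x \<otimes>\<^bsub>C\<^esub> y \<oplus>\<^bsub>C\<^esub> x \<otimes>\<^bsub>C\<^esub> z"
      using mult_linear_right[OF x] y z by (auto simp: linear_maps_def)
    show "polar R C q (x \<oplus>\<^bsub>C\<^esub> y) z = polar R C q x z \<oplus> polar R C q y z"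
      by (rule polar_rules(2)[OF x y z])
  }
  {
    assume r: "r \<in> carrier R"
    show "(r \<odot>\<^bsub>C\<^esub> x) \<otimes>\<^bsub>C\<^esub> y = r \<odot>\<^bsub>C\<^esub> (x \<otimes>\<^bsub>C\<^esub> y)"
      using mult_linear_left[OF y] x r by (auto simp: linear_maps_def)
    show "x \<otimes>\<^bsub>C\<^esub> (r \<odot>\<^bsub>C\<^esub> y) = r \<odot>\<^bsub>C\<^esub> (x \<otimes>\<^bsub>C\<^esub> y)"
      using mult_linear_right[OF x] y r by (auto simp: linear_maps_def)
    show "polar R C q (r \<odot>\<^bsub>C\<^esub> x) y = r \<otimes> polar R C q x y"
      by (rule polar_rules(3)[OF x y y r])
  }
next
  fix x assume x: "x \<in> carrier C" and 0: "\<And>y. y \<in> carrier C \<Longrightarrow> polar R C q x y = \<zero>"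
  have "polar R C q \<zero>\<^bsub>C\<^esub> y = \<zero>" if "y \<in> carrier C" for y
    using polar_rules(3)[OF x that x, of \<zero>] x polar_rules(1)[OF x that x] by (simp add: smult_l_null)
  then show "x = \<zero>\<^bsub>C\<^esub>" using 0 x by (intro polar_inject) auto
qed (auto simp: unit_closed mult_unit_left mult_unit_right q_closed q_smult q_unit)

end

section \<open>The results on types, read back on carriers\<close>

context two_compositions
begin

interpretation F: comp_family M0 Q0 by (rule family0)

abbreviation "li \<equiv> vsing i0"
abbreviation "ev v \<equiv> vval v i0"

lemma ev_li: "x \<in> carrier C \<Longrightarrow> ev (li x) = x"
  by (simp add: vsing_simps)

lemma li_ev: "li (ev v) = vsmul e0 v"
  by (simp add: e0_vsmul)

lemma ev_e0: "ev (vsmul e0 v) = ev v"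
  by (simp add: ev_li flip: li_ev)

lemma ev_simps: "ev (v + w) = ev v \<oplus>\<^bsub>C\<^esub> ev w" "ev (vsmul r v) = sval r i0 \<odot>\<^bsub>C\<^esub> ev v"
    "ev (vmul M0 v w) = m (ev v) (ev w)" "ev vone = \<one>\<^bsub>C\<^esub>" "sval (vnorm Q0 v) i0 = q' (ev v)"
    "ev (v - w) = ev v \<ominus>\<^bsub>C\<^esub> ev w"
  by (simp_all add: F.fam_simps)

lemma li_add: "x \<in> carrier C \<Longrightarrow> y \<in> carrier C \<Longrightarrow> li (x \<oplus>\<^bsub>C\<^esub> y) = vsmul e0 (li x + li y)"
  and li_smult: "r \<in> carrier R \<Longrightarrow> x \<in> carrier C \<Longrightarrow> li (r \<odot>\<^bsub>C\<^esub> x) = vsmul e0 (vsmul (ssing i0 r) (li x))"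
  and li_mult: "x \<in> carrier C \<Longrightarrow> y \<in> carrier C \<Longrightarrow> li (m x y) = vsmul e0 (vmul M0 (li x) (li y))"
  and li_one: "li \<one>\<^bsub>C\<^esub> = vsmul e0 vone"
  by (simp_all add: ev_simps ev_li ssing_simps flip: li_ev)

lemma ev_cj:
  "ev (composition_algebra.cj vsmul vone (vnorm Q0) v) = conjugate R C q' (ev v)"
proof -
  interpret A: composition_algebra vsmul "vmul M0" vone "vnorm Q0" by (rule F.composition)
  show ?thesis
    using F.polar_sval[of i0 v vone]
    by (simp add: A.cj_def A.b_def ev_simps conjugate_def)
qed

text \<open>One product at \<open>i0\<close>, with \<open>q\<close> and \<open>q'\<close> as its two
  norms, is an instance of \<open>two_norms\<close>; \<open>norms_eq\<close> is read off at
  \<open>i0\<close>, where \<open>e0\<close> is the unit.\<close>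

lemma norms_agree:
  assumes m: "m = mult C" and rank: "rank5 R C q" and x: "x \<in> carrier C"
  shows "q x = q' x"
proof -
  interpret S: two_compositions R C q "mult C" q by (rule two_compositions.intro) (rule comp)+
  interpret A: ranked_composition_algebra vsmul "vmul M0" vone "vnorm S.Q0" e0
    using S.ranked0[OF rank] by (simp add: M0_def S.M0_def m)
  interpret B: composition_algebra vsmul "vmul M0" vone "vnorm Q0" by (rule F.composition)
  interpret N: two_norms vsmul "vmul M0" vone "vnorm S.Q0" e0 "vnorm Q0" ..
  interpret R: cring R by (rule ring0)
  have "sval (e0 * vnorm S.Q0 (li x)) i0 = sval (e0 * vnorm Q0 (li x)) i0"
    by (simp add: N.norms_eq)
  then show ?thesis
    using x comp_on.q_mem[OF comp x] comp_on.q_mem[OF comp' x]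
    by (simp add: sca_simps e0_simps ev_simps S.ev_simps ev_li)
qed

lemma isotope_on_carrier:
  assumes q': "q' = q" and rank: "rank5 R C q"
  shows "\<exists>a\<in>carrier C. \<exists>f\<in>linear_maps R C C. q a = \<one>\<^bsub>R\<^esub> \<and> bij_betw f (carrier C) (carrier C)
    \<and> f \<one>\<^bsub>C\<^esub> = \<one>\<^bsub>C\<^esub>
    \<and> (\<forall>x\<in>carrier C. \<forall>y\<in>carrier C. f (m x y) = (f x \<otimes>\<^bsub>C\<^esub> a) \<otimes>\<^bsub>C\<^esub> (conjugate R C q a \<otimes>\<^bsub>C\<^esub> f y))"
proof -
  interpret S: two_compositions R C q "mult C" q by (rule two_compositions.intro) (rule comp)+
  have Q: "S.Q0 = Q0" unfolding q' ..
  interpret A: composition_algebra vsmul "vmul S.M0" vone "vnorm Q0"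
    using comp_family.composition[OF S.family0] unfolding Q .
  interpret B: ranked_composition_algebra vsmul "vmul M0" vone "vnorm Q0" e0
    using ranked0 rank unfolding q' by blast
  interpret T: two_products vsmul "vmul S.M0" "vmul M0" vone "vnorm Q0" e0 ..
  obtain a \<phi> \<psi> where qa: "vnorm Q0 a = e0" and add: "\<And>x y. \<phi> (x + y) = \<phi> x + \<phi> y"
    and scl: "\<And>r x. \<phi> (vsmul r x) = vsmul r (\<phi> x)" and one: "\<phi> vone = vsmul e0 vone"
    and \<phi>\<psi>: "\<And>x. \<phi> (\<psi> x) = vsmul e0 x" and \<psi>\<phi>: "\<And>x. \<psi> (\<phi> x) = vsmul e0 x"
    and mult: "\<And>x y. \<phi> (vmul M0 x y) = vmul S.M0 (vmul S.M0 (\<phi> x) a) (vmul S.M0 (A.cj a) (\<phi> y))"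
    using T.isotope_exists by blast
  \<comment> \<open>\<open>\<psi>\<close> inverts \<open>\<phi>\<close> up to \<open>e0\<close>, and
    the coordinate at \<open>i0\<close> does not notice \<open>e0\<close>; this makes
    \<open>f\<close> bijective and unital.\<close>
  define f where "f x = ev (\<phi> (li x))" for x
  have f_mem: "f x \<in> carrier C" for x by (simp add: f_def)
  have "f (x \<oplus>\<^bsub>C\<^esub> y) = f x \<oplus>\<^bsub>C\<^esub> f y" if "x \<in> carrier C" "y \<in> carrier C" for x y
    using that by (simp add: f_def li_add scl add ev_e0) (simp add: ev_simps)
  moreover have "f (r \<odot>\<^bsub>C\<^esub> x) = r \<odot>\<^bsub>C\<^esub> f x" if "r \<in> carrier R" "x \<in> carrier C" for r x
    using that by (simp add: f_def li_smult scl ev_e0) (simp add: ev_simps ssing_simps)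
  ultimately have lin: "f \<in> linear_maps R C C" using f_mem by (simp add: linear_maps_def)
  have inj: "inj_on f (carrier C)"
  proof (rule inj_onI)
    fix x y assume x: "x \<in> carrier C" "y \<in> carrier C" and "f x = f y"
    then have "li (ev (\<phi> (li x))) = li (ev (\<phi> (li y)))" by (simp add: f_def)
    then have "\<phi> (vsmul e0 (li x)) = \<phi> (vsmul e0 (li y))" by (simp add: li_ev scl)
    then have "\<psi> (\<phi> (vsmul e0 (li x))) = \<psi> (\<phi> (vsmul e0 (li y)))" by simp
    then have "ev (vsmul e0 (vsmul e0 (li x))) = ev (vsmul e0 (vsmul e0 (li y)))" by (simp add: \<psi>\<phi>)
    then show "x = y" using x by (simp add: ev_e0 ev_li)
  qed
  have surj: "x \<in> f ` carrier C" if x: "x \<in> carrier C" for x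
  proof
    show "x = f (ev (\<psi> (li x)))" using x by (simp add: f_def li_ev scl \<phi>\<psi> ev_e0 ev_li)
  qed simp
  have bij: "bij_betw f (carrier C) (carrier C)"
    using inj surj f_mem by (auto simp: bij_betw_def)
  have f1: "f \<one>\<^bsub>C\<^esub> = \<one>\<^bsub>C\<^esub>"
    by (simp add: f_def li_one scl one ev_e0) (simp add: ev_simps)
  have "q (ev a) = sval (vnorm Q0 a) i0" by (simp add: S.ev_simps q')
  also have "\<dots> = \<one>\<^bsub>R\<^esub>" by (simp add: qa e0_simps)
  finally have q1: "q (ev a) = \<one>\<^bsub>R\<^esub>" .
  have "f (m x y) = (f x \<otimes>\<^bsub>C\<^esub> ev a) \<otimes>\<^bsub>C\<^esub> (conjugate R C q (ev a) \<otimes>\<^bsub>C\<^esub> f y)"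
    if "x \<in> carrier C" "y \<in> carrier C" for x y
    using that ev_cj[of a] by (simp add: f_def li_mult scl mult ev_e0) (simp add: S.ev_simps q')
  then show ?thesis
    using lin bij f1 q1 by (intro bexI[of _ "ev a"] bexI[of _ f]) auto
qed

end

lemma comp_on_identities:
  assumes comp: "comp_on R C (mult C) q"
    and x: "x \<in> carrier C" and y: "y \<in> carrier C"
  shows "conjugate R C q x \<in> carrier C"
    "q (conjugate R C q x) = q x"
    "conjugate R C q x \<otimes>\<^bsub>C\<^esub> (x \<otimes>\<^bsub>C\<^esub> y) = q x \<odot>\<^bsub>C\<^esub> y"
    "x \<otimes>\<^bsub>C\<^esub> (conjugate R C q x \<otimes>\<^bsub>C\<^esub> y) = q x \<odot>\<^bsub>C\<^esub> y"
    "(y \<otimes>\<^bsub>C\<^esub> x) \<otimes>\<^bsub>C\<^esub> conjugate R C q x = q x \<odot>\<^bsub>C\<^esub> y"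
    "(y \<otimes>\<^bsub>C\<^esub> conjugate R C q x) \<otimes>\<^bsub>C\<^esub> x = q x \<odot>\<^bsub>C\<^esub> y"
    "conjugate R C q (x \<otimes>\<^bsub>C\<^esub> y) = conjugate R C q y \<otimes>\<^bsub>C\<^esub> conjugate R C q x"
    "conjugate R C q \<one>\<^bsub>C\<^esub> = \<one>\<^bsub>C\<^esub>"
proof -
  interpret S: two_compositions R C q "mult C" q by (rule two_compositions.intro) (rule comp)+
  interpret A: composition_algebra vsmul "vmul S.M0" vone "vnorm S.Q0"
    using comp_family.composition[OF S.family0] .
  have e: "S.ev (S.li x) = x" "S.ev (S.li y) = y" using x y by (simp_all add: S.ev_li)
  note [simp] = S.ev_simps S.ev_cj e
  show "conjugate R C q x \<in> carrier C"
    using S.mem0(2)[of "A.cj (S.li x)"] by simp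
  show "q (conjugate R C q x) = q x"
    using arg_cong[OF A.q_cj[of "S.li x"], of "\<lambda>v. sval v S.i0"] by simp
  show "conjugate R C q x \<otimes>\<^bsub>C\<^esub> (x \<otimes>\<^bsub>C\<^esub> y) = q x \<odot>\<^bsub>C\<^esub> y"
    using arg_cong[OF A.cj_mu_mu[of "S.li x" "S.li y"], of S.ev] by simp
  show "x \<otimes>\<^bsub>C\<^esub> (conjugate R C q x \<otimes>\<^bsub>C\<^esub> y) = q x \<odot>\<^bsub>C\<^esub> y"
    using arg_cong[OF A.mu_cj_mu[of "S.li x" "S.li y"], of S.ev] by simp
  show "(y \<otimes>\<^bsub>C\<^esub> x) \<otimes>\<^bsub>C\<^esub> conjugate R C q x = q x \<odot>\<^bsub>C\<^esub> y"
    using arg_cong[OF A.mu_mu_cj[of "S.li y" "S.li x"], of S.ev] by simp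
  show "(y \<otimes>\<^bsub>C\<^esub> conjugate R C q x) \<otimes>\<^bsub>C\<^esub> x = q x \<odot>\<^bsub>C\<^esub> y"
    using arg_cong[OF A.mu_cj_mu_right[of "S.li y" "S.li x"], of S.ev] by simp
  show "conjugate R C q (x \<otimes>\<^bsub>C\<^esub> y) = conjugate R C q y \<otimes>\<^bsub>C\<^esub> conjugate R C q x"
    using arg_cong[OF A.cj_mult[of "S.li x" "S.li y"], of S.ev] by simp
  show "conjugate R C q \<one>\<^bsub>C\<^esub> = \<one>\<^bsub>C\<^esub>"
    by (metis A.cj_un S.ev_cj S.ev_simps(4))
qed

lemma linear_mapsD:
  assumes "f \<in> linear_maps R M N"
  shows "x \<in> carrier M \<Longrightarrow> f x \<in> carrier N"
    "x \<in> carrier M \<Longrightarrow> y \<in> carrier M \<Longrightarrow> f (x \<oplus>\<^bsub>M\<^esub> y) = f x \<oplus>\<^bsub>N\<^esub> f y"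
    "r \<in> carrier R \<Longrightarrow> x \<in> carrier M \<Longrightarrow> f (r \<odot>\<^bsub>M\<^esub> x) = r \<odot>\<^bsub>N\<^esub> f x"
  using assms by (auto simp: linear_maps_def)

lemma linear_mapsI:
  assumes "\<And>x. x \<in> carrier M \<Longrightarrow> f x \<in> carrier N"
    "\<And>x y. x \<in> carrier M \<Longrightarrow> y \<in> carrier M \<Longrightarrow> f (x \<oplus>\<^bsub>M\<^esub> y) = f x \<oplus>\<^bsub>N\<^esub> f y"
    "\<And>r x. r \<in> carrier R \<Longrightarrow> x \<in> carrier M \<Longrightarrow> f (r \<odot>\<^bsub>M\<^esub> x) = r \<odot>\<^bsub>N\<^esub> f x"
  shows "f \<in> linear_maps R M N"
  using assms by (simp add: linear_maps_def)

lemma linear_inverse: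
  assumes f: "f \<in> linear_maps R M N" and bij: "bij_betw f (carrier M) (carrier N)" and M: "module R M"
  obtains h where "h \<in> linear_maps R N M" "bij_betw h (carrier N) (carrier M)"
    "\<And>x. x \<in> carrier M \<Longrightarrow> h (f x) = x" "\<And>y. y \<in> carrier N \<Longrightarrow> f (h y) = y"
proof
  interpret module R M by fact
  let ?h = "inv_into (carrier M) f"
  show hf: "?h (f x) = x" if "x \<in> carrier M" for x
    using bij that by (simp add: bij_betw_def inv_into_f_f)
  show fh: "f (?h y) = y" if "y \<in> carrier N" for y
    using bij that by (simp add: bij_betw_def f_inv_into_f)
  show bh: "bij_betw ?h (carrier N) (carrier M)" by (rule bij_betw_inv_into[OF bij])
  have mem: "?h y \<in> carrier M" if "y \<in> carrier N" for y using bh that by (rule bij_betwE[rule_format])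
  show "?h \<in> linear_maps R N M"
  proof (rule linear_mapsI)
    fix x y assume xy: "x \<in> carrier N" "y \<in> carrier N"
    have "x \<oplus>\<^bsub>N\<^esub> y = f (?h x \<oplus>\<^bsub>M\<^esub> ?h y)"
      using xy mem by (simp add: linear_mapsD(2)[OF f] fh)
    then show "?h (x \<oplus>\<^bsub>N\<^esub> y) = ?h x \<oplus>\<^bsub>M\<^esub> ?h y"
      using xy mem by (simp add: hf)
  next
    fix r y assume r: "r \<in> carrier R" and y: "y \<in> carrier N"
    have "r \<odot>\<^bsub>N\<^esub> y = f (r \<odot>\<^bsub>M\<^esub> ?h y)"
      using r y mem by (simp add: linear_mapsD(3)[OF f] fh)
    then show "?h (r \<odot>\<^bsub>N\<^esub> y) = r \<odot>\<^bsub>M\<^esub> ?h y"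
      using r y mem by (simp add: hf)
  qed (rule mem)
qed

lemma isometric_sym:
  assumes "module R M" "isometric R M q N q'"
  shows "isometric R N q' M q"
proof -
  obtain f where f: "f \<in> linear_maps R M N" "bij_betw f (carrier M) (carrier N)"
    and q: "\<And>x. x \<in> carrier M \<Longrightarrow> q' (f x) = q x"
    using assms unfolding isometric_def by blast
  obtain h where h: "h \<in> linear_maps R N M" "bij_betw h (carrier N) (carrier M)"
    "\<And>y. y \<in> carrier N \<Longrightarrow> f (h y) = y"
    using linear_inverse[OF f assms(1)] by metis
  have "q (h y) = q' y" if "y \<in> carrier N" for y
    using q[of "h y"] h(3)[OF that] linear_mapsD(1)[OF h(1) that] by simp
  then show ?thesis using h unfolding isometric_def by blast
qed

lemma comp_on_transport:
  assumes C': "comp_on R C' m' q'" and D: "module R D"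
    and h: "h \<in> linear_maps R D C'" and bij: "bij_betw h (carrier D) (carrier C')"
    and one: "\<one>\<^bsub>D\<^esub> \<in> carrier D" "h \<one>\<^bsub>D\<^esub> = \<one>\<^bsub>C'\<^esub>"
    and m: "\<And>x y. x \<in> carrier D \<Longrightarrow> y \<in> carrier D \<Longrightarrow> m x y \<in> carrier D"
      "\<And>x y. x \<in> carrier D \<Longrightarrow> y \<in> carrier D \<Longrightarrow> h (m x y) = m' (h x) (h y)"
    and q: "\<And>x. x \<in> carrier D \<Longrightarrow> q x = q' (h x)"
  shows "comp_on R D m q"
proof -
  interpret C': comp_on R C' m' q' by fact
  interpret D: module R D by fact
  note hD = linear_mapsD[OF h]
  have inj: "x = y" if "h x = h y" "x \<in> carrier D" "y \<in> carrier D" for x y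
    using bij that by (auto simp: bij_betw_def inj_on_def)
  have pol: "polar R D q x y = polar R C' q' (h x) (h y)" if "x \<in> carrier D" "y \<in> carrier D" for x y
    using that by (simp add: polar_def q hD)
  show ?thesis
  proof (unfold_locales)
    fix x assume x: "x \<in> carrier D" and 0: "\<And>y. y \<in> carrier D \<Longrightarrow> polar R D q x y = \<zero>\<^bsub>R\<^esub>"
    have "polar R C' q' (h x) y = \<zero>\<^bsub>R\<^esub>" if y: "y \<in> carrier C'" for y
    proof -
      obtain z where "z \<in> carrier D" "y = h z" using bij y by (auto simp: bij_betw_def)
      then show ?thesis using 0[of z] pol x by simp
    qed
    then have "h x = \<zero>\<^bsub>C'\<^esub>" using C'.polar_nondeg hD(1)[OF x] by blast
    also have "\<dots> = h \<zero>\<^bsub>D\<^esub>"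
      using hD(3)[of "\<zero>\<^bsub>R\<^esub>" "\<zero>\<^bsub>D\<^esub>"] hD(1)[of "\<zero>\<^bsub>D\<^esub>"] by (simp add: D.smult_l_null C'.smult_l_null)
    finally show "x = \<zero>\<^bsub>D\<^esub>" using x by (intro inj) simp_all
  next
    fix x y z assume "x \<in> carrier D" "y \<in> carrier D" "z \<in> carrier D"
    then show "m (x \<oplus>\<^bsub>D\<^esub> y) z = m x z \<oplus>\<^bsub>D\<^esub> m y z" "m x (y \<oplus>\<^bsub>D\<^esub> z) = m x y \<oplus>\<^bsub>D\<^esub> m x z"
      by (intro inj; simp add: m hD C'.m_add_left C'.m_add_right)+
    show "polar R D q (x \<oplus>\<^bsub>D\<^esub> y) z = polar R D q x z \<oplus>\<^bsub>R\<^esub> polar R D q y z"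
      using \<open>x \<in> carrier D\<close> \<open>y \<in> carrier D\<close> \<open>z \<in> carrier D\<close> by (simp add: pol hD C'.polar_add_left)
  next
    fix r x y assume "r \<in> carrier R" "x \<in> carrier D" "y \<in> carrier D"
    then show "m (r \<odot>\<^bsub>D\<^esub> x) y = r \<odot>\<^bsub>D\<^esub> m x y" "m x (r \<odot>\<^bsub>D\<^esub> y) = r \<odot>\<^bsub>D\<^esub> m x y"
      by (intro inj; simp add: m hD C'.m_smult_left C'.m_smult_right)+
    show "polar R D q (r \<odot>\<^bsub>D\<^esub> x) y = r \<otimes>\<^bsub>R\<^esub> polar R D q x y"
      using \<open>r \<in> carrier R\<close> \<open>x \<in> carrier D\<close> \<open>y \<in> carrier D\<close> by (simp add: pol hD C'.polar_smult_left)
  next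
    fix x assume x: "x \<in> carrier D"
    show "m \<one>\<^bsub>D\<^esub> x = x" "m x \<one>\<^bsub>D\<^esub> = x"
      using x one by (intro inj; simp add: m hD C'.m_one_left C'.m_one_right)+
  qed (use one in \<open>simp_all add: m q hD C'.q_mem C'.q_smul C'.q_m C'.q_one\<close>)
qed

locale octonions = octonion_algebra R C q
  for R :: "('r, 'x) ring_scheme" (structure) and C :: "('r, 'c, 'y) module_scheme" (structure) and q
begin

abbreviation "bar \<equiv> conjugate R C q"

lemmas conj_rules = comp_on_identities[OF comp_on_mult]

lemma conj_closed: "x \<in> carrier C \<Longrightarrow> bar x \<in> carrier C"
  using conj_rules(1) by blast

lemma conj_one: "bar \<one>\<^bsub>C\<^esub> = \<one>\<^bsub>C\<^esub>"
  using conj_rules(8) unit_closed by blast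

lemma inv_norm_one:
  assumes a: "a \<in> carrier C" "q a = \<one>"
  shows "inv\<^bsub>C\<^esub> a = bar a"
  unfolding m_inv_def
proof (rule the_equality)
  show "bar a \<in> carrier C \<and> a \<otimes>\<^bsub>C\<^esub> bar a = \<one>\<^bsub>C\<^esub> \<and> bar a \<otimes>\<^bsub>C\<^esub> a = \<one>\<^bsub>C\<^esub>"
    using conj_rules(3,4)[OF a(1) unit_closed] a conj_closed[OF a(1)]
    by (simp add: mult_unit_right unit_closed smult_one)
  fix y assume y: "y \<in> carrier C \<and> a \<otimes>\<^bsub>C\<^esub> y = \<one>\<^bsub>C\<^esub> \<and> y \<otimes>\<^bsub>C\<^esub> a = \<one>\<^bsub>C\<^esub>"
  then show "y = bar a"
    using conj_rules(3)[OF a(1), of y] a conj_closed[OF a(1)] by (simp add: mult_unit_right smult_one)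
qed

lemma norm_one_conj: "a \<in> norm_one R C q \<Longrightarrow> bar a \<in> norm_one R C q"
  using conj_rules(1,2) by (auto simp: norm_one_def)

lemma mult_add_smult:
  assumes "x \<in> carrier C" "y \<in> carrier C" "z \<in> carrier C"
  shows "x \<otimes>\<^bsub>C\<^esub> (y \<oplus>\<^bsub>C\<^esub> z) = x \<otimes>\<^bsub>C\<^esub> y \<oplus>\<^bsub>C\<^esub> x \<otimes>\<^bsub>C\<^esub> z"
    "(x \<oplus>\<^bsub>C\<^esub> y) \<otimes>\<^bsub>C\<^esub> z = x \<otimes>\<^bsub>C\<^esub> z \<oplus>\<^bsub>C\<^esub> y \<otimes>\<^bsub>C\<^esub> z"
    "r \<in> carrier R \<Longrightarrow> x \<otimes>\<^bsub>C\<^esub> (r \<odot>\<^bsub>C\<^esub> y) = r \<odot>\<^bsub>C\<^esub> (x \<otimes>\<^bsub>C\<^esub> y)"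
    "r \<in> carrier R \<Longrightarrow> (r \<odot>\<^bsub>C\<^esub> x) \<otimes>\<^bsub>C\<^esub> y = r \<odot>\<^bsub>C\<^esub> (x \<otimes>\<^bsub>C\<^esub> y)"
  using comp_on.m_add_left[OF comp_on_mult] comp_on.m_add_right[OF comp_on_mult]
    comp_on.m_smult_left[OF comp_on_mult] comp_on.m_smult_right[OF comp_on_mult] assms by auto

lemma isotope_comp_on:
  assumes a: "a \<in> norm_one R C q" and b: "b \<in> norm_one R C q"
  shows "comp_on R (isotope C a b) (mult (isotope C a b)) q" "module R (isotope C a b)"
proof -
  have a': "a \<in> carrier C" "q a = \<one>" and b': "b \<in> carrier C" "q b = \<one>"
    using a b by (auto simp: norm_one_def)
  have ab: "a \<otimes>\<^bsub>C\<^esub> b \<in> carrier C" "q (a \<otimes>\<^bsub>C\<^esub> b) = \<one>"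
    using a' b' by (auto simp: mult_closed q_mult)
  let ?D = "isotope C a b"
  have D: "carrier ?D = carrier C" "add ?D = add C" "zero ?D = zero C" "smult ?D = smult C"
    "one ?D = bar b \<otimes>\<^bsub>C\<^esub> bar a" "mult ?D = (\<lambda>x y. (x \<otimes>\<^bsub>C\<^esub> a) \<otimes>\<^bsub>C\<^esub> (b \<otimes>\<^bsub>C\<^esub> y))"
    using inv_norm_one[OF ab] conj_rules(7)[OF a'(1) b'(1)] by (simp_all add: isotope_def)
  have "abelian_group ?D"
    by (rule abelian_groupI) (auto simp: D intro: M.a_assoc M.a_comm intro!: bexI[of _ "\<ominus>\<^bsub>C\<^esub> _"] M.l_neg)
  then show mod: "module R ?D"
    by (intro module.intro R.is_cring)
      (auto simp: module_axioms_def D smult_l_distr smult_r_distr smult_assoc1 smult_one)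
  interpret D: module R ?D by (rule mod)
  have pol: "polar R ?D q = polar R C q" by (intro ext) (simp add: polar_def D)
  have cc: "bar a \<in> carrier C" "bar b \<in> carrier C" using a' b' conj_closed by auto
  show "comp_on R ?D (mult ?D) q"
  proof (unfold_locales, unfold D pol)
    fix x assume x: "x \<in> carrier C"
    show "((bar b \<otimes>\<^bsub>C\<^esub> bar a) \<otimes>\<^bsub>C\<^esub> a) \<otimes>\<^bsub>C\<^esub> (b \<otimes>\<^bsub>C\<^esub> x) = x"
      using conj_rules(6)[OF a'(1) cc(2)] conj_rules(3)[OF b'(1) x] a' b' cc x by (simp add: smult_one)
    show "(x \<otimes>\<^bsub>C\<^esub> a) \<otimes>\<^bsub>C\<^esub> (b \<otimes>\<^bsub>C\<^esub> (bar b \<otimes>\<^bsub>C\<^esub> bar a)) = x"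
      using conj_rules(4)[OF b'(1) cc(1)] conj_rules(5)[OF a'(1) x] a' b' cc x by (simp add: smult_one)
    show "q x \<in> carrier R" by (rule q_closed[OF x])
  next
    fix x assume "x \<in> carrier C" "\<And>y. y \<in> carrier C \<Longrightarrow> polar R C q x y = \<zero>"
    then show "x = \<zero>\<^bsub>C\<^esub>" by (rule comp_on.polar_nondeg[OF comp_on_mult])
  next
    have "q (bar a) = \<one>" "q (bar b) = \<one>"
      using conj_rules(2)[OF a'(1) a'(1)] conj_rules(2)[OF b'(1) b'(1)] a' b' by simp_all
    then show "q (bar b \<otimes>\<^bsub>C\<^esub> bar a) = \<one>" using cc by (simp add: q_mult)
  qed (use a' b' cc in \<open>simp_all add: mult_closed mult_add_smult q_mult q_smult q_closed polar_rules\<close>)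
qed

lemma comb5_cong: "smult D = smult C \<Longrightarrow> add D = add C \<Longrightarrow> comb5 D = comb5 C"
  by (intro ext) (simp add: comb5_def)

lemma isotope_rank5: "rank5 R (isotope C a b) q"
proof -
  have "polar R (isotope C a b) q = polar R C q" by (intro ext) (simp add: polar_def isotope_def)
  moreover have "comb5 (isotope C a b) = comb5 C" by (rule comb5_cong) (simp_all add: isotope_def)
  moreover have "carrier (isotope C a b) = carrier C" by (simp add: isotope_def)
  ultimately show ?thesis using rank5 unfolding rank5_def by simp
qed

end

theorem corollary6p7:
  fixes R :: "('r, 'x) ring_scheme"
    and C :: "('r, 'c, 'y) module_scheme"
    and C' :: "('r, 'd, 'z) module_scheme"
    and q :: "'c \<Rightarrow> 'r"
    and q' :: "'d \<Rightarrow> 'r"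
  assumes "cring R"
    and "octonion_algebra R C q"
    and "octonion_algebra R C' q'"
  shows "(isometric R C q C' q' \<longleftrightarrow> similar R C q C' q')
    \<and> (similar R C q C' q' \<longleftrightarrow>
        (\<exists>a\<in>norm_one R C q. \<exists>b\<in>norm_one R C q. algebra_isomorphic R C' (isotope C a b)))
    \<and> ((\<exists>a\<in>norm_one R C q. \<exists>b\<in>norm_one R C q. algebra_isomorphic R C' (isotope C a b)) \<longleftrightarrow>
        (\<exists>a\<in>norm_one R C q. algebra_isomorphic R C' (isotope C a (inv\<^bsub>C\<^esub> a))))
    \<and> (\<forall>a\<in>norm_one R C q. isotope C a (inv\<^bsub>C\<^esub> a) = isotope C a (conjugate R C q a))"
proof -
  interpret C: octonions R C q using assms by (simp add: octonions_def)
  interpret C': octonion_algebra R C' q' by fact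
  have u: "q (C.bar x) = q x" "C.bar x \<in> carrier C" if "x \<in> carrier C" for x
    using C.conj_rules(2)[OF that that] C.conj_closed[OF that] by auto

  have conj: "isotope C a (inv\<^bsub>C\<^esub> a) = isotope C a (conjugate R C q a)" if "a \<in> norm_one R C q" for a
    using that C.inv_norm_one by (simp add: norm_one_def)

  have similar: "similar R C q C' q'" if iso: "isometric R C q C' q'"
  proof -
    obtain f where "f \<in> linear_maps R C' C" "bij_betw f (carrier C') (carrier C)"
      "\<And>x. x \<in> carrier C' \<Longrightarrow> q (f x) = q' x"
      using isometric_sym[OF C.module_axioms iso] unfolding isometric_def by blast
    then have "isometric R C' q' C (\<lambda>x. \<one>\<^bsub>R\<^esub> \<otimes>\<^bsub>R\<^esub> q x)"
      unfolding isometric_def using C'.q_closed linear_mapsD(1) by (intro bexI[of _ f]) auto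
    then show ?thesis unfolding similar_def using C.R.Units_one_closed by blast
  qed

  have unital: "\<exists>k\<in>linear_maps R C' C. bij_betw k (carrier C') (carrier C) \<and>
      (\<forall>x\<in>carrier C'. q (k x) = q' x) \<and> k \<one>\<^bsub>C'\<^esub> = \<one>\<^bsub>C\<^esub>"
    if sim: "similar R C q C' q'"
  proof -
    obtain l f where l: "l \<in> Units R" and f: "f \<in> linear_maps R C' C" "bij_betw f (carrier C') (carrier C)"
      and qf: "\<And>x. x \<in> carrier C' \<Longrightarrow> l \<otimes>\<^bsub>R\<^esub> q (f x) = q' x"
      using sim unfolding similar_def isometric_def by blast
    have lR: "l \<in> carrier R" using l by (rule C.R.Units_closed)
    define w where "w = f \<one>\<^bsub>C'\<^esub>"
    have w: "w \<in> carrier C" using linear_mapsD(1)[OF f(1) C'.unit_closed] by (simp add: w_def)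
    have qw: "l \<otimes>\<^bsub>R\<^esub> q w = \<one>\<^bsub>R\<^esub>" using qf[OF C'.unit_closed] C'.q_unit by (simp add: w_def)
    define k where "k x = l \<odot>\<^bsub>C\<^esub> (C.bar w \<otimes>\<^bsub>C\<^esub> f x)" for x
    have kc: "k x \<in> carrier C" if "x \<in> carrier C'" for x
      using that lR u[OF w] linear_mapsD(1)[OF f(1)] by (simp add: k_def C.mult_closed)
    have lin: "k \<in> linear_maps R C' C"
    proof (rule linear_mapsI)
      show "k (x \<oplus>\<^bsub>C'\<^esub> y) = k x \<oplus>\<^bsub>C\<^esub> k y" if "x \<in> carrier C'" "y \<in> carrier C'" for x y
        using that lR u[OF w] linear_mapsD[OF f(1)]
        by (simp add: k_def C.mult_add_smult C.mult_closed C.smult_r_distr)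
      show "k (r \<odot>\<^bsub>C'\<^esub> x) = r \<odot>\<^bsub>C\<^esub> k x" if "r \<in> carrier R" "x \<in> carrier C'" for r x
        using that lR u[OF w] linear_mapsD[OF f(1)]
        by (simp add: k_def C.mult_add_smult C.mult_closed C.R.m_comm flip: C.smult_assoc1)
    qed (rule kc)
    have wk: "w \<otimes>\<^bsub>C\<^esub> k x = f x" if "x \<in> carrier C'" for x
    proof -
      have fx: "f x \<in> carrier C" using that linear_mapsD(1)[OF f(1)] by blast
      have "w \<otimes>\<^bsub>C\<^esub> k x = l \<odot>\<^bsub>C\<^esub> (w \<otimes>\<^bsub>C\<^esub> (C.bar w \<otimes>\<^bsub>C\<^esub> f x))"
        using lR w u[OF w] fx by (simp add: k_def C.mult_add_smult C.mult_closed)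
      also have "\<dots> = (l \<otimes>\<^bsub>R\<^esub> q w) \<odot>\<^bsub>C\<^esub> f x"
        using C.conj_rules(4)[OF w fx] lR w fx by (simp add: C.smult_assoc1 C.q_closed)
      finally show ?thesis using qw fx by (simp add: C.smult_one)
    qed
    have kw: "l \<odot>\<^bsub>C\<^esub> (C.bar w \<otimes>\<^bsub>C\<^esub> (w \<otimes>\<^bsub>C\<^esub> y)) = y" if y: "y \<in> carrier C" for y
    proof -
      have "l \<odot>\<^bsub>C\<^esub> (C.bar w \<otimes>\<^bsub>C\<^esub> (w \<otimes>\<^bsub>C\<^esub> y)) = (l \<otimes>\<^bsub>R\<^esub> q w) \<odot>\<^bsub>C\<^esub> y"
        using C.conj_rules(3)[OF w y] lR w y by (simp add: C.smult_assoc1 C.q_closed)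
      then show ?thesis using qw y by (simp add: C.smult_one)
    qed
    have "bij_betw k (carrier C') (carrier C)"
    proof (rule bij_betw_imageI)
      show "inj_on k (carrier C')"
      proof (rule inj_onI)
        fix x y assume xy: "x \<in> carrier C'" "y \<in> carrier C'" "k x = k y"
        then have "f x = f y" using wk by metis
        then show "x = y" using f(2) xy by (auto simp: bij_betw_def inj_on_def)
      qed
      show "k ` carrier C' = carrier C"
      proof
        show "carrier C \<subseteq> k ` carrier C'"
        proof
          fix y assume y: "y \<in> carrier C"
          then have "w \<otimes>\<^bsub>C\<^esub> y \<in> f ` carrier C'" using f(2) w by (simp add: bij_betw_def C.mult_closed)
          then obtain x where "x \<in> carrier C'" "f x = w \<otimes>\<^bsub>C\<^esub> y" by auto
          then show "y \<in> k ` carrier C'" using kw[OF y] by (intro image_eqI[of _ _ x]) (simp_all add: k_def)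
        qed
      qed (use kc in auto)
    qed
    moreover have "q (k x) = q' x" if x: "x \<in> carrier C'" for x
    proof -
      have fx: "f x \<in> carrier C" using x linear_mapsD(1)[OF f(1)] by blast
      have "q (k x) = (l \<otimes>\<^bsub>R\<^esub> q w) \<otimes>\<^bsub>R\<^esub> (l \<otimes>\<^bsub>R\<^esub> q (f x))"
        using lR w u[OF w] fx C.q_closed
        by (simp add: k_def C.q_smult C.q_mult C.mult_closed C.R.m_ac)
      then show ?thesis using qw qf[OF x] C'.q_closed[OF x] by simp
    qed
    moreover have "k \<one>\<^bsub>C'\<^esub> = \<one>\<^bsub>C\<^esub>"
      using kw[OF C.unit_closed] w by (simp add: k_def C.mult_unit_right flip: w_def)
    ultimately show ?thesis using lin by blast
  qed

  have isotopic: "\<exists>a\<in>norm_one R C q. algebra_isomorphic R C' (isotope C a (inv\<^bsub>C\<^esub> a))"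
    if sim: "similar R C q C' q'"
  proof -
    obtain k where k: "k \<in> linear_maps R C' C" "bij_betw k (carrier C') (carrier C)"
      and qk: "\<And>x. x \<in> carrier C' \<Longrightarrow> q (k x) = q' x" and k1: "k \<one>\<^bsub>C'\<^esub> = \<one>\<^bsub>C\<^esub>"
      using unital[OF sim] by blast
    obtain h where h: "h \<in> linear_maps R C C'" "bij_betw h (carrier C) (carrier C')"
      and hk: "\<And>x. x \<in> carrier C' \<Longrightarrow> h (k x) = x" and kh: "\<And>y. y \<in> carrier C \<Longrightarrow> k (h y) = y"
      using linear_inverse[OF k C'.module_axioms] by blast
    note kD = linear_mapsD[OF k(1)] and hD = linear_mapsD[OF h(1)]
    \<comment> \<open>The product of \<open>C'\<close> carried over to \<open>C\<close>; because
      \<open>k\<close> is isometric and unital, it has the norm and the unit of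
      \<open>C\<close>.\<close>
    define m where "m x y = k (h x \<otimes>\<^bsub>C'\<^esub> h y)" for x y
    have "comp_on R C m q"
    proof (rule comp_on_transport[OF C'.comp_on_mult C.module_axioms h C.unit_closed])
      show "h \<one>\<^bsub>C\<^esub> = \<one>\<^bsub>C'\<^esub>" using hk[OF C'.unit_closed] by (simp add: k1)
      show "q x = q' (h x)" if "x \<in> carrier C" for x using qk[OF hD(1)[OF that]] kh[OF that] by simp
    qed (simp_all add: m_def kD hD hk C'.mult_closed)
    then interpret T: two_compositions R C q m q
      using C.comp_on_mult by (simp add: two_compositions_def)
    obtain a f where a: "a \<in> carrier C" "q a = \<one>\<^bsub>R\<^esub>" and f: "f \<in> linear_maps R C C"
      "bij_betw f (carrier C) (carrier C)" "f \<one>\<^bsub>C\<^esub> = \<one>\<^bsub>C\<^esub>"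
      and fm: "\<And>x y. x \<in> carrier C \<Longrightarrow> y \<in> carrier C \<Longrightarrow>
        f (m x y) = (f x \<otimes>\<^bsub>C\<^esub> a) \<otimes>\<^bsub>C\<^esub> (C.bar a \<otimes>\<^bsub>C\<^esub> f y)"
      using T.isotope_on_carrier[OF refl C.rank5] by blast
    note fD = linear_mapsD[OF f(1)]
    have ia: "inv\<^bsub>C\<^esub> a = C.bar a" using C.inv_norm_one a by blast
    have "a \<otimes>\<^bsub>C\<^esub> C.bar a = \<one>\<^bsub>C\<^esub>"
      using C.conj_rules(4)[OF a(1) C.unit_closed] a u[OF a(1)]
      by (simp add: C.mult_unit_right C.smult_one C.unit_closed)
    moreover have "inv\<^bsub>C\<^esub> \<one>\<^bsub>C\<^esub> = \<one>\<^bsub>C\<^esub>"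
      using C.inv_norm_one[OF C.unit_closed C.q_unit] C.conj_one by simp
    ultimately have one: "\<one>\<^bsub>isotope C a (inv\<^bsub>C\<^esub> a)\<^esub> = \<one>\<^bsub>C\<^esub>" by (simp add: isotope_def ia)
    have "algebra_isomorphic R C' (isotope C a (inv\<^bsub>C\<^esub> a))"
      unfolding algebra_isomorphic_def
    proof (intro bexI[of _ "\<lambda>x. f (k x)"] conjI ballI)
      show "(\<lambda>x. f (k x)) \<in> linear_maps R C' (isotope C a (inv\<^bsub>C\<^esub> a))"
        by (rule linear_mapsI) (simp_all add: isotope_def kD fD)
      show "bij_betw (\<lambda>x. f (k x)) (carrier C') (carrier (isotope C a (inv\<^bsub>C\<^esub> a)))"
        using bij_betw_trans[OF k(2) f(2)] by (simp add: isotope_def comp_def)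
      show "f (k \<one>\<^bsub>C'\<^esub>) = \<one>\<^bsub>isotope C a (inv\<^bsub>C\<^esub> a)\<^esub>" by (simp add: k1 f(3) one)
      fix x y assume x: "x \<in> carrier C'" and y: "y \<in> carrier C'"
      have "k (x \<otimes>\<^bsub>C'\<^esub> y) = m (k x) (k y)" using x y by (simp add: m_def hk)
      then show "f (k (x \<otimes>\<^bsub>C'\<^esub> y)) = f (k x) \<otimes>\<^bsub>isotope C a (inv\<^bsub>C\<^esub> a)\<^esub> f (k y)"
        using fm[OF kD(1)[OF x] kD(1)[OF y]] by (simp add: isotope_def ia)
    qed
    then show ?thesis using a by (auto simp: norm_one_def)
  qed

  have two: "\<exists>a\<in>norm_one R C q. \<exists>b\<in>norm_one R C q. algebra_isomorphic R C' (isotope C a b)"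
    if "\<exists>a\<in>norm_one R C q. algebra_isomorphic R C' (isotope C a (inv\<^bsub>C\<^esub> a))"
    using that C.norm_one_conj C.inv_norm_one by (auto simp: norm_one_def)

  have isometric: "isometric R C q C' q'"
    if iso: "\<exists>a\<in>norm_one R C q. \<exists>b\<in>norm_one R C q. algebra_isomorphic R C' (isotope C a b)"
  proof -
    obtain a b f where a: "a \<in> norm_one R C q" and b: "b \<in> norm_one R C q"
      and f: "f \<in> linear_maps R C' (isotope C a b)" "bij_betw f (carrier C') (carrier (isotope C a b))"
      and f1: "f \<one>\<^bsub>C'\<^esub> = \<one>\<^bsub>isotope C a b\<^esub>"
      and fm: "\<And>x y. x \<in> carrier C' \<Longrightarrow> y \<in> carrier C' \<Longrightarrow>
        f (x \<otimes>\<^bsub>C'\<^esub> y) = f x \<otimes>\<^bsub>isotope C a b\<^esub> f y"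
      using iso unfolding algebra_isomorphic_def by blast
    let ?D = "isotope C a b"
    note D = C.isotope_comp_on[OF a b]
    interpret D: comp_on R ?D "mult ?D" q by (rule D(1))
    obtain h where h: "h \<in> linear_maps R ?D C'" "bij_betw h (carrier ?D) (carrier C')"
      and hf: "\<And>x. x \<in> carrier C' \<Longrightarrow> h (f x) = x" and fh: "\<And>y. y \<in> carrier ?D \<Longrightarrow> f (h y) = y"
      using linear_inverse[OF f C'.module_axioms] by blast
    have hm: "h (x \<otimes>\<^bsub>?D\<^esub> y) = h x \<otimes>\<^bsub>C'\<^esub> h y" if "x \<in> carrier ?D" "y \<in> carrier ?D" for x y
      using fm[of "h x" "h y"] hf[of "h x \<otimes>\<^bsub>C'\<^esub> h y"] that fh linear_mapsD(1)[OF h(1)] C'.mult_closed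
      by simp
    \<comment> \<open>The norm of \<open>C'\<close>, carried over by \<open>h\<close>, is a second
      composition norm for the product of the isotope, so it must equal \<open>q\<close>.\<close>
    have "comp_on R ?D (mult ?D) (\<lambda>x. q' (h x))"
    proof (rule comp_on_transport[OF C'.comp_on_mult D(2) h D.one_mem])
      show "h \<one>\<^bsub>?D\<^esub> = \<one>\<^bsub>C'\<^esub>" using hf[OF C'.unit_closed] by (simp add: f1)
    qed (simp_all add: D.m_closed hm)
    then interpret T: two_compositions R ?D q "mult ?D" "\<lambda>x. q' (h x)"
      using D(1) by (simp add: two_compositions_def)
    have "q x = q' (h x)" if "x \<in> carrier ?D" for x
      using T.norms_agree[OF refl C.isotope_rank5 that] .
    moreover have "carrier ?D = carrier C" "linear_maps R ?D C' = linear_maps R C C'"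
      by (simp_all add: isotope_def linear_maps_def)
    ultimately show ?thesis using h unfolding isometric_def by (intro bexI[of _ h]) simp_all
  qed

  show ?thesis
    using similar isotopic two isometric conj by (intro conjI) metis+
qed

end
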